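(* Let $\Omega\subset\mathbb{R}^n$ be an open bounded set, $\ell=\operatorname{diam}\Omega$, $x_0\in\Omega$, and let $p(\cdot),\alpha(\cdot)\in WL(\Omega)$ satisfy $1<p_-\le p(x)\le p_+<\infty$ and $$\inf_{x\in\Omega}\alpha(x)>0,\qquad \sup_{x\in\Omega}\alpha(x)p(x)<n.$$ Let $\frac1{q(x)}=\frac1{p(x)}-\frac{\alpha(x)}{n}$ and let the functions $\omega_1$ and $\omega_2$ fulfill $$t^{\alpha(x_0)}\int_0^t\omega_1(r)\frac{dr}{r}\le C\,\omega_2(t),\qquad 0<t<\ell,$$ where $C$ does not depend on $t$. Then the operators $M^{\alpha(\cdot)}$ and $I^{\alpha(\cdot)}$ are bounded from ${}^{\complement}\mathcal{M}^{p(\cdot),\omega_1}_{\{x_0\}}(\Omega)$ to ${}^{\complement}\mathcal{M}^{q(\cdot),\omega_2}_{\{x_0\}}(\Omega)$.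
   Context: $B(x,r)$ is the open ball in $\mathbb{R}^n$, $\widetilde B(x,r)=B(x,r)\cap\Omega$. For measurable $p:\Omega\to[1,\infty)$: $p_-=\operatorname{ess\,inf}_\Omega p$, $p_+=\operatorname{ess\,sup}_\Omega p$, $p'(x)=\frac{p(x)}{p(x)-1}$ (and likewise $q'$). $L^{p(\cdot)}(E)$ is the variable exponent Lebesgue space with the Luxemburg norm $\|f\|_{L^{p(\cdot)}(E)}=\inf\{\eta>0:\int_E|f(x)/\eta|^{p(x)}dx\le1\}$. $WL(\Omega)$ is the class of functions on $\Omega$ with $|p(x)-p(y)|\le\frac{A}{-\ln|x-y|}$ for all $x,y\in\Omega$, $|x-y|\le\frac12$, with $A>0$ independent of $x,y$. The functions $\omega,\omega_1,\omega_2$ are non-negative and measurable on $(0,\ell)$ and bounded outside any neighbourhood $(0,\delta)$ of the origin. The variable exponent generalized local "complementary" Morrey space ${}^{\complement}\mathcal{M}^{p(\cdot),\omega}_{\{x_0\}}(\Omega)$ is defined by the norm $$\|f\|_{{}^{\complement}\mathcal{M}^{p(\cdot),\omega}_{\{x_0\}}(\Omega)}=\sup_{0<r<\ell}\frac{r^{n/p'(x_0)}}{\omega(r)}\|f\|_{L^{p(\cdot)}(\Omega\setminus\widetilde B(x_0,r))},$$ and similarly with $q(\cdot)$ in place of $p(\cdot)$. Standing assumption for each such space: $\sup_{0<r<\ell}\frac{r^{n/p'(x_0)}}{\omega(r)}<\infty$ (with $q'(x_0)$ for the space with exponent $q(\cdot)$); in particular $\omega>0$. The operators are $$I^{\alpha(\cdot)}f(x)=\int_\Omega\frac{f(y)\,dy}{|x-y|^{n-\alpha(x)}},\qquad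 M^{\alpha(\cdot)}f(x)=\sup_{r>0}\frac1{|B(x,r)|^{1-\frac{\alpha(x)}n}}\int_{\widetilde B(x,r)}|f(y)|\,dy.$$ Boundedness means a norm inequality with constant independent of $f$. *)

theory Defs
  imports "HOL-Analysis.Analysis" "HOL-Probability.Essential_Supremum"
begin

text \<open>
  Functions on \<open>\<Omega>\<close> are total functions whose values outside \<open>\<Omega>\<close> are irrelevant.  Euclidean
  space of dimension \<open>n\<close> is a type \<open>'a::euclidean_space\<close> with \<open>n = DIM('a)\<close>.  Norms take values
  in \<open>ennreal\<close>, so that they are defined (possibly infinite) for every function.
\<close>

subsection \<open>Variable exponents\<close>

definition exponent_lower :: "'a::euclidean_space set \<Rightarrow> ('a \<Rightarrow> real) \<Rightarrow> ereal" where
  "exponent_lower \<Omega> p = - esssup (lebesgue_on \<Omega>) (\<lambda>x. - ereal (p x))"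

definition exponent_upper :: "'a::euclidean_space set \<Rightarrow> ('a \<Rightarrow> real) \<Rightarrow> ereal" where
  "exponent_upper \<Omega> p = esssup (lebesgue_on \<Omega>) (\<lambda>x. ereal (p x))"

definition conj_exponent :: "('a \<Rightarrow> real) \<Rightarrow> 'a \<Rightarrow> real" where
  "conj_exponent p x = p x / (p x - 1)"

definition WL :: "'a::euclidean_space set \<Rightarrow> ('a \<Rightarrow> real) set" where
  "WL \<Omega> = {p. \<exists>A>0. \<forall>x\<in>\<Omega>. \<forall>y\<in>\<Omega>. x \<noteq> y \<and> norm (x - y) \<le> 1/2 \<longrightarrow>
     \<bar>p x - p y\<bar> \<le> A / (- ln (norm (x - y)))}"

text \<open>The infimum of the empty set is \<open>\<infinity>\<close> in \<open>ennreal\<close>.\<close>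

definition luxemburg_norm ::
    "('a::euclidean_space \<Rightarrow> real) \<Rightarrow> 'a set \<Rightarrow> ('a \<Rightarrow> real) \<Rightarrow> ennreal" where
  "luxemburg_norm p E f =
     Inf {ennreal \<eta> | \<eta>. \<eta> > 0 \<and> (\<integral>\<^sup>+x\<in>E. ennreal (\<bar>f x / \<eta>\<bar> powr p x) \<partial>lebesgue) \<le> 1}"

subsection \<open>Local complementary Morrey spaces\<close>

abbreviation rel_ball :: "'a::euclidean_space set \<Rightarrow> 'a \<Rightarrow> real \<Rightarrow> 'a set" where
  "rel_ball \<Omega> x r \<equiv> ball x r \<inter> \<Omega>"

text \<open>
  The factor in front of the Lebesgue norm.  Division is that of \<open>ennreal\<close>, where \<open>c / 0 = \<infinity>\<close>
  for \<open>c > 0\<close>; finiteness of the supremum of this factor therefore forces \<open>\<omega> > 0\<close>.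
\<close>

definition morrey_factor ::
    "'a::euclidean_space \<Rightarrow> ('a \<Rightarrow> real) \<Rightarrow> (real \<Rightarrow> real) \<Rightarrow> real \<Rightarrow> ennreal" where
  "morrey_factor x\<^sub>0 p \<omega> r =
     ennreal (r powr (real DIM('a) / conj_exponent p x\<^sub>0)) / ennreal (\<omega> r)"

definition morrey_weight ::
    "'a::euclidean_space set \<Rightarrow> 'a \<Rightarrow> ('a \<Rightarrow> real) \<Rightarrow> (real \<Rightarrow> real) \<Rightarrow> bool" where
  "morrey_weight \<Omega> x\<^sub>0 p \<omega> \<longleftrightarrow>
     (\<forall>r\<in>{0<..<diameter \<Omega>}. 0 \<le> \<omega> r) \<and>
     \<omega> \<in> borel_measurable (lebesgue_on {0<..<diameter \<Omega>}) \<and>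
     (\<forall>\<delta>>0. \<exists>K. \<forall>r. \<delta> \<le> r \<and> r < diameter \<Omega> \<longrightarrow> \<omega> r \<le> K) \<and>
     (SUP r\<in>{0<..<diameter \<Omega>}. morrey_factor x\<^sub>0 p \<omega> r) < \<infinity>"

definition comp_morrey_norm ::
    "'a::euclidean_space set \<Rightarrow> 'a \<Rightarrow> ('a \<Rightarrow> real) \<Rightarrow> (real \<Rightarrow> real) \<Rightarrow> ('a \<Rightarrow> real) \<Rightarrow> ennreal" where
  "comp_morrey_norm \<Omega> x\<^sub>0 p \<omega> f =
     (SUP r\<in>{0<..<diameter \<Omega>}.
        morrey_factor x\<^sub>0 p \<omega> r * luxemburg_norm p (\<Omega> - rel_ball \<Omega> x\<^sub>0 r) f)"

definition comp_morrey_space ::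
    "'a::euclidean_space set \<Rightarrow> 'a \<Rightarrow> ('a \<Rightarrow> real) \<Rightarrow> (real \<Rightarrow> real) \<Rightarrow> ('a \<Rightarrow> real) set" where
  "comp_morrey_space \<Omega> x\<^sub>0 p \<omega> =
     {f \<in> borel_measurable (lebesgue_on \<Omega>). comp_morrey_norm \<Omega> x\<^sub>0 p \<omega> f < \<infinity>}"

subsection \<open>Operators of variable order\<close>

definition riesz_kernel_term ::
    "('a::euclidean_space \<Rightarrow> real) \<Rightarrow> ('a \<Rightarrow> real) \<Rightarrow> 'a \<Rightarrow> 'a \<Rightarrow> real" where
  "riesz_kernel_term \<alpha> f x y = f y / norm (x - y) powr (real DIM('a) - \<alpha> x)"

text \<open>
  The Bochner integral is \<open>0\<close> by convention where the integrand is not integrable, so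
  absolute convergence must be asserted separately.
\<close>

definition riesz_potential ::
    "'a::euclidean_space set \<Rightarrow> ('a \<Rightarrow> real) \<Rightarrow> ('a \<Rightarrow> real) \<Rightarrow> 'a \<Rightarrow> real" where
  "riesz_potential \<Omega> \<alpha> f x = (LINT y:\<Omega>|lebesgue. riesz_kernel_term \<alpha> f x y)"

definition frac_maximal ::
    "'a::euclidean_space set \<Rightarrow> ('a \<Rightarrow> real) \<Rightarrow> ('a \<Rightarrow> real) \<Rightarrow> 'a \<Rightarrow> ennreal" where
  "frac_maximal \<Omega> \<alpha> f x =
     (SUP r\<in>{0<..}. (\<integral>\<^sup>+y\<in>rel_ball \<Omega> x r. ennreal \<bar>f y\<bar> \<partial>lebesgue) /
        ennreal (measure lebesgue (ball x r) powr (1 - \<alpha> x / real DIM('a))))"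

definition bounded_between ::
    "'f set \<Rightarrow> ('f \<Rightarrow> ennreal) \<Rightarrow> 'g set \<Rightarrow> ('g \<Rightarrow> ennreal) \<Rightarrow> ('f \<Rightarrow> 'g) \<Rightarrow> bool" where
  "bounded_between X NX Y NY T \<longleftrightarrow>
     (\<exists>K::real. \<forall>f\<in>X. T f \<in> Y \<and> NY (T f) \<le> ennreal K * NX f)"

end

theory Submission
  imports Defs
begin

text \<open>
  Both operators are dominated by the potential \<open>P f(x)\<close> of \<open>\<bar>f\<bar>\<close> with the kernel
  \<open>\<bar>x - y\<bar>\<close> to the power \<open>\<alpha>(x) - n\<close>: the integral defining the Riesz potential directly, the
  fractional maximal function because the kernel is at least \<open>r\<close> to the power \<open>\<alpha>(x) - n\<close> on
  \<open>B(x,r)\<close>.  So it is enough to bound, for every \<open>t\<close>, the Luxemburg norm of \<open>P f\<close> in the exponent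
  \<open>q\<close> outside \<open>B(x\<^sub>0,t)\<close> (lemma \<open>potential_modular\<close>).  All estimates are made for modulars; on
  the Luxemburg norm a bound \<open>K \<ge> 1\<close> for the modular costs the factor \<open>K\<close>.

  Split \<open>f\<close> at a radius \<open>r\<^sub>0\<close> between \<open>t/4\<close> and \<open>t/2\<close>.  The part of \<open>f\<close> outside \<open>B(x\<^sub>0,r\<^sub>0)\<close> lies
  in the Lebesgue space with exponent \<open>p\<close>, with a norm controlled by \<open>\<omega>\<^sub>1(r\<^sub>0)\<close>, and the Sobolev
  theorem for variable exponents (lemma \<open>sobolev_modular\<close>) takes it to the exponent \<open>q\<close>.  For the
  part inside \<open>B(x\<^sub>0,r\<^sub>0)\<close> the kernel at a point \<open>x\<close> outside \<open>B(x\<^sub>0,t)\<close> is comparable with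
  \<open>\<bar>x - x\<^sub>0\<bar>\<close> to the power \<open>\<alpha>(x) - n\<close>, whose modular outside \<open>B(x\<^sub>0,t)\<close> is explicit (lemma
  \<open>power_tail_le\<close>); what remains is the integral of \<open>\<bar>f\<bar>\<close> over \<open>B(x\<^sub>0,r\<^sub>0)\<close>.  Cut into dyadic
  shells and estimated by the Hoelder inequality, each shell contributes a value of \<open>\<omega>\<^sub>1\<close> at a
  radius of that size (lemma \<open>integral_near_centre_le\<close>).  With the radii chosen so that \<open>\<omega>\<^sub>1\<close> is
  at most a multiple of its logarithmic mean on their dyadic intervals, up to a summable error (lemma
  \<open>dyadic_selection\<close>), these values add up to a multiple of
  the integral in the condition on \<open>\<omega>\<^sub>1\<close> and \<open>\<omega>\<^sub>2\<close>, which is then the estimate asserted.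

  The Sobolev theorem follows the argument of Hedberg.  Let \<open>s > 1\<close> be a lower bound of \<open>p\<close>, and
  let \<open>G\<close> bound the averages of \<open>h = \<bar>f\<bar>\<close> to the power \<open>p/s\<close> over the balls about \<open>x\<close> of radius at
  most 1.  If the modular of \<open>f\<close> is at most 1, then the averages of \<open>\<bar>f\<bar>\<close> are at most a multiple of
  \<open>G\<close> to the power \<open>s/p(x)\<close>; this is Diening's inequality (lemma \<open>average_modular_le\<close>).  It
  controls the potential over \<open>B(x,\<delta>)\<close>, the Hoelder inequality controls the rest (lemma
  \<open>far_potential_le\<close>), and the best \<open>\<delta>\<close> gives a multiple of \<open>G\<close> to the power \<open>s/q(x)\<close>.  The
  integral of \<open>G\<close> to the power \<open>s\<close> is bounded by the Hardy-Littlewood theorem for the constant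
  exponent \<open>s\<close> (lemma \<open>strong_type_covering\<close>), since the integral of \<open>h\<close> to the power \<open>s\<close> is the
  modular of \<open>f\<close>.

  The logarithmic modulus of continuity of \<open>p\<close> enters in one form only: a power \<open>r\<close> to
  \<open>p(x) - p(y)\<close> is bounded as long as \<open>\<bar>x - y\<bar> \<le> r\<close> and \<open>r\<close> is bounded, so that exponents may be
  frozen at one point of a ball.
\<close>

section \<open>Dyadic sums and elementary inequalities\<close>

lemma ball_sets_lebesgue [measurable]: "ball x r \<in> sets lebesgue"
  by (simp add: fmeasurableD)

lemma emeasure_lebesgue_ball:
  fixes x :: "'a::euclidean_space"
  assumes "0 < r"
  shows "emeasure lebesgue (ball x r) = ennreal (unit_ball_vol (real DIM('a)) * r powr real DIM('a))"
  using assms by (simp add: emeasure_ball powr_realpow)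

lemma ennreal_le_suminf: "f k \<le> (\<Sum>k. f k)" for f :: "nat \<Rightarrow> ennreal"
  using sum_le_suminf[of f "{k}"] by simp

lemma suminf_ennreal_geometric:
  assumes "0 \<le> c" "0 \<le> z" "z < 1"
  shows "(\<Sum>k. ennreal (c * z ^ k)) = ennreal (c / (1 - z))"
proof (rule suminf_ennreal_eq)
  show "(\<lambda>k. c * z ^ k) sums (c / (1 - z))"
    using sums_mult[OF geometric_sums, of z c] assms by simp
qed (use assms in auto)

text \<open>
  Sorts the distances from a point into dyadic shells: applied with \<open>z = \<delta>/\<bar>x - y\<bar>\<close> to shells
  shrinking to \<open>x\<close>, and with \<open>z = 2 \<bar>x - y\<bar>/\<delta>\<close> to shells growing from \<open>B(x,\<delta>)\<close>.
\<close>

lemma dyadic_below: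
  fixes z :: real assumes "1 < z"
  obtains k :: nat where "2 ^ k < z" "z \<le> 2 ^ Suc k"
proof -
  define k where "k = (LEAST k. z \<le> 2 ^ Suc k)"
  obtain m :: nat where "z < 2 ^ m"
    using real_arch_pow[of 2 z] by auto
  moreover have "(2::real) ^ m \<le> 2 ^ Suc m" by simp
  ultimately have "z \<le> 2 ^ Suc m" by linarith
  then have 1: "z \<le> 2 ^ Suc k" unfolding k_def by (rule LeastI)
  have "2 ^ k < z"
  proof (cases k)
    case (Suc j)
    then have "\<not> z \<le> 2 ^ Suc j"
      using not_less_Least[of j "\<lambda>k. z \<le> 2 ^ Suc k"] by (auto simp: k_def)
    then show ?thesis using Suc by simp
  qed (use assms in auto)
  with 1 that show ?thesis by blast
qed

text \<open>
  On the shell where \<open>\<bar>x - y\<bar>\<close> is of the size \<open>\<delta> 2^k\<close> the integrand is about the reciprocal of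
  the volume of the shell, times \<open>2^(- k \<epsilon>)\<close>; the shells thus contribute a geometric series whose
  sum depends neither on \<open>x\<close> nor on \<open>\<delta>\<close>.
\<close>

lemma nn_integral_tail_bound:
  fixes x :: "'a::euclidean_space"
  assumes \<epsilon>: "0 < \<epsilon>" and \<delta>: "0 < \<delta>"
  shows "(\<integral>\<^sup>+y\<in>- ball x \<delta>. ennreal (norm (x - y) powr - real DIM('a) * (\<delta> / norm (x - y)) powr \<epsilon>) \<partial>lebesgue)
    \<le> ennreal (unit_ball_vol (real DIM('a)) * 4 powr real DIM('a) / (1 - 2 powr - \<epsilon>))"
proof -
  let ?n = "real DIM('a)"
  let ?V = "unit_ball_vol (real DIM('a))"
  define z where "z = (2::real) powr - \<epsilon>"
  have z: "0 < z" "z < 1" using \<epsilon> by (auto simp: z_def powr_less_one)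
  define a where "a k = (2 ^ k * \<delta>) powr - ?n * z ^ k" for k :: nat
  define B where "B k = ball x (4 * 2 ^ k * \<delta>)" for k :: nat
  have pt: "ennreal (norm (x - y) powr - ?n * (\<delta> / norm (x - y)) powr \<epsilon>) * indicator (- ball x \<delta>) y
      \<le> (\<Sum>k. ennreal (a k) * indicator (B k) y)" for y
  proof (cases "y \<in> ball x \<delta>")
    case False
    define \<rho> where "\<rho> = norm (x - y)"
    have \<rho>: "\<delta> \<le> \<rho>" using False by (auto simp: \<rho>_def dist_norm)
    have "1 < 2 * (\<rho> / \<delta>)" using \<rho> \<delta> by (simp add: field_simps)
    then obtain k where k: "2 ^ k < 2 * (\<rho> / \<delta>)" "2 * (\<rho> / \<delta>) \<le> 2 ^ Suc k"
      by (rule dyadic_below)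
    obtain j where kj: "2 ^ j \<le> \<rho> / \<delta>" "\<rho> / \<delta> < 4 * 2 ^ j"
    proof (cases k)
      case 0
      then have "\<rho> / \<delta> \<le> 1" using k by simp
      then show ?thesis using \<rho> \<delta> by (intro that[of 0]) (auto simp: field_simps)
    next
      case (Suc j)
      define t where "t = (2::real) ^ j"
      have "2 * t < 2 * (\<rho> / \<delta>)" "2 * (\<rho> / \<delta>) \<le> 4 * t" "0 < t" using k Suc by (auto simp: t_def)
      then have "t \<le> \<rho> / \<delta>" "\<rho> / \<delta> < 4 * t" by linarith+
      then show ?thesis using that[of j] by (simp add: t_def)
    qed
    have p: "\<rho> powr - ?n \<le> (2 ^ j * \<delta>) powr - ?n"
      using kj \<rho> \<delta> by (intro powr_mono2') (auto simp: field_simps)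
    have "(\<delta> / \<rho>) powr \<epsilon> \<le> (1 / 2 ^ j) powr \<epsilon>"
      using kj \<rho> \<delta> \<epsilon> by (intro powr_mono2) (auto simp: field_simps)
    also have "\<dots> = z ^ j"
      by (simp add: z_def powr_divide powr_minus powr_realpow[symmetric] powr_powr mult.commute divide_simps)
    finally have "\<rho> powr - ?n * (\<delta> / \<rho>) powr \<epsilon> \<le> a j"
      unfolding a_def by (intro mult_mono p) auto
    moreover have "y \<in> B j" using kj \<delta> by (auto simp: B_def dist_norm \<rho>_def field_simps)
    ultimately have "ennreal (\<rho> powr - ?n * (\<delta> / \<rho>) powr \<epsilon>) \<le> ennreal (a j) * indicator (B j) y"
      by (simp add: ennreal_leI)
    also have "\<dots> \<le> (\<Sum>k. ennreal (a k) * indicator (B k) y)"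
      by (rule ennreal_le_suminf)
    finally show ?thesis
      unfolding \<rho>_def using False by (subst indicator_simps(1)) (simp_all only: Compl_iff not_False_eq_True mult_1_right)
  qed simp
  have "(\<integral>\<^sup>+y\<in>- ball x \<delta>. ennreal (norm (x - y) powr - ?n * (\<delta> / norm (x - y)) powr \<epsilon>) \<partial>lebesgue)
    \<le> (\<integral>\<^sup>+y. (\<Sum>k. ennreal (a k) * indicator (B k) y) \<partial>lebesgue)"
    by (intro nn_integral_mono pt)
  also have "\<dots> = (\<Sum>k. \<integral>\<^sup>+y. ennreal (a k) * indicator (B k) y \<partial>lebesgue)"
    unfolding B_def by (intro nn_integral_suminf) measurable
  also have "\<dots> = (\<Sum>k. ennreal (?V * 4 powr ?n * z ^ k))"
  proof (rule suminf_cong)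
    fix k
    have "(\<integral>\<^sup>+y. ennreal (a k) * indicator (B k) y \<partial>lebesgue) = ennreal (a k) * emeasure lebesgue (B k)"
      by (rule nn_integral_cmult_indicator) (simp add: B_def)
    also have "\<dots> = ennreal (a k * (?V * (4 * 2 ^ k * \<delta>) powr ?n))"
    proof -
      have "0 \<le> a k" using z by (simp add: a_def)
      then show ?thesis using \<delta> unfolding B_def
        by (subst emeasure_lebesgue_ball) (simp_all add: ennreal_mult')
    qed
    also have "a k * (?V * (4 * 2 ^ k * \<delta>) powr ?n) = ?V * 4 powr ?n * z ^ k"
    proof -
      have "(4 * 2 ^ k * \<delta>) powr ?n = 4 powr ?n * (2 ^ k * \<delta>) powr ?n"
        using \<delta> by (simp add: powr_mult mult.assoc)
      moreover have "(2 ^ k * \<delta>) powr - ?n * (2 ^ k * \<delta>) powr ?n = 1"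
        using \<delta> by (simp add: powr_add[symmetric])
      ultimately show ?thesis by (simp add: a_def)
    qed
    finally show "(\<integral>\<^sup>+y. ennreal (a k) * indicator (B k) y \<partial>lebesgue) = ennreal (?V * 4 powr ?n * z ^ k)" .
  qed
  also have "\<dots> = ennreal (?V * 4 powr ?n / (1 - z))"
    using z by (intro suminf_ennreal_geometric) auto
  finally show ?thesis by (simp only: z_def)
qed

text \<open>
  The Young inequality without its sharp constants, which makes it a mere distinction of cases: if
  \<open>b \<le> a powr (p - 1)\<close> the first summand dominates the product, otherwise the second does.  Inserted
  under an integral it replaces the Hoelder inequality with a variable exponent.
\<close>

lemma young_powr:
  fixes a b p :: real
  assumes "0 \<le> a" "0 \<le> b" "1 < p"
  shows "a * b \<le> a powr p + b powr (p / (p - 1))"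
proof (cases "b \<le> a powr (p - 1)")
  case True
  then have "a * b \<le> a * a powr (p - 1)" using assms by (intro mult_left_mono)
  also have "\<dots> = a powr p"
    using assms by (cases "a = 0") (auto simp: powr_diff)
  finally show ?thesis by (simp add: add_increasing2)
next
  case False
  then have "(a powr (p - 1)) powr (1 / (p - 1)) \<le> b powr (1 / (p - 1))"
    using assms by (intro powr_mono2) auto
  then have "a \<le> b powr (1 / (p - 1))" using assms by (simp add: powr_powr)
  then have "a * b \<le> b powr (1 / (p - 1)) * b" using assms by (intro mult_right_mono)
  also have "\<dots> = b powr (1 / (p - 1) + 1)"
    using assms by (cases "b = 0") (simp_all add: powr_add)
  also have "1 / (p - 1) + 1 = p / (p - 1)" using assms by (simp add: field_simps)
  finally show ?thesis by (simp add: add_increasing)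
qed

lemma powr_add_le:
  fixes u v q :: real
  assumes "0 \<le> u" "0 \<le> v" "0 \<le> q"
  shows "(u + v) powr q \<le> 2 powr q * (u powr q + v powr q)"
proof -
  have "(u + v) powr q \<le> (2 * max u v) powr q" using assms by (intro powr_mono2) auto
  also have "\<dots> = 2 powr q * max u v powr q" using assms by (simp add: powr_mult)
  also have "\<dots> \<le> 2 powr q * (u powr q + v powr q)"
    by (intro mult_left_mono) (auto simp: max_def)
  finally show ?thesis .
qed

text \<open>
  A geometric sum is comparable with its last term, and the last level below \<open>u\<close> is at most \<open>u\<close>.
  This turns the sum over the levels \<open>2^k\<close> in the strong type estimate back into a power.
\<close>

lemma sum_dyadic_levels_le:
  fixes b u :: real
  assumes "0 < b" "0 \<le> u"
  shows "(\<Sum>k<m. if 2 ^ k < u then (2 powr b) ^ k else 0) \<le> (2 powr b / (2 powr b - 1)) * u powr b"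
    (is "?S m \<le> ?c * _")
proof (induction m)
  case 0
  have "1 < 2 powr b" using assms by simp
  then show ?case by simp
next
  case (Suc m)
  have r: "1 < 2 powr b" using assms by simp
  show ?case
  proof (cases "2 ^ m < u")
    case True
    have "?S (Suc m) \<le> (\<Sum>k<Suc m. (2 powr b) ^ k)"
      by (rule sum_mono) auto
    also have "\<dots> = ((2 powr b) ^ Suc m - 1) / (2 powr b - 1)"
      using r by (subst geometric_sum) auto
    also have "\<dots> \<le> ?c * (2 powr b) ^ m"
      using r by (simp add: field_simps)
    also have "(2 powr b) ^ m = (2 ^ m) powr b"
      by (simp add: powr_realpow[symmetric] powr_powr mult.commute)
    also have "?c * (2 ^ m) powr b \<le> ?c * u powr b"
    proof (rule mult_left_mono)
      show "(2 ^ m) powr b \<le> u powr b" using True assms by (intro powr_mono2) auto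
      show "0 \<le> ?c" using r by (intro divide_nonneg_nonneg) linarith+
    qed
    finally show ?thesis .
  next
    case False
    then show ?thesis using Suc by simp
  qed
qed

section \<open>The maximal estimate by a covering argument\<close>

text \<open>
  The default rule rewrites the Lebesgue measure of a set into that of a Borel kernel of it,
  which hides the measures of balls.
\<close>

declare emeasure_completion [simp del]

text \<open>
  The weak type inequality of the maximal function for radii at most 1.  The part of \<open>h\<close> below
  \<open>L/(2 V)\<close> has averages that account for only half of the level \<open>L\<close>, so on every ball with a
  large average the part above this threshold has an integral of at least half of \<open>L r^n\<close>.  A
  disjoint subfamily whose fivefold enlargements cover (the Vitali lemma) then bounds the measure of
  the exceptional set.  A measurable set \<open>E\<close> containing the bad points is enough later on, so that
  the maximal function itself need not be introduced.
\<close>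

lemma weak_type_covering:
  fixes h :: "'a::euclidean_space \<Rightarrow> real"
  assumes [measurable]: "h \<in> borel_measurable lebesgue" and h0: "\<And>x. 0 \<le> h x" and L: "0 < L"
  defines "V \<equiv> unit_ball_vol (real DIM('a))"
  shows "\<exists>E\<in>sets lebesgue.
    emeasure lebesgue E \<le> ennreal (2 * 5 powr real DIM('a) * V / L) *
        (\<integral>\<^sup>+y. (if L < 2 * V * h y then ennreal (h y) else 0) \<partial>lebesgue) \<and>
    (\<forall>x. x \<notin> E \<longrightarrow> (\<forall>r. 0 < r \<and> r \<le> 1 \<longrightarrow>
        (\<integral>\<^sup>+y\<in>ball x r. ennreal (h y) \<partial>lebesgue) \<le> ennreal (L * r powr real DIM('a))))"
proof -
  let ?n = "real DIM('a)"
  have V: "0 < V" by (simp add: V_def)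
  define H where "H y = (if L < 2 * V * h y then ennreal (h y) else 0)" for y
  have [measurable]: "H \<in> borel_measurable lebesgue" unfolding H_def by measurable
  define K where "K = {(x, r). 0 < r \<and> r \<le> 1 \<and>
     ennreal (L * r powr ?n) < (\<integral>\<^sup>+y\<in>ball x r. ennreal (h y) \<partial>lebesgue)}"
  obtain C where C: "countable C" "C \<subseteq> K"
     "pairwise (\<lambda>i j. disjnt (ball (fst i) (snd i)) (ball (fst j) (snd j))) C"
     "(\<Union>i\<in>K. ball (fst i) (snd i)) \<subseteq> (\<Union>i\<in>C. ball (fst i) (5 * snd i))"
  proof (rule Vitali_covering_lemma_balls
      [where S = "\<Union>i\<in>K. ball (fst i) (snd i)" and K = K and a = fst and r = snd and B = 1])
    show "0 < snd i \<and> snd i \<le> 1" if "i \<in> K" for i using that by (auto simp: K_def)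
  qed (use that in blast)+
  have ball5: "emeasure lebesgue (ball (fst i) (5 * snd i)) \<le>
      ennreal (2 * 5 powr ?n * V / L) * (\<integral>\<^sup>+y\<in>ball (fst i) (snd i). H y \<partial>lebesgue)"
    if "i \<in> C" for i
  proof -
    obtain x r where i: "i = (x, r)" by (cases i)
    then have r: "0 < r" "r \<le> 1"
      "ennreal (L * r powr ?n) < (\<integral>\<^sup>+y\<in>ball x r. ennreal (h y) \<partial>lebesgue)"
      using that C by (auto simp: K_def)
    have "ennreal (L * r powr ?n) \<le> (\<integral>\<^sup>+y\<in>ball x r. ennreal (h y) \<partial>lebesgue)" using r by simp
    also have "\<dots> \<le> (\<integral>\<^sup>+y. H y * indicator (ball x r) y + ennreal (L / (2 * V)) * indicator (ball x r) y \<partial>lebesgue)"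
    proof (intro nn_integral_mono)
      fix y
      show "ennreal (h y) * indicator (ball x r) y
          \<le> H y * indicator (ball x r) y + ennreal (L / (2 * V)) * indicator (ball x r) y"
        using V by (auto simp: H_def indicator_def field_simps intro!: ennreal_leI)
    qed
    also have "\<dots> = (\<integral>\<^sup>+y\<in>ball x r. H y \<partial>lebesgue) + ennreal (L / (2 * V)) * emeasure lebesgue (ball x r)"
      by (subst nn_integral_add) (auto simp: nn_integral_cmult_indicator)
    also have "ennreal (L / (2 * V)) * emeasure lebesgue (ball x r) = ennreal (L / 2 * r powr ?n)"
      using r V L by (subst emeasure_lebesgue_ball) (simp_all add: ennreal_mult'[symmetric] V_def[symmetric])
    finally have *: "ennreal (L * r powr ?n) \<le> (\<integral>\<^sup>+y\<in>ball x r. H y \<partial>lebesgue) + ennreal (L / 2 * r powr ?n)" .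
    have half: "ennreal (L / 2 * r powr ?n) \<le> (\<integral>\<^sup>+y\<in>ball x r. H y \<partial>lebesgue)"
    proof -
      have "ennreal (L / 2 * r powr ?n) + ennreal (L / 2 * r powr ?n) = ennreal (L * r powr ?n)"
        using L by (subst ennreal_plus[symmetric]) auto
      then have "ennreal (L / 2 * r powr ?n) + ennreal (L / 2 * r powr ?n) \<le>
         ennreal (L / 2 * r powr ?n) + (\<integral>\<^sup>+y\<in>ball x r. H y \<partial>lebesgue)"
        using * by (simp add: add.commute)
      then show ?thesis by (subst (asm) ennreal_add_left_cancel_le) auto
    qed
    have "emeasure lebesgue (ball x (5 * r)) = ennreal (V * (5 * r) powr ?n)"
      using r by (simp add: emeasure_lebesgue_ball V_def)
    also have "V * (5 * r) powr ?n = 2 * 5 powr ?n * V / L * (L / 2 * r powr ?n)"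
      using r L by (simp add: powr_mult)
    also have "ennreal \<dots> = ennreal (2 * 5 powr ?n * V / L) * ennreal (L / 2 * r powr ?n)"
      using L V by (intro ennreal_mult) auto
    also have "\<dots> \<le> ennreal (2 * 5 powr ?n * V / L) * (\<integral>\<^sup>+y\<in>ball x r. H y \<partial>lebesgue)"
      by (intro mult_left_mono half) auto
    finally show ?thesis by (simp add: i)
  qed
  \<comment> \<open>The countable family is indexed by natural numbers, with empty sets at unused indices.\<close>
  define D where "D = to_nat_on C ` C"
  define A where "A k = (if k \<in> D then ball (fst (from_nat_into C k)) (5 * snd (from_nat_into C k)) else {})" for k
  define B where "B k = (if k \<in> D then ball (fst (from_nat_into C k)) (snd (from_nat_into C k)) else {})" for k
  have D: "from_nat_into C k \<in> C" "to_nat_on C (from_nat_into C k) = k" if "k \<in> D" for k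
    using that C(1) by (auto simp: D_def)
  have disj: "disjoint_family B"
    unfolding disjoint_family_on_def
  proof (intro ballI impI)
    fix k l :: nat assume kl: "k \<noteq> l"
    show "B k \<inter> B l = {}"
    proof (cases "k \<in> D \<and> l \<in> D")
      case True
      then have "from_nat_into C k \<noteq> from_nat_into C l" using D kl by metis
      then show ?thesis using pairwiseD[OF C(3), of "from_nat_into C k" "from_nat_into C l"] D True
        by (auto simp: B_def disjnt_def)
    qed (auto simp: B_def)
  qed
  have [measurable]: "A k \<in> sets lebesgue" "B k \<in> sets lebesgue" for k
    by (auto simp: A_def B_def)
  define E where "E = (\<Union>k. A k)"
  have E: "E = (\<Union>i\<in>C. ball (fst i) (5 * snd i))"
  proof (rule set_eqI)
    fix x
    have "(\<exists>k. x \<in> A k) \<longleftrightarrow> (\<exists>k\<in>D. x \<in> ball (fst (from_nat_into C k)) (5 * snd (from_nat_into C k)))"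
      by (auto simp: A_def split: if_splits)
    also have "\<dots> \<longleftrightarrow> (\<exists>i\<in>C. x \<in> ball (fst i) (5 * snd i))"
      using C(1) by (auto simp: D_def)
    finally show "x \<in> E \<longleftrightarrow> x \<in> (\<Union>i\<in>C. ball (fst i) (5 * snd i))" by (auto simp: E_def)
  qed
  have "emeasure lebesgue E \<le> (\<Sum>k. emeasure lebesgue (A k))"
    unfolding E_def by (rule emeasure_subadditive_countably) auto
  also have "\<dots> \<le> (\<Sum>k. ennreal (2 * 5 powr ?n * V / L) * (\<integral>\<^sup>+y\<in>B k. H y \<partial>lebesgue))"
    using ball5[OF D(1)] by (intro suminf_le) (auto simp: A_def B_def)
  also have "\<dots> = ennreal (2 * 5 powr ?n * V / L) * (\<Sum>k. \<integral>\<^sup>+y\<in>B k. H y \<partial>lebesgue)"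
    by simp
  also have "(\<Sum>k. \<integral>\<^sup>+y\<in>B k. H y \<partial>lebesgue) = (\<integral>\<^sup>+y\<in>(\<Union>k. B k). H y \<partial>lebesgue)"
    by (rule nn_integral_disjoint_family[symmetric]) (auto simp: disj)
  also have "\<dots> \<le> (\<integral>\<^sup>+y. H y \<partial>lebesgue)"
    by (intro nn_integral_mono) (auto simp: indicator_def)
  finally have 1: "emeasure lebesgue E \<le> ennreal (2 * 5 powr ?n * V / L) * (\<integral>\<^sup>+y. H y \<partial>lebesgue)"
    by (simp add: mult_left_mono)
  have 2: "(\<integral>\<^sup>+y\<in>ball x r. ennreal (h y) \<partial>lebesgue) \<le> ennreal (L * r powr ?n)"
    if "x \<notin> E" "0 < r" "r \<le> 1" for x r
  proof (rule ccontr)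
    assume "\<not> ?thesis"
    then have "(x, r) \<in> K" using that by (auto simp: K_def)
    then have "x \<in> (\<Union>i\<in>K. ball (fst i) (snd i))" using that by force
    then show False using C(4) E that by blast
  qed
  have "E \<in> sets lebesgue" unfolding E_def by measurable
  with 1 2 show ?thesis unfolding H_def by blast
qed

text \<open>
  The Hardy-Littlewood theorem, with a majorant \<open>1 + g\<close> in place of the maximal function: \<open>g\<close> is the
  sum of the exceptional sets \<open>E k\<close> of the weak type inequality at the levels \<open>2^k\<close>, weighted by
  \<open>2^((k + 1) s)\<close>.  At a point where \<open>g\<close> is finite, some level \<open>2^k\<close> is not exceeded, and for the
  least one \<open>G = 2^k\<close> satisfies \<open>G^s \<le> g\<close> because the point lies in \<open>E (k - 1)\<close>.  Levels below 1
  are absorbed by the summand 1, which is harmless on a set of finite measure.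
\<close>

lemma strong_type_covering:
  fixes h :: "'a::euclidean_space \<Rightarrow> real"
  assumes s: "1 < s" and h [measurable]: "h \<in> borel_measurable lebesgue" and h0: "\<And>x. 0 \<le> h x"
  defines "V \<equiv> unit_ball_vol (real DIM('a))"
  defines "C \<equiv> 2 * 5 powr real DIM('a) * V * 2 powr s *
    (2 powr (s - 1) / (2 powr (s - 1) - 1) * (2 * V) powr (s - 1))"
  shows "\<exists>g\<in>borel_measurable lebesgue.
        (\<integral>\<^sup>+x. g x \<partial>lebesgue) \<le> ennreal C * (\<integral>\<^sup>+x. ennreal (h x powr s) \<partial>lebesgue) \<and>
        (\<forall>x. g x < \<infinity> \<longrightarrow> (\<exists>G\<ge>1. ennreal (G powr s) \<le> 1 + g x \<and>
           (\<forall>r. 0 < r \<and> r \<le> 1 \<longrightarrow>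
              (\<integral>\<^sup>+y\<in>ball x r. ennreal (h y) \<partial>lebesgue) \<le> ennreal (G * r powr real DIM('a)))))"
proof -
  let ?n = "real DIM('a)"
  have V: "0 < V" by (simp add: V_def)
  define b where "b = s - 1"
  have b: "0 < b" using s by (simp add: b_def)
  define c where "c = 2 powr b / (2 powr b - 1)"
  have "1 < 2 powr b" using b by (simp add: gr_one_powr)
  then have c: "0 < c" unfolding c_def by (intro divide_pos_pos) linarith+
  define K where "K = 2 * 5 powr ?n * V * 2 powr s"
  have K: "0 < K" using V by (simp add: K_def)
  have C_eq: "C = K * (c * (2 * V) powr b)" by (simp add: C_def K_def c_def b_def)
  then have C: "0 < C" using V K c by simp
  define Q where "Q k F \<longleftrightarrow> F \<in> sets lebesgue \<and>
    emeasure lebesgue F \<le> ennreal (2 * 5 powr ?n * V / 2 ^ k) *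
      (\<integral>\<^sup>+y. (if 2 ^ k < 2 * V * h y then ennreal (h y) else 0) \<partial>lebesgue) \<and>
    (\<forall>x. x \<notin> F \<longrightarrow> (\<forall>r. 0 < r \<and> r \<le> 1 \<longrightarrow>
      (\<integral>\<^sup>+y\<in>ball x r. ennreal (h y) \<partial>lebesgue) \<le> ennreal (2 ^ k * r powr ?n)))"
    for k :: nat and F
  have "\<exists>F. Q k F" for k
    using weak_type_covering[OF h h0, of "2 ^ k", simplified] unfolding V_def[symmetric] Q_def
    by blast
  then have "\<forall>k. \<exists>F. Q k F" by blast
  then obtain E where "\<forall>k. Q k (E k)" using choice by blast
  then have E [measurable]: "\<And>k::nat. E k \<in> sets lebesgue" and
    Em: "\<And>k. emeasure lebesgue (E k) \<le> ennreal (2 * 5 powr ?n * V / 2 ^ k) *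
      (\<integral>\<^sup>+y. (if 2 ^ k < 2 * V * h y then ennreal (h y) else 0) \<partial>lebesgue)" and
    Ea: "\<And>k x r. x \<notin> E k \<Longrightarrow> 0 < r \<Longrightarrow> r \<le> 1 \<Longrightarrow>
      (\<integral>\<^sup>+y\<in>ball x r. ennreal (h y) \<partial>lebesgue) \<le> ennreal (2 ^ k * r powr ?n)"
    unfolding Q_def by blast+
  define w where "w k = (2 ^ Suc k) powr s" for k :: nat
  define g where "g x = (\<Sum>k. ennreal (w k) * indicator (E k) x)" for x
  have g [measurable]: "g \<in> borel_measurable lebesgue" unfolding g_def by measurable
  define u where "u y k = (if 2 ^ k < 2 * V * h y then (2 powr b) ^ k else 0)" for y and k :: nat
  have u0: "0 \<le> u y k" for y k by (simp add: u_def)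
  have [measurable]: "(\<lambda>y. u y k) \<in> borel_measurable lebesgue" for k unfolding u_def by measurable
  have "(\<integral>\<^sup>+x. g x \<partial>lebesgue) = (\<Sum>k. \<integral>\<^sup>+x. ennreal (w k) * indicator (E k) x \<partial>lebesgue)"
    unfolding g_def by (intro nn_integral_suminf) measurable
  also have "\<dots> = (\<Sum>k. ennreal (w k) * emeasure lebesgue (E k))"
    by (simp add: nn_integral_cmult_indicator)
  also have "\<dots> \<le> (\<Sum>k. \<integral>\<^sup>+y. ennreal (K * u y k) * ennreal (h y) \<partial>lebesgue)"
  proof (intro suminf_le summableI)
    fix k
    have wk: "w k * (2 * 5 powr ?n * V / 2 ^ k) = K * (2 powr b) ^ k"
    proof -
      have "w k = 2 powr s * (2 ^ k) powr s" by (simp add: w_def powr_mult)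
      also have "(2 ^ k) powr s = (2 ^ k) powr b * 2 ^ k" 
        by (simp add: b_def powr_diff)
      also have "(2 ^ k) powr b = (2 powr b) ^ k"
        by (simp add: powr_realpow[symmetric] powr_powr mult.commute)
      finally show ?thesis by (simp add: K_def)
    qed
    have "ennreal (w k) * emeasure lebesgue (E k) \<le> ennreal (w k) * (ennreal (2 * 5 powr ?n * V / 2 ^ k) *
      (\<integral>\<^sup>+y. (if 2 ^ k < 2 * V * h y then ennreal (h y) else 0) \<partial>lebesgue))"
      by (intro mult_left_mono Em) auto
    also have "\<dots> = ennreal (K * (2 powr b) ^ k) *
        (\<integral>\<^sup>+y. (if 2 ^ k < 2 * V * h y then ennreal (h y) else 0) \<partial>lebesgue)"
      using V wk by (simp add: mult.assoc[symmetric] ennreal_mult'[symmetric] w_def)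
    also have "\<dots> = (\<integral>\<^sup>+y. ennreal (K * (2 powr b) ^ k) * (if 2 ^ k < 2 * V * h y then ennreal (h y) else 0) \<partial>lebesgue)"
      by (intro nn_integral_cmult[symmetric]) measurable
    also have "\<dots> = (\<integral>\<^sup>+y. ennreal (K * u y k) * ennreal (h y) \<partial>lebesgue)"
      by (intro nn_integral_cong) (simp add: u_def)
    finally show "ennreal (w k) * emeasure lebesgue (E k) \<le> (\<integral>\<^sup>+y. ennreal (K * u y k) * ennreal (h y) \<partial>lebesgue)" .
  qed
  also have "\<dots> = (\<integral>\<^sup>+y. (\<Sum>k. ennreal (K * u y k) * ennreal (h y)) \<partial>lebesgue)"
    by (intro nn_integral_suminf[symmetric]) measurable
  also have "\<dots> \<le> (\<integral>\<^sup>+y. ennreal C * ennreal (h y powr s) \<partial>lebesgue)"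
  proof (intro nn_integral_mono)
    fix y
    have "(\<Sum>k. ennreal (u y k)) \<le> ennreal (c * (2 * V * h y) powr b)"
    proof (rule suminf_le_const)
      fix m
      have "(\<Sum>k<m. ennreal (u y k)) = ennreal (\<Sum>k<m. u y k)"
        by (simp add: u0 sum_ennreal)
      also have "\<dots> \<le> ennreal (c * (2 * V * h y) powr b)"
        unfolding u_def c_def using V h0 b by (intro ennreal_leI sum_dyadic_levels_le) auto
      finally show "(\<Sum>k<m. ennreal (u y k)) \<le> ennreal (c * (2 * V * h y) powr b)" .
    qed auto
    then have "ennreal K * (\<Sum>k. ennreal (u y k)) * ennreal (h y) \<le>
       ennreal K * ennreal (c * (2 * V * h y) powr b) * ennreal (h y)"
      by (intro mult_left_mono mult_right_mono) auto
    also have "ennreal K * ennreal (c * (2 * V * h y) powr b) * ennreal (h y) =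
        ennreal (K * (c * (2 * V * h y) powr b) * h y)"
      using K c h0 by (simp add: ennreal_mult'[symmetric])
    also have "K * (c * (2 * V * h y) powr b) * h y = C * h y powr s"
    proof -
      have "h y powr b * h y = h y powr s"
        using h0[of y] by (cases "h y = 0") (auto simp: b_def powr_diff)
      then show ?thesis using V h0[of y] by (simp add: C_eq powr_mult)
    qed
    finally show "(\<Sum>k. ennreal (K * u y k) * ennreal (h y)) \<le> ennreal C * ennreal (h y powr s)"
      using K C by (simp add: ennreal_mult')
  qed
  also have "\<dots> = ennreal C * (\<integral>\<^sup>+x. ennreal (h x powr s) \<partial>lebesgue)"
    by (intro nn_integral_cmult) measurable
  finally have 1: "(\<integral>\<^sup>+x. g x \<partial>lebesgue) \<le> ennreal C * (\<integral>\<^sup>+x. ennreal (h x powr s) \<partial>lebesgue)" .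
  have 2: "\<exists>G\<ge>1. ennreal (G powr s) \<le> 1 + g x \<and>
         (\<forall>r. 0 < r \<and> r \<le> 1 \<longrightarrow>
            (\<integral>\<^sup>+y\<in>ball x r. ennreal (h y) \<partial>lebesgue) \<le> ennreal (G * r powr ?n))"
    if fin: "g x < \<infinity>" for x
  proof -
    have "\<exists>k. x \<notin> E k"
    proof (rule ccontr)
      assume "\<not> ?thesis"
      then have "g x = (\<Sum>k. ennreal (w k))" by (simp add: g_def)
      moreover have "(\<Sum>k. 1) \<le> (\<Sum>k. ennreal (w k))"
      proof (intro suminf_le summableI)
        fix k
        have "1 \<le> w k"
          unfolding w_def using s by (intro ge_one_powr_ge_zero one_le_power) auto
        then show "1 \<le> ennreal (w k)" using ennreal_leI by fastforce
      qed
      moreover have "(\<Sum>k::nat. 1) = (\<infinity>::ennreal)"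
        using nn_integral_count_space_nat[of "\<lambda>_. 1"] by simp
      ultimately show False using fin by (simp add: top_unique)
    qed
    define k where "k = (LEAST k. x \<notin> E k)"
    have k: "x \<notin> E k" unfolding k_def by (rule LeastI_ex) fact
    have "ennreal ((2 ^ k) powr s) \<le> 1 + g x"
    proof (cases k)
      case 0 then show ?thesis by simp
    next
      case (Suc j)
      then have "x \<in> E j" using not_less_Least[of j "\<lambda>k. x \<notin> E k"] by (auto simp: k_def)
      then have "ennreal ((2 ^ k) powr s) \<le> g x"
        unfolding g_def Suc using ennreal_le_suminf[of "\<lambda>k. ennreal (w k) * indicator (E k) x" j]
        by (simp add: w_def)
      then show ?thesis by (simp add: add_increasing)
    qed
    then show ?thesis using Ea[OF k] by (intro exI[of _ "2 ^ k"]) auto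
  qed
  show ?thesis using g 1 2 by blast
qed

section \<open>Potentials and exponents with a logarithmic modulus of continuity\<close>

definition pos_potential :: "('a::euclidean_space \<Rightarrow> real) \<Rightarrow> ('a \<Rightarrow> real) \<Rightarrow> 'a \<Rightarrow> ennreal" where
  "pos_potential \<alpha> f x = (\<integral>\<^sup>+y. ennreal (f y / norm (x - y) powr (real DIM('a) - \<alpha> x)) \<partial>lebesgue)"

lemma powr_le_exp:
  fixes r :: real
  assumes "0 < r" "\<bar>c\<bar> * \<bar>ln r\<bar> \<le> B"
  shows "r powr c \<le> exp B"
proof -
  have "c * ln r \<le> \<bar>c * ln r\<bar>" by simp
  also have "\<dots> \<le> B" using assms by (simp add: abs_mult)
  finally show ?thesis using assms by (simp add: powr_def)
qed

text \<open>
  On the shell where \<open>\<bar>x - y\<bar>\<close> is of the size \<open>\<delta> 2^(- k)\<close> the kernel is constant up to a factor,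
  and the bound on averages leaves \<open>(\<delta> 2^(- k))^\<alpha>\<close>; these powers are summable because \<open>\<alpha> \<ge> a0 > 0\<close>.
\<close>

lemma near_potential_le:
  fixes f :: "'a::euclidean_space \<Rightarrow> real"
  assumes [measurable]: "f \<in> borel_measurable lebesgue" and f0: "\<And>y. 0 \<le> f y"
    and a0: "0 < a0" and \<alpha>: "a0 \<le> \<alpha>" "\<alpha> \<le> real DIM('a)"
    and \<Phi>: "0 \<le> \<Phi>" and \<delta>: "0 < \<delta>" "\<delta> \<le> 1"
    and avg: "\<And>r. 0 < r \<Longrightarrow> r \<le> 1 \<Longrightarrow>
      (\<integral>\<^sup>+y\<in>ball x r. ennreal (f y) \<partial>lebesgue) \<le> ennreal (\<Phi> * r powr real DIM('a))"
  shows "(\<integral>\<^sup>+y\<in>ball x \<delta>. ennreal (f y / norm (x - y) powr (real DIM('a) - \<alpha>)) \<partial>lebesgue)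
    \<le> ennreal (2 powr real DIM('a) / (1 - 2 powr - a0) * \<Phi> * \<delta> powr \<alpha>)"
proof -
  let ?n = "real DIM('a)"
  define z where "z = (2::real) powr - a0"
  have z: "0 < z" "z < 1" using a0 by (auto simp: z_def powr_less_one)
  define w where "w k = (\<delta> / 2 ^ Suc k) powr (\<alpha> - ?n)" for k :: nat
  define B where "B k = ball x (\<delta> / 2 ^ k)" for k :: nat
  have [measurable]: "B k \<in> sets lebesgue" for k by (simp add: B_def)
  have pt: "ennreal (f y / norm (x - y) powr (?n - \<alpha>)) * indicator (ball x \<delta>) y
      \<le> (\<Sum>k. ennreal (w k) * (ennreal (f y) * indicator (B k) y))" for y
  proof (cases "y \<in> ball x \<delta> \<and> y \<noteq> x")
    case True
    define \<rho> where "\<rho> = norm (x - y)"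
    have \<rho>: "0 < \<rho>" "\<rho> < \<delta>" using True by (auto simp: \<rho>_def dist_norm)
    have "1 < \<delta> / \<rho>" using \<rho> by simp
    then obtain k where k: "2 ^ k < \<delta> / \<rho>" "\<delta> / \<rho> \<le> 2 ^ Suc k" by (rule dyadic_below)
    have "\<delta> / 2 ^ Suc k \<le> \<rho>" using k \<rho> by (simp add: field_simps)
    then have "\<rho> powr (\<alpha> - ?n) \<le> w k"
      unfolding w_def using \<delta> \<alpha> by (intro powr_mono2') auto
    moreover have "\<rho> powr (\<alpha> - ?n) = inverse (\<rho> powr (?n - \<alpha>))" by (simp add: powr_minus[symmetric])
    ultimately have "f y / \<rho> powr (?n - \<alpha>) \<le> w k * f y"
      using f0[of y] by (simp add: divide_inverse mult.commute mult_left_mono)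
    moreover have "y \<in> B k" using k \<rho> by (simp add: B_def dist_norm \<rho>_def[symmetric] field_simps)
    ultimately have "ennreal (f y / \<rho> powr (?n - \<alpha>)) \<le> ennreal (w k) * (ennreal (f y) * indicator (B k) y)"
      using f0[of y] by (simp add: ennreal_mult'[symmetric] w_def ennreal_leI)
    also have "\<dots> \<le> (\<Sum>k. ennreal (w k) * (ennreal (f y) * indicator (B k) y))"
      by (rule ennreal_le_suminf)
    finally show ?thesis using True by (simp add: \<rho>_def)
  qed auto
  have "(\<integral>\<^sup>+y\<in>ball x \<delta>. ennreal (f y / norm (x - y) powr (?n - \<alpha>)) \<partial>lebesgue)
     \<le> (\<integral>\<^sup>+y. (\<Sum>k. ennreal (w k) * (ennreal (f y) * indicator (B k) y)) \<partial>lebesgue)"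
    by (intro nn_integral_mono pt)
  also have "\<dots> = (\<Sum>k. \<integral>\<^sup>+y. ennreal (w k) * (ennreal (f y) * indicator (B k) y) \<partial>lebesgue)"
    by (intro nn_integral_suminf) measurable
  also have "\<dots> = (\<Sum>k. ennreal (w k) * (\<integral>\<^sup>+y\<in>B k. ennreal (f y) \<partial>lebesgue))"
    by (intro suminf_cong nn_integral_cmult) measurable
  also have "\<dots> \<le> (\<Sum>k. ennreal ((2 powr ?n * \<Phi> * \<delta> powr \<alpha>) * z ^ k))"
  proof (intro suminf_le summableI)
    fix k
    have "\<delta> / 2 ^ k \<le> 1" using \<delta> by (simp add: divide_le_eq) (meson one_le_power order_trans one_le_numeral)
    then have "(\<integral>\<^sup>+y\<in>B k. ennreal (f y) \<partial>lebesgue) \<le> ennreal (\<Phi> * (\<delta> / 2 ^ k) powr ?n)"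
      unfolding B_def using \<delta> by (intro avg) auto
    then have "ennreal (w k) * (\<integral>\<^sup>+y\<in>B k. ennreal (f y) \<partial>lebesgue) \<le> ennreal (w k) * ennreal (\<Phi> * (\<delta> / 2 ^ k) powr ?n)"
      by (rule mult_left_mono) simp
    also have "\<dots> = ennreal (w k * (\<Phi> * (\<delta> / 2 ^ k) powr ?n))"
      using \<Phi> by (simp add: ennreal_mult' w_def)
    also have "\<dots> \<le> ennreal ((2 powr ?n * \<Phi> * \<delta> powr \<alpha>) * z ^ k)"
    proof (rule ennreal_leI)
      define X where "X = \<delta> / 2 ^ k"
      have X: "0 < X" using \<delta> by (simp add: X_def)
      have "w k = (X / 2) powr (\<alpha> - ?n)" by (simp add: w_def X_def mult.commute)
      also have "\<dots> = X powr (\<alpha> - ?n) * 2 powr (?n - \<alpha>)"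
        using X by (simp add: powr_divide powr_diff)
      finally have "w k * X powr ?n = 2 powr (?n - \<alpha>) * X powr \<alpha>"
        using X by (simp add: powr_diff)
      also have "\<dots> \<le> 2 powr ?n * (\<delta> powr \<alpha> * z ^ k)"
      proof (rule mult_mono)
        show "2 powr (?n - \<alpha>) \<le> (2::real) powr ?n" using \<alpha> a0 by (intro powr_mono) auto
        have "X powr \<alpha> = \<delta> powr \<alpha> * (1 / 2 ^ k) powr \<alpha>"
          using \<delta> by (simp add: X_def powr_divide)
        also have "(1 / 2 ^ k) powr \<alpha> \<le> (1 / 2 ^ k) powr a0"
          using \<alpha> by (intro powr_mono') auto
        also have "(1 / 2 ^ k) powr a0 = z ^ k"
          by (simp add: z_def powr_divide powr_minus powr_realpow[symmetric] powr_powr mult.commute divide_simps)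
        finally show "X powr \<alpha> \<le> \<delta> powr \<alpha> * z ^ k" by (simp add: mult_left_mono)
      qed auto
      finally show "w k * (\<Phi> * (\<delta> / 2 ^ k) powr ?n) \<le> (2 powr ?n * \<Phi> * \<delta> powr \<alpha>) * z ^ k"
        using \<Phi> mult_left_mono[of "w k * X powr ?n" "2 powr ?n * (\<delta> powr \<alpha> * z ^ k)" \<Phi>]
        by (simp add: X_def[symmetric] mult_ac)
    qed
    finally show "ennreal (w k) * (\<integral>\<^sup>+y\<in>B k. ennreal (f y) \<partial>lebesgue)
      \<le> ennreal ((2 powr ?n * \<Phi> * \<delta> powr \<alpha>) * z ^ k)" .
  qed
  also have "\<dots> = ennreal ((2 powr ?n * \<Phi> * \<delta> powr \<alpha>) / (1 - z))"
    using \<Phi> z by (intro suminf_ennreal_geometric) auto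
  finally show ?thesis by (simp add: z_def)
qed

text \<open>
  The hypotheses on the exponents in quantitative form.  The modulus of continuity is stated for all
  radii \<open>r \<ge> \<bar>x - y\<bar>\<close> up to the bound \<open>D\<close> on distances, not only for \<open>r = \<bar>x - y\<bar> \<le> 1/2\<close>: in this
  form it applies to any two points of a ball of radius \<open>r\<close>.  Only the values of functions on \<open>\<Omega>\<close>
  matter, so measurability of \<open>p\<close> is required after multiplication by the indicator of \<open>\<Omega>\<close>.
\<close>

locale log_hoelder_setting =
  fixes \<Omega> :: "'a::euclidean_space set" and p \<alpha> q :: "'a \<Rightarrow> real" and s P D A \<kappa> a0 :: real
  assumes Omega: "\<Omega> \<in> lmeasurable"
    and p_measurable: "(\<lambda>x. p x * indicator \<Omega> x) \<in> borel_measurable lebesgue"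
    and s: "1 < s" and p_ge: "x \<in> \<Omega> \<Longrightarrow> s \<le> p x" and p_le: "x \<in> \<Omega> \<Longrightarrow> p x \<le> P"
    and D: "1 \<le> D" and dist_le: "x \<in> \<Omega> \<Longrightarrow> y \<in> \<Omega> \<Longrightarrow> norm (x - y) \<le> D"
    and log_hoelder: "x \<in> \<Omega> \<Longrightarrow> y \<in> \<Omega> \<Longrightarrow> norm (x - y) \<le> r \<Longrightarrow> 0 < r \<Longrightarrow> r \<le> D \<Longrightarrow>
        \<bar>p x - p y\<bar> * \<bar>ln r\<bar> \<le> A"
    and a0: "0 < a0" and \<alpha>_ge: "x \<in> \<Omega> \<Longrightarrow> a0 \<le> \<alpha> x"
    and \<kappa>: "0 < \<kappa>" and q_eq: "x \<in> \<Omega> \<Longrightarrow> 1 / q x = 1 / p x - \<alpha> x / real DIM('a)"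
    and q_bound: "x \<in> \<Omega> \<Longrightarrow> \<kappa> \<le> 1 / q x"
begin

lemma n_ge_1: "1 \<le> real DIM('a)" using DIM_positive[where 'a='a] by linarith

lemma p_gt_1: "x \<in> \<Omega> \<Longrightarrow> 1 < p x" using p_ge s by fastforce

lemma q_bounds: assumes "x \<in> \<Omega>" shows "1 < q x" "q x \<le> 1 / \<kappa>"
proof -
  have 1: "0 < 1 / q x" using q_bound[OF assms] \<kappa> by linarith
  then have q: "0 < q x" by simp
  have "0 < \<alpha> x / real DIM('a)" using \<alpha>_ge[OF assms] a0 by simp
  then have "1 / q x < 1 / p x" using q_eq[OF assms] by simp
  also have "1 / p x < 1" using p_gt_1[OF assms] by simp
  finally show "1 < q x" using q by simp
  show "q x \<le> 1 / \<kappa>" using q_bound[OF assms] \<kappa> q by (simp add: field_simps)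
qed

lemma \<alpha>_le: assumes "x \<in> \<Omega>" shows "\<alpha> x < real DIM('a)"
proof -
  have "0 < 1 / q x" using q_bounds(1)[OF assms] by simp
  then have "\<alpha> x / real DIM('a) < 1 / p x" using q_eq[OF assms] by simp
  also have "1 / p x < 1" using p_gt_1[OF assms] by simp
  finally show ?thesis using n_ge_1 by simp
qed

lemma powr_p_measurable:
  assumes [measurable]: "f \<in> borel_measurable lebesgue" and "\<And>x. x \<notin> \<Omega> \<Longrightarrow> f x = 0"
  shows "(\<lambda>x. f x powr (p x / c)) \<in> borel_measurable lebesgue"
proof -
  note p_measurable [measurable]
  have "(\<lambda>x. f x powr (p x / c)) = (\<lambda>x. f x powr ((p x * indicator \<Omega> x) / c))"
    using assms(2) by (auto simp: fun_eq_iff indicator_def)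
  then show ?thesis by simp
qed

definition unit_modular :: "('a \<Rightarrow> real) \<Rightarrow> bool" where
  "unit_modular f \<longleftrightarrow> f \<in> borel_measurable lebesgue \<and> (\<forall>y. 0 \<le> f y) \<and> (\<forall>y. y \<notin> \<Omega> \<longrightarrow> f y = 0) \<and>
     (\<integral>\<^sup>+y. ennreal (f y powr p y) \<partial>lebesgue) \<le> 1"

lemma unit_modularD:
  assumes "unit_modular f"
  shows "f \<in> borel_measurable lebesgue" "0 \<le> f y" "y \<notin> \<Omega> \<Longrightarrow> f y = 0"
    "(\<integral>\<^sup>+y. ennreal (f y powr p y) \<partial>lebesgue) \<le> 1"
    "(\<lambda>y. f y powr p y) \<in> borel_measurable lebesgue"
  using assms powr_p_measurable[of f 1] unfolding unit_modular_def by simp_all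

definition E0 where "E0 = exp (real DIM('a) * A / (s - 1))"

lemma E0_pos: "0 < E0" by (simp add: E0_def)

text \<open>
  With \<open>p'(y) = p(y)/(p(y) - 1)\<close> the exponent on the left is \<open>- n p'(y)/p'(x)\<close>, and
  \<open>p'(y)/p'(x) - 1\<close> is \<open>(p(x) - p(y)) / (p(x) (p(y) - 1))\<close>, which is at most
  \<open>\<bar>p(x) - p(y)\<bar>/(s - 1)\<close>: the logarithmic modulus of continuity makes the deviation from
  \<open>r^(- n)\<close> a bounded factor.
\<close>

lemma conj_exponent_freeze:
  assumes xy: "x \<in> \<Omega>" "y \<in> \<Omega>" "norm (x - y) \<le> r" "0 < r" "r \<le> D"
  shows "(r powr - (real DIM('a) - real DIM('a) / p x)) powr (p y / (p y - 1)) \<le> E0 * r powr - real DIM('a)"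
proof -
  have p: "1 < p x" "1 < p y" "s \<le> p y" using p_gt_1 p_ge xy by auto
  define \<theta> where "\<theta> = (p x - p y) / (p x * (p y - 1))"
  have "(real DIM('a) - real DIM('a) / p x) * (p y / (p y - 1)) = real DIM('a) + real DIM('a) * \<theta>"
    using p by (simp add: \<theta>_def divide_simps) (simp add: algebra_simps)
  then have "(r powr - (real DIM('a) - real DIM('a) / p x)) powr (p y / (p y - 1)) = r powr - (real DIM('a) + real DIM('a) * \<theta>)"
    by (simp only: powr_powr mult_minus_left)
  also have "\<dots> = r powr (- (real DIM('a) * \<theta>)) * r powr - real DIM('a)"
    by (subst powr_add[symmetric]) (simp add: add.commute)
  also have "\<dots> \<le> E0 * r powr - real DIM('a)"
  proof (intro mult_right_mono)
    have "s - 1 \<le> 1 * (p y - 1)" using p by simp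
    also have "\<dots> \<le> p x * (p y - 1)" using p by (intro mult_right_mono) auto
    finally have den: "s - 1 \<le> p x * (p y - 1)" .
    then have "\<bar>\<theta>\<bar> \<le> \<bar>p x - p y\<bar> / (s - 1)"
      unfolding \<theta>_def using s p by (simp add: abs_mult frac_le)
    then have "\<bar>\<theta>\<bar> * \<bar>ln r\<bar> \<le> \<bar>p x - p y\<bar> / (s - 1) * \<bar>ln r\<bar>" by (intro mult_right_mono) auto
    also have "\<dots> = (\<bar>p x - p y\<bar> * \<bar>ln r\<bar>) / (s - 1)" by simp
    also have "\<dots> \<le> A / (s - 1)" using log_hoelder[OF xy] s by (intro divide_right_mono) auto
    finally have "real DIM('a) * (\<bar>\<theta>\<bar> * \<bar>ln r\<bar>) \<le> real DIM('a) * (A / (s - 1))" by (intro mult_left_mono) auto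
    then show "r powr (- (real DIM('a) * \<theta>)) \<le> E0"
      unfolding E0_def using xy by (intro powr_le_exp) (auto simp: abs_mult mult.assoc)
  qed auto
  finally show ?thesis .
qed

text \<open>
  This is the Hoelder inequality together with the fact that the indicator of \<open>B(x,r)\<close> has a norm
  of the order \<open>r^(n/p'(x))\<close> in the exponent \<open>p'\<close>.  Both come from the Young inequality with the
  weight \<open>r^(- n/p'(x))\<close>, whose \<open>p'(y)\<close>-th power is at most a multiple of \<open>1/r^n\<close>.
\<close>

lemma ball_integral_le:
  fixes g :: "'a \<Rightarrow> real"
  assumes x: "x \<in> \<Omega>" and r: "0 < r" "r \<le> D"
    and g: "unit_modular g"
  shows "(\<integral>\<^sup>+y\<in>ball x r. ennreal (g y) \<partial>lebesgue) \<le> ennreal ((1 + E0 * unit_ball_vol (real DIM('a))) * r powr (real DIM('a) - real DIM('a) / p x))"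
proof -
  note [measurable] = unit_modularD(1,5)[OF g]
  note g0 = unit_modularD(2)[OF g] and gz = unit_modularD(3)[OF g] and mod = unit_modularD(4)[OF g]
  define m where "m = r powr (real DIM('a) - real DIM('a) / p x)"
  have m: "0 < m" using r by (simp add: m_def)
  have minv: "inverse m = r powr - (real DIM('a) - real DIM('a) / p x)" by (simp add: m_def powr_minus[symmetric])
  have pt: "ennreal (g y) * indicator (ball x r) y
     \<le> ennreal m * (ennreal (g y powr p y) + ennreal (E0 * r powr - real DIM('a)) * indicator (ball x r) y)" for y
  proof (cases "y \<in> \<Omega> \<and> y \<in> ball x r")
    case True
    have "g y * inverse m \<le> g y powr p y + inverse m powr (p y / (p y - 1))"
      using True m g0 p_gt_1 by (intro young_powr) auto
    also have "inverse m powr (p y / (p y - 1)) \<le> E0 * r powr - real DIM('a)"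
      unfolding minv using x r True by (intro conj_exponent_freeze) (auto simp: dist_norm)
    finally have "g y \<le> m * (g y powr p y + E0 * r powr - real DIM('a))" using m by (simp add: field_simps)
    then have "ennreal (g y) \<le> ennreal (m * (g y powr p y + E0 * r powr - real DIM('a)))" by (rule ennreal_leI)
    also have "\<dots> = ennreal m * (ennreal (g y powr p y) + ennreal (E0 * r powr - real DIM('a)))"
      using m E0_pos by (subst ennreal_mult') (auto simp: ennreal_plus)
    finally show ?thesis using True by simp
  qed (auto simp: gz)
  have "(\<integral>\<^sup>+y\<in>ball x r. ennreal (g y) \<partial>lebesgue)
     \<le> (\<integral>\<^sup>+y. ennreal m * (ennreal (g y powr p y) + ennreal (E0 * r powr - real DIM('a)) * indicator (ball x r) y) \<partial>lebesgue)"
    by (intro nn_integral_mono pt)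
  also have "\<dots> = ennreal m * ((\<integral>\<^sup>+y. ennreal (g y powr p y) \<partial>lebesgue) + ennreal (E0 * r powr - real DIM('a)) * emeasure lebesgue (ball x r))"
    by (subst nn_integral_cmult, measurable, subst nn_integral_add) (auto simp: nn_integral_cmult_indicator)
  also have "\<dots> \<le> ennreal m * (1 + ennreal (E0 * r powr - real DIM('a)) * ennreal (unit_ball_vol (real DIM('a)) * r powr real DIM('a)))"
    using mod r by (intro mult_left_mono add_mono) (auto simp: emeasure_lebesgue_ball)
  also have "ennreal (E0 * r powr - real DIM('a)) * ennreal (unit_ball_vol (real DIM('a)) * r powr real DIM('a)) = ennreal (E0 * unit_ball_vol (real DIM('a)))"
    using r E0_pos by (simp add: ennreal_mult'[symmetric] powr_minus)
  also have "ennreal m * (1 + ennreal (E0 * unit_ball_vol (real DIM('a)))) = ennreal ((1 + E0 * unit_ball_vol (real DIM('a))) * m)"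
  proof -
    have "1 + ennreal (E0 * unit_ball_vol (real DIM('a))) = ennreal (1 + E0 * unit_ball_vol (real DIM('a)))" using E0_pos by simp
    then show ?thesis using m unfolding \<open>1 + _ = _\<close>
      by (subst ennreal_mult'[symmetric]) (auto simp: mult.commute)
  qed
  finally show ?thesis by (simp add: m_def)
qed

text \<open>
  The volume of the unit ball stems from the values of \<open>f\<close> below the threshold, the exponential from
  freezing the exponent above it.
\<close>

definition average_const where
  "average_const = 2 * (unit_ball_vol (real DIM('a)) + exp (real DIM('a) * A + ln (unit_ball_vol (real DIM('a)) + 2) * P))"

text \<open>
  Diening's inequality.  With \<open>T = 1 + \<close> the average of \<open>h = f^(p/s)\<close> over \<open>B(x,r)\<close> and
  \<open>l = T^(s/p(x))\<close>, values of \<open>f\<close> up to \<open>l\<close> contribute at most \<open>l\<close> to the average of \<open>f\<close>, and where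
  \<open>f > l\<close> one has \<open>f \<le> l (f/l)^(p(y)/s)\<close>, which is \<open>l h(y) T^(- p(y)/p(x))\<close>.  Since \<open>T\<close> is at most
  a constant times \<open>r^(- n)\<close>, freezing the exponent replaces \<open>T^(- p(y)/p(x))\<close> by a multiple of
  \<open>1/T\<close>, and the average of \<open>h/T\<close> is at most 1.  It is essential that \<open>T\<close> is the average over this
  one ball: a supremum over all radii would not be bounded by a power of \<open>r\<close>.
\<close>

lemma average_modular_le:
  assumes f: "unit_modular f" and x: "x \<in> \<Omega>" and r: "0 < r" "r \<le> 1" and G: "1 \<le> G"
    and avg: "(\<integral>\<^sup>+y\<in>ball x r. ennreal (f y powr (p y / s)) \<partial>lebesgue) \<le> ennreal (G * r powr real DIM('a))"
  shows "(\<integral>\<^sup>+y\<in>ball x r. ennreal (f y) \<partial>lebesgue) \<le> ennreal (average_const * G powr (s / p x) * r powr real DIM('a))"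
proof -
  note [measurable] = unit_modularD(1,5)[OF f]
  note f0 = unit_modularD(2)[OF f] and fz = unit_modularD(3)[OF f] and mod = unit_modularD(4)[OF f]
  define v where "v = unit_ball_vol (real DIM('a))"
  have Vpos: "0 < v" by (simp add: v_def)
  \<comment> \<open>Bounds \<open>T\<close> to the power \<open>(p x - p y)/p x\<close>, from \<open>1 \<le> T \<le> (v + 2)/r^n\<close> and \<open>\<bar>p x - p y\<bar> \<le> P\<close>.\<close>
  define e where "e = exp (real DIM('a) * A + ln (v + 2) * P)"
  have e: "0 < e" by (simp add: e_def)
  have C_eq: "average_const = 2 * (v + e)" by (simp add: average_const_def v_def e_def)
  have px: "1 < p x" "s \<le> p x" using p_gt_1 p_ge x by auto
  have [measurable]: "(\<lambda>y. f y powr (p y / c)) \<in> borel_measurable lebesgue" for c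
    using powr_p_measurable fz by simp
  define h where "h y = f y powr (p y / s)" for y
  have [measurable]: "h \<in> borel_measurable lebesgue" unfolding h_def by measurable
  have h0: "0 \<le> h y" for y by (simp add: h_def)
  have h_le: "h y \<le> 1 + f y powr p y" for y
  proof (cases "y \<in> \<Omega>")
    case True
    then have py: "1 < p y" "p y / s \<le> p y" "0 < p y / s" using p_gt_1[of y] s by (auto simp: divide_le_eq)
    show ?thesis
    proof (cases "f y \<le> 1")
      case True
      then have "h y \<le> 1 powr (p y / s)" unfolding h_def using py f0 by (intro powr_mono2) auto
      then show ?thesis by (simp add: add_increasing2)
    next
      case False
      then have "h y \<le> f y powr p y" unfolding h_def using py by (intro powr_mono) auto
      then show ?thesis by simp
    qed
  qed (simp add: h_def fz)
  define I where "I = (\<integral>\<^sup>+y\<in>ball x r. ennreal (h y) \<partial>lebesgue)"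
  have "I \<le> (\<integral>\<^sup>+y. indicator (ball x r) y + ennreal (f y powr p y) \<partial>lebesgue)"
    unfolding I_def
  proof (intro nn_integral_mono)
    fix y
    have "ennreal (h y) \<le> 1 + ennreal (f y powr p y)"
      using ennreal_leI[OF h_le[of y]] by (simp add: ennreal_plus)
    then show "ennreal (h y) * indicator (ball x r) y \<le> indicator (ball x r) y + ennreal (f y powr p y)"
      by (auto simp: indicator_def)
  qed
  also have "\<dots> = emeasure lebesgue (ball x r) + (\<integral>\<^sup>+y. ennreal (f y powr p y) \<partial>lebesgue)"
    by (subst nn_integral_add) auto
  also have "\<dots> \<le> ennreal (v * r powr real DIM('a)) + 1"
    using mod r by (intro add_mono) (auto simp: emeasure_lebesgue_ball v_def)
  also have "\<dots> = ennreal (v * r powr real DIM('a) + 1)" using Vpos by (simp add: ennreal_plus)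
  finally have I1: "I \<le> ennreal (v * r powr real DIM('a) + 1)" .
  define H where "H = enn2real I"
  have IH: "I = ennreal H" unfolding H_def using I1 by (intro ennreal_enn2real[symmetric]) (auto simp: less_top[symmetric] top_unique)
  have H: "0 \<le> H" "H \<le> v * r powr real DIM('a) + 1" "H \<le> G * r powr real DIM('a)"
  proof -
    show H0: "0 \<le> H" by (simp add: H_def)
    have V0: "0 \<le> v * r powr real DIM('a) + 1" using Vpos by (intro add_nonneg_nonneg mult_nonneg_nonneg) auto
    show "H \<le> v * r powr real DIM('a) + 1" using I1[unfolded IH] V0 ennreal_le_iff by blast
    have G0: "0 \<le> G * r powr real DIM('a)" using G by simp
    have "ennreal H \<le> ennreal (G * r powr real DIM('a))" using avg IH by (simp add: I_def h_def)
    then show "H \<le> G * r powr real DIM('a)" using G0 ennreal_le_iff by blast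
  qed
  define R where "R = r powr real DIM('a)"
  have R: "0 < R" "R \<le> 1" using r by (auto simp: R_def powr_le1)
  define T where "T = 1 + H / R"
  have T: "1 \<le> T" "T \<le> 2 * G" "H / T \<le> R" "T \<le> (v + 2) / R"
  proof -
    show T1: "1 \<le> T" using H R by (simp add: T_def)
    have "H / R \<le> G" using H(3) R by (simp add: R_def field_simps)
    then show "T \<le> 2 * G" using G by (simp add: T_def)
    have "H = R * (T - 1)" using R by (simp add: T_def)
    also have "\<dots> \<le> R * T" using R by simp
    finally show "H / T \<le> R" using T1 by (simp add: divide_le_eq)
    have "v * R \<le> v" using R Vpos mult_left_mono[of R 1 "v"] by simp
    then have "R + H \<le> v + 2" using H(2) R unfolding R_def by linarith
    then have "(R + H) / R \<le> (v + 2) / R" using R by (intro divide_right_mono) auto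
    moreover have "T = (R + H) / R" using R by (simp add: T_def add_divide_distrib)
    ultimately show "T \<le> (v + 2) / R" by simp
  qed
  define l where "l = T powr (s / p x)"
  have l: "1 \<le> l" unfolding l_def using T px s by (intro ge_one_powr_ge_zero) auto
  have l_le: "l \<le> 2 * G powr (s / p x)"
  proof -
    have "l \<le> (2 * G) powr (s / p x)" unfolding l_def using T px s by (intro powr_mono2) auto
    also have "\<dots> = 2 powr (s / p x) * G powr (s / p x)" using G by (simp add: powr_mult)
    also have "\<dots> \<le> 2 powr 1 * G powr (s / p x)"
      using px s by (intro mult_right_mono powr_mono) auto
    finally show ?thesis by simp
  qed
  have pt: "f y \<le> l + (l * e / T) * h y" if y: "y \<in> \<Omega>" "y \<in> ball x r" for y
  proof (cases "f y \<le> l")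
    case True
    then show ?thesis using l e T h0[of y] by (simp add: add_increasing2)
  next
    case False
    have py: "1 < p y" "s \<le> p y" "p y \<le> P" using p_gt_1 p_ge p_le y by auto
    have "f y = l * (f y / l) powr 1" using l False by simp
    also have "\<dots> \<le> l * (f y / l) powr (p y / s)"
      using l False py s by (intro mult_left_mono powr_mono) auto
    also have "(f y / l) powr (p y / s) = h y * l powr - (p y / s)"
      using l False unfolding h_def by (simp add: powr_divide powr_minus_divide)
    also have "l powr - (p y / s) = T powr - (p y / p x)"
      using px s by (simp add: l_def powr_powr)
    also have "- (p y / p x) = (p x - p y) / p x + - 1" using px by (simp add: field_simps)
    also have "T powr ((p x - p y) / p x + - 1) = T powr ((p x - p y) / p x) / T"
      using T by (subst powr_add) (simp add: powr_minus divide_inverse)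
    also have "l * (h y * (T powr ((p x - p y) / p x) / T)) \<le> l * (h y * (e / T))"
    proof (intro mult_left_mono divide_right_mono)
      have "ln T \<le> ln ((v + 2) / R)" using T R Vpos by (subst ln_le_cancel_iff) auto
      also have "\<dots> = ln (v + 2) + real DIM('a) * (- ln r)"
        using R Vpos r by (simp add: ln_div R_def ln_powr)
      finally have lnT: "ln T \<le> ln (v + 2) + real DIM('a) * \<bar>ln r\<bar>" using r by simp
      have "\<bar>(p x - p y) / p x\<bar> * \<bar>ln T\<bar> \<le> \<bar>p x - p y\<bar> * ln T"
        using px T by (intro mult_mono) (auto simp: divide_le_eq mult_le_cancel_left1)
      also have "\<dots> \<le> \<bar>p x - p y\<bar> * (ln (v + 2) + real DIM('a) * \<bar>ln r\<bar>)"
        by (intro mult_left_mono lnT) auto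
      also have "\<dots> = \<bar>p x - p y\<bar> * ln (v + 2) + real DIM('a) * (\<bar>p x - p y\<bar> * \<bar>ln r\<bar>)"
        by (simp add: algebra_simps)
      also have "\<dots> \<le> P * ln (v + 2) + real DIM('a) * A"
      proof (intro add_mono mult_mono)
        show "\<bar>p x - p y\<bar> \<le> P" using px py p_le[OF x] by linarith
        show "\<bar>p x - p y\<bar> * \<bar>ln r\<bar> \<le> A"
          using x y r D by (intro log_hoelder) (auto simp: dist_norm)
        show "0 \<le> P" using py by linarith
        show "0 \<le> ln (v + 2)" using Vpos by (intro ln_ge_zero) auto
      qed auto
      finally show "T powr ((p x - p y) / p x) \<le> e"
        unfolding e_def using T by (intro powr_le_exp) (auto simp: algebra_simps)
    qed (use T l h0 in auto)
    finally show ?thesis using l by (simp add: mult_ac)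
  qed
  define w where "w = l * e / T"
  have w: "0 \<le> w" using l e T by (simp add: w_def)
  have pt': "ennreal (f y) * indicator (ball x r) y \<le>
     ennreal l * indicator (ball x r) y + ennreal w * (ennreal (h y) * indicator (ball x r) y)" for y
  proof (cases "y \<in> \<Omega> \<and> y \<in> ball x r")
    case True
    have "ennreal (f y) \<le> ennreal (l + w * h y)" using True by (intro ennreal_leI pt[folded w_def]) auto
    also have "\<dots> = ennreal l + ennreal w * ennreal (h y)"
      using l w h0[of y] by (simp add: ennreal_plus ennreal_mult)
    finally show ?thesis using True by simp
  qed (auto simp: fz)
  have "(\<integral>\<^sup>+y\<in>ball x r. ennreal (f y) \<partial>lebesgue) \<le>
     (\<integral>\<^sup>+y. ennreal l * indicator (ball x r) y + ennreal w * (ennreal (h y) * indicator (ball x r) y) \<partial>lebesgue)"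
    by (intro nn_integral_mono pt')
  also have "\<dots> = ennreal l * emeasure lebesgue (ball x r) + ennreal w * I"
    unfolding I_def by (subst nn_integral_add) (auto simp: nn_integral_cmult_indicator nn_integral_cmult)
  also have "\<dots> = ennreal (l * (v * R) + w * H)"
    using r l w H Vpos R
    by (simp add: emeasure_lebesgue_ball v_def IH R_def ennreal_plus ennreal_mult')
  also have "\<dots> \<le> ennreal (average_const * G powr (s / p x) * R)"
  proof (rule ennreal_leI)
    have "l * (v * R) + w * H = l * (v * R) + l * e * (H / T)" by (simp add: w_def)
    also have "\<dots> \<le> l * (v * R) + l * e * R"
      using T l e Vpos R by (intro add_mono mult_left_mono) auto
    also have "\<dots> = l * ((v + e) * R)" by (simp add: algebra_simps)
    also have "\<dots> \<le> (2 * G powr (s / p x)) * ((v + e) * R)"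
      using l_le Vpos e R by (intro mult_right_mono) auto
    also have "\<dots> = average_const * G powr (s / p x) * R" unfolding C_eq by (simp add: algebra_simps)
    finally show "l * (v * R) + w * H \<le> average_const * G powr (s / p x) * R" .
  qed
  finally show ?thesis by (simp add: R_def)
qed

definition far_const where
  "far_const = 1 + E0 * (unit_ball_vol (real DIM('a)) * 4 powr real DIM('a) / (1 - 2 powr - (real DIM('a) * \<kappa>)))"

text \<open>
  The Young inequality with the weight \<open>\<delta>^(\<alpha>(x) - n/p(x))\<close>.  The \<open>p'(y)\<close>-th power of the weighted
  kernel is, after freezing the exponent, at most a multiple of \<open>\<rho>^(- n)\<close> times a power of
  \<open>\<delta>/\<rho>\<close>, where \<open>\<rho> = \<bar>x - y\<bar>\<close>.  The exponent of \<open>\<delta>/\<rho>\<close> is positive, uniformly in \<open>x\<close>, because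
  \<open>\<alpha> p\<close> stays below \<open>n\<close> by a positive margin.
\<close>

lemma far_potential_le:
  assumes f: "unit_modular f" and x: "x \<in> \<Omega>" and \<delta>: "0 < \<delta>"
  shows "(\<integral>\<^sup>+y\<in>- ball x \<delta>. ennreal (f y / norm (x - y) powr (real DIM('a) - \<alpha> x)) \<partial>lebesgue)
    \<le> ennreal (far_const * \<delta> powr (\<alpha> x - real DIM('a) / p x))"
proof -
  note [measurable] = unit_modularD(1,5)[OF f]
  note f0 = unit_modularD(2)[OF f] and fz = unit_modularD(3)[OF f] and mod = unit_modularD(4)[OF f]
  have n\<kappa>: "0 < real DIM('a) * \<kappa>" using \<kappa> by simp
  define B where "B = unit_ball_vol (real DIM('a)) * 4 powr real DIM('a) / (1 - 2 powr - (real DIM('a) * \<kappa>))"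
  have B: "0 < B" unfolding B_def using n\<kappa> by (simp add: powr_less_one)
  have C_eq: "far_const = 1 + E0 * B" by (simp add: far_const_def B_def)
  then have C: "0 < far_const" using B E0_pos by (simp add: add_pos_pos)
  define \<mu> where "\<mu> = \<delta> powr (\<alpha> x - real DIM('a) / p x)"
  have \<mu>: "0 < \<mu>" using \<delta> by (simp add: \<mu>_def)
  define \<beta> where "\<beta> = real DIM('a) / p x - \<alpha> x"
  have \<beta>: "real DIM('a) * \<kappa> \<le> \<beta>"
  proof -
    have "\<kappa> \<le> 1 / p x - \<alpha> x / real DIM('a)" using q_bound[OF x] q_eq[OF x] by simp
    then have "real DIM('a) * \<kappa> \<le> real DIM('a) * (1 / p x - \<alpha> x / real DIM('a))" by (rule mult_left_mono) simp
    also have "\<dots> = \<beta>" by (simp add: \<beta>_def right_diff_distrib)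
    finally show ?thesis .
  qed
  define k where "k y = norm (x - y) powr - real DIM('a) * (\<delta> / norm (x - y)) powr (real DIM('a) * \<kappa>)" for y
  have [measurable]: "k \<in> borel_measurable lebesgue"
    unfolding k_def by (rule measurable_completion) measurable
  have pt: "ennreal (f y / norm (x - y) powr (real DIM('a) - \<alpha> x)) * indicator (- ball x \<delta>) y \<le>
     ennreal \<mu> * (ennreal (f y powr p y) + ennreal E0 * (ennreal (k y) * indicator (- ball x \<delta>) y))" for y
  proof (cases "y \<in> \<Omega> \<and> y \<in> - ball x \<delta>")
    case True
    define \<rho> where "\<rho> = norm (x - y)"
    have \<rho>: "0 < \<rho>" "\<delta> \<le> \<rho>" "\<rho> \<le> D" using True x \<delta> dist_le[of x y] by (auto simp: \<rho>_def dist_norm)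
    have py: "1 < p y" using True p_gt_1 by auto
    define c where "c = \<rho> powr - (real DIM('a) - real DIM('a) / p x) * (\<delta> / \<rho>) powr \<beta>"
    have "\<rho> powr - (real DIM('a) - real DIM('a) / p x) * \<rho> powr - \<beta> = \<rho> powr - (real DIM('a) - \<alpha> x)"
      by (subst powr_add[symmetric]) (simp add: \<beta>_def)
    moreover have "\<mu> * \<delta> powr \<beta> = 1"
      using \<delta> by (simp add: \<mu>_def \<beta>_def powr_add[symmetric])
    moreover have "(\<delta> / \<rho>) powr \<beta> = \<delta> powr \<beta> * \<rho> powr - \<beta>"
      using \<delta> \<rho> by (simp add: powr_divide powr_minus_divide)
    ultimately have \<mu>c: "\<mu> * c = \<rho> powr - (real DIM('a) - \<alpha> x)" by (simp add: c_def mult.left_commute)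
    have "f y / \<rho> powr (real DIM('a) - \<alpha> x) = f y * \<rho> powr - (real DIM('a) - \<alpha> x)"
      using powr_minus_divide[of \<rho> "real DIM('a) - \<alpha> x"] by simp
    also have "\<dots> = \<mu> * (f y * c)" by (simp only: \<mu>c[symmetric]) simp
    also have "f y * c \<le> f y powr p y + c powr (p y / (p y - 1))"
      using f0 py by (intro young_powr) (auto simp: c_def)
    also have "c powr (p y / (p y - 1)) \<le> E0 * k y"
    proof -
      have "c powr (p y / (p y - 1)) = (\<rho> powr - (real DIM('a) - real DIM('a) / p x)) powr (p y / (p y - 1)) * ((\<delta> / \<rho>) powr \<beta>) powr (p y / (p y - 1))"
        unfolding c_def by (rule powr_mult)
      also have "\<dots> \<le> (E0 * \<rho> powr - real DIM('a)) * (\<delta> / \<rho>) powr (real DIM('a) * \<kappa>)"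
      proof (intro mult_mono)
        show "(\<rho> powr - (real DIM('a) - real DIM('a) / p x)) powr (p y / (p y - 1)) \<le> E0 * \<rho> powr - real DIM('a)"
          using True x \<rho> by (intro conj_exponent_freeze) (auto simp: \<rho>_def)
        have "real DIM('a) * \<kappa> \<le> \<beta> * 1" using \<beta> by simp
        also have "\<dots> \<le> \<beta> * (p y / (p y - 1))"
          using \<beta> n\<kappa> py by (intro mult_left_mono) (auto simp: le_divide_eq)
        finally have "(\<delta> / \<rho>) powr (\<beta> * (p y / (p y - 1))) \<le> (\<delta> / \<rho>) powr (real DIM('a) * \<kappa>)"
          using \<delta> \<rho> by (intro powr_mono') (auto simp: divide_le_eq)
        then show "((\<delta> / \<rho>) powr \<beta>) powr (p y / (p y - 1)) \<le> (\<delta> / \<rho>) powr (real DIM('a) * \<kappa>)"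
          by (simp only: powr_powr)
      qed (use E0_pos in auto)
      finally show ?thesis by (simp add: k_def \<rho>_def mult.assoc)
    qed
    finally have "f y / \<rho> powr (real DIM('a) - \<alpha> x) \<le> \<mu> * (f y powr p y + E0 * k y)"
      using \<mu> by simp
    then have "ennreal (f y / \<rho> powr (real DIM('a) - \<alpha> x)) \<le> ennreal (\<mu> * (f y powr p y + E0 * k y))"
      by (rule ennreal_leI)
    also have "\<dots> = ennreal \<mu> * (ennreal (f y powr p y) + ennreal E0 * ennreal (k y))"
      using \<mu> E0_pos by (subst ennreal_mult') (auto simp: ennreal_plus ennreal_mult' k_def)
    finally show ?thesis unfolding \<rho>_def using True
      by (subst (1 2) indicator_simps(1)) (simp_all only: mult_1_right)
  qed (auto simp: fz indicator_def)
  have "(\<integral>\<^sup>+y\<in>- ball x \<delta>. ennreal (f y / norm (x - y) powr (real DIM('a) - \<alpha> x)) \<partial>lebesgue) \<le>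
    (\<integral>\<^sup>+y. ennreal \<mu> * (ennreal (f y powr p y) + ennreal E0 * (ennreal (k y) * indicator (- ball x \<delta>) y)) \<partial>lebesgue)"
    by (intro nn_integral_mono pt)
  also have "\<dots> = ennreal \<mu> * ((\<integral>\<^sup>+y. ennreal (f y powr p y) \<partial>lebesgue) +
      ennreal E0 * (\<integral>\<^sup>+y\<in>- ball x \<delta>. ennreal (k y) \<partial>lebesgue))"
    by (subst nn_integral_cmult, measurable, subst nn_integral_add) (auto simp: nn_integral_cmult)
  also have "\<dots> \<le> ennreal \<mu> * (1 + ennreal E0 * ennreal B)"
    using nn_integral_tail_bound[OF n\<kappa> \<delta>] unfolding k_def B_def by (intro mult_left_mono add_mono mod) auto
  also have "\<dots> = ennreal (far_const * \<mu>)"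
  proof -
    have "1 + ennreal E0 * ennreal B = ennreal far_const"
      using E0_pos B by (simp add: C_eq ennreal_plus ennreal_mult')
    then show ?thesis using C \<mu> by (simp add: ennreal_mult' mult.commute)
  qed
  finally show ?thesis by (simp add: \<mu>_def)
qed

text \<open>
  Since \<open>(n - \<alpha>) q = n + (n - n/p) q\<close>, the left hand side is \<open>\<rho>^(- n) (t/\<rho>)^(a q(x))\<close> up to a power
  of \<open>\<rho>\<close> with exponent a multiple of \<open>p(x0) - p(x)\<close>, where \<open>\<rho> = \<bar>x0 - x\<bar>\<close> and \<open>a = n - n/p(x0)\<close>.
  The integral of the right hand side outside \<open>B(x0,t)\<close> is bounded independently of \<open>t\<close>.
\<close>

lemma power_tail_le:
  assumes x0: "x0 \<in> \<Omega>" and x: "x \<in> \<Omega>" and t: "0 < t" "t \<le> norm (x0 - x)"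
  shows "(t powr (real DIM('a) - real DIM('a) / p x0) * norm (x0 - x) powr - (real DIM('a) - \<alpha> x)) powr q x
    \<le> exp (real DIM('a) * A / \<kappa>) * (norm (x0 - x) powr - real DIM('a) * (t / norm (x0 - x)) powr (real DIM('a) - real DIM('a) / p x0))"
proof -
  define \<rho> where "\<rho> = norm (x0 - x)"
  have \<rho>: "0 < \<rho>" "t \<le> \<rho>" "\<rho> \<le> D" using t x x0 dist_le[of x0 x] by (auto simp: \<rho>_def)
  define a where "a = real DIM('a) - real DIM('a) / p x0"
  have p0: "1 < p x0" and px: "1 < p x" using p_gt_1 x x0 by auto
  have a: "0 < a" using p0 by (simp add: a_def divide_less_eq)
  note qx = q_bounds[OF x]
  have "\<alpha> x = real DIM('a) / p x - real DIM('a) / q x"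
  proof -
    have "\<alpha> x / real DIM('a) = 1 / p x - 1 / q x" using q_eq[OF x] by simp
    then show ?thesis by (simp add: field_simps)
  qed
  define d where "d = (a - (real DIM('a) - real DIM('a) / p x)) * q x"
  have "- (real DIM('a) - \<alpha> x) * q x = - real DIM('a) + d + - (a * q x)"
    using qx unfolding d_def \<open>\<alpha> x = _\<close> by (simp add: field_simps)
  then have "(t powr a * \<rho> powr - (real DIM('a) - \<alpha> x)) powr q x = t powr (a * q x) * \<rho> powr (- real DIM('a) + d + - (a * q x))"
    using powr_mult[of "t powr a" "\<rho> powr - (real DIM('a) - \<alpha> x)" "q x"] by (simp only: powr_powr powr_ge_zero)
  also have "\<dots> = t powr (a * q x) * (\<rho> powr - real DIM('a) * \<rho> powr d * \<rho> powr - (a * q x))"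
    by (simp only: powr_add)
  also have "\<dots> = \<rho> powr d * (\<rho> powr - real DIM('a) * (t / \<rho>) powr (a * q x))"
    using t \<rho> by (simp add: powr_divide powr_minus_divide)
  also have "\<dots> \<le> exp (real DIM('a) * A / \<kappa>) * (\<rho> powr - real DIM('a) * (t / \<rho>) powr a)"
  proof (intro mult_mono)
    have "\<bar>d\<bar> * \<bar>ln \<rho>\<bar> \<le> (real DIM('a) * \<bar>p x0 - p x\<bar> * (1 / \<kappa>)) * \<bar>ln \<rho>\<bar>"
    proof (rule mult_right_mono)
      have "a - (real DIM('a) - real DIM('a) / p x) = real DIM('a) * ((p x0 - p x) / (p x * p x0))"
        using p0 px unfolding a_def by (simp add: field_simps)
      then have "\<bar>d\<bar> = real DIM('a) * (\<bar>p x0 - p x\<bar> / (p x * p x0)) * q x"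
        using p0 px qx by (simp add: d_def abs_mult)
      also have "\<dots> \<le> real DIM('a) * (\<bar>p x0 - p x\<bar> / 1) * (1 / \<kappa>)"
      proof (intro mult_mono mult_left_mono divide_left_mono)
        show "1 \<le> p x * p x0" using p0 px mult_mono[of 1 "p x" 1 "p x0"] by simp
      qed (use qx p0 px \<kappa> in auto)
      finally show "\<bar>d\<bar> \<le> real DIM('a) * \<bar>p x0 - p x\<bar> * (1 / \<kappa>)" by simp
    qed simp
    also have "\<dots> = real DIM('a) * (\<bar>p x0 - p x\<bar> * \<bar>ln \<rho>\<bar>) / \<kappa>" by simp
    also have "\<dots> \<le> real DIM('a) * A / \<kappa>"
      using \<kappa> \<rho> x x0 by (intro divide_right_mono mult_left_mono log_hoelder) (auto simp: \<rho>_def)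
    finally show "\<rho> powr d \<le> exp (real DIM('a) * A / \<kappa>)" using \<rho> by (intro powr_le_exp)
    have "a * 1 \<le> a * q x" using a qx by (intro mult_left_mono) auto
    then show "(t / \<rho>) powr (a * q x) \<le> (t / \<rho>) powr a"
      using t \<rho> by (intro powr_mono') (auto simp: divide_le_eq)
  qed auto
  finally show ?thesis by (simp add: a_def \<rho>_def)
qed

text \<open>
  In modular form: the potential of \<open>f\<close> on \<open>S\<close> has a norm of the order \<open>\<Lambda>\<close> in the exponent \<open>q\<close>.  The
  \<open>q(x)\<close>-th power of the potential divided by \<open>\<Lambda>\<close> is replaced by a measurable majorant \<open>g\<close>, so that
  bounds of different origin can be added before integrating.
\<close>

definition dominated :: "('a \<Rightarrow> real) \<Rightarrow> 'a set \<Rightarrow> real \<Rightarrow> real \<Rightarrow> bool" where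
  "dominated f S \<Lambda> K \<longleftrightarrow> (\<exists>g\<in>borel_measurable lebesgue. (\<integral>\<^sup>+x\<in>\<Omega>. g x \<partial>lebesgue) \<le> ennreal K \<and>
     (\<forall>x\<in>S. g x < \<infinity> \<longrightarrow>
        (\<exists>c\<ge>0. pos_potential \<alpha> f x \<le> ennreal (c * \<Lambda>) \<and> ennreal (c powr q x) \<le> g x)))"

text \<open>
  The first factor is the constant of the pointwise bound of the potential by \<open>G^(s/q)\<close>, raised to an
  upper bound of \<open>q\<close>; the second bounds the integral of \<open>1 + g\<close> over \<open>\<Omega>\<close>, with \<open>g\<close> from
  \<open>strong_type_covering\<close>.
\<close>

definition sobolev_const where
  "sobolev_const =
     (1 + (2 powr real DIM('a) / (1 - 2 powr - a0) * average_const + far_const)) powr (1 / \<kappa>) *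
     (measure lebesgue \<Omega> + 2 * 5 powr real DIM('a) * unit_ball_vol (real DIM('a)) * 2 powr s *
        (2 powr (s - 1) / (2 powr (s - 1) - 1) * (2 * unit_ball_vol (real DIM('a))) powr (s - 1)))"

lemma sobolev_const_nonneg: "0 \<le> sobolev_const"
proof -
  have "1 < 2 powr (s - 1)" using s by (simp add: gr_one_powr)
  then show ?thesis unfolding sobolev_const_def
    by (intro mult_nonneg_nonneg add_nonneg_nonneg divide_nonneg_nonneg) auto
qed

text \<open>
  With \<open>\<delta> = G^(- s/n)\<close> the bounds for the near and the far part of the potential coincide: both are
  multiples of \<open>G^(s/q(x))\<close>, whose \<open>q(x)\<close>-th power is \<open>G^s\<close>.  As \<open>G \<ge> 1\<close>, the radius \<open>\<delta>\<close> is
  at most 1, where the averages are controlled.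
\<close>

lemma sobolev_modular:
  assumes f: "unit_modular f"
  shows "dominated f \<Omega> 1 sobolev_const"
proof -
  note [measurable] = unit_modularD(1)[OF f]
  note f0 = unit_modularD(2)[OF f] and fz = unit_modularD(3)[OF f] and mod = unit_modularD(4)[OF f]
  define CS where "CS = 2 * 5 powr real DIM('a) * unit_ball_vol (real DIM('a)) * 2 powr s *
    (2 powr (s - 1) / (2 powr (s - 1) - 1) * (2 * unit_ball_vol (real DIM('a))) powr (s - 1))"
  define C2 where "C2 = 2 powr real DIM('a) / (1 - 2 powr - a0)"
  have V: "unit_ball_vol (real DIM('a)) \<noteq> 0" by (rule less_imp_neq[symmetric]) simp
  have "1 < 2 powr (s - 1)" using s by (simp add: gr_one_powr)
  then have CS: "0 < CS" unfolding CS_def using V by (intro mult_pos_pos divide_pos_pos) auto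
  have C2: "0 < C2" using a0 by (simp add: C2_def powr_less_one)
  have C1: "0 < average_const" unfolding average_const_def by (intro mult_pos_pos add_pos_pos) auto
  have C3: "0 < far_const" unfolding far_const_def using E0_pos \<kappa>
    by (intro add_pos_pos mult_pos_pos divide_pos_pos) (auto simp: powr_less_one)
  define L where "L = C2 * average_const + far_const"
  have L: "0 < L" using C1 C2 C3 by (simp add: L_def add_pos_pos)
  define K where "K = (1 + L) powr (1 / \<kappa>)"
  have K: "0 < K" using L by (simp add: K_def)
  have C_eq: "sobolev_const = K * (measure lebesgue \<Omega> + CS)"
    by (simp add: sobolev_const_def K_def L_def C2_def CS_def)
  have hm: "(\<lambda>y. f y powr (p y / s)) \<in> borel_measurable lebesgue"
    using powr_p_measurable fz by simp
  have hs: "(f y powr (p y / s)) powr s = f y powr p y" for y using s by (simp add: powr_powr)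
  obtain g0 where [measurable]: "g0 \<in> borel_measurable lebesgue"
    and g0: "(\<integral>\<^sup>+x. g0 x \<partial>lebesgue) \<le> ennreal CS * (\<integral>\<^sup>+x. ennreal (f x powr p x) \<partial>lebesgue)"
    and G: "\<And>x. g0 x < \<infinity> \<Longrightarrow> \<exists>G\<ge>1. ennreal (G powr s) \<le> 1 + g0 x \<and>
         (\<forall>r. 0 < r \<and> r \<le> 1 \<longrightarrow>
            (\<integral>\<^sup>+y\<in>ball x r. ennreal (f y powr (p y / s)) \<partial>lebesgue) \<le> ennreal (G * r powr real DIM('a)))"
    using strong_type_covering[OF s hm] unfolding hs CS_def by auto
  define g where "g x = ennreal K * (1 + g0 x)" for x
  have gm [measurable]: "g \<in> borel_measurable lebesgue" unfolding g_def by measurable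
  have Om [measurable]: "\<Omega> \<in> sets lebesgue" using Omega by (rule fmeasurableD)
  have 1: "(\<integral>\<^sup>+x\<in>\<Omega>. g x \<partial>lebesgue) \<le> ennreal sobolev_const"
  proof -
    have "(\<integral>\<^sup>+x\<in>\<Omega>. g x \<partial>lebesgue) \<le> (\<integral>\<^sup>+x. ennreal K * (indicator \<Omega> x + g0 x) \<partial>lebesgue)"
      by (intro nn_integral_mono) (auto simp: g_def indicator_def)
    also have "\<dots> = ennreal K * (emeasure lebesgue \<Omega> + (\<integral>\<^sup>+x. g0 x \<partial>lebesgue))"
      by (subst nn_integral_cmult, measurable, subst nn_integral_add) auto
    also have "\<dots> \<le> ennreal K * (ennreal (measure lebesgue \<Omega>) + ennreal CS * 1)"
    proof (intro mult_left_mono add_mono)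
      show "emeasure lebesgue \<Omega> \<le> ennreal (measure lebesgue \<Omega>)"
        using emeasure_eq_measure2[OF Omega] by (rule eq_refl)
      show "(\<integral>\<^sup>+x. g0 x \<partial>lebesgue) \<le> ennreal CS * 1"
        by (rule order_trans[OF g0 mult_left_mono[OF mod]]) simp
    qed simp
    also have "\<dots> = ennreal sobolev_const"
      using K CS by (simp add: C_eq ennreal_plus ennreal_mult')
    finally show ?thesis .
  qed
  have 2: "\<exists>c\<ge>0. pos_potential \<alpha> f x \<le> ennreal c \<and> ennreal (c powr q x) \<le> g x"
    if x: "x \<in> \<Omega>" and fin: "g x < \<infinity>" for x
  proof -
    have "g0 x < \<infinity>" using fin K by (auto simp: g_def less_top[symmetric] ennreal_mult_eq_top_iff)
    then obtain G where G1: "1 \<le> G" and Gs: "ennreal (G powr s) \<le> 1 + g0 x" and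
      Ga: "\<And>r. 0 < r \<Longrightarrow> r \<le> 1 \<Longrightarrow>
            (\<integral>\<^sup>+y\<in>ball x r. ennreal (f y powr (p y / s)) \<partial>lebesgue) \<le> ennreal (G * r powr real DIM('a))"
      using G by blast
    have px: "1 < p x" using p_gt_1 x by auto
    note qx = q_bounds[OF x]
    define \<Phi> where "\<Phi> = average_const * G powr (s / p x)"
    have \<Phi>: "0 \<le> \<Phi>" using C1 by (simp add: \<Phi>_def)
    \<comment> \<open>The radius at which the near and the far bound balance.\<close>
    define \<delta> where "\<delta> = G powr - (s / real DIM('a))"
    have \<delta>: "0 < \<delta>" "\<delta> \<le> 1"
      using G1 s powr_mono[of "- (s / real DIM('a))" 0 G] by (auto simp: \<delta>_def)
    have n: "(\<integral>\<^sup>+y\<in>ball x \<delta>. ennreal (f y / norm (x - y) powr (real DIM('a) - \<alpha> x)) \<partial>lebesgue)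
      \<le> ennreal (C2 * \<Phi> * \<delta> powr \<alpha> x)"
    unfolding C2_def
    proof (rule near_potential_le)
      show "(\<integral>\<^sup>+y\<in>ball x r. ennreal (f y) \<partial>lebesgue) \<le> ennreal (\<Phi> * r powr real DIM('a))"
        if "0 < r" "r \<le> 1" for r
        unfolding \<Phi>_def by (rule average_modular_le[OF f x that G1 Ga[OF that]])
      show "\<alpha> x \<le> real DIM('a)" using \<alpha>_le[OF x] by simp
    qed (use f0 a0 \<alpha>_ge[OF x] \<Phi> \<delta> in auto)
    have f: "(\<integral>\<^sup>+y\<in>- ball x \<delta>. ennreal (f y / norm (x - y) powr (real DIM('a) - \<alpha> x)) \<partial>lebesgue)
      \<le> ennreal (far_const * \<delta> powr (\<alpha> x - real DIM('a) / p x))"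
      by (rule far_potential_le[OF f x \<delta>(1)])
    define c where "c = L * G powr (s / q x)"
    have \<alpha>q: "\<alpha> x / real DIM('a) = 1 / p x - 1 / q x" using q_eq[OF x] by simp
    have e1: "G powr (s / p x) * \<delta> powr \<alpha> x = G powr (s / q x)"
    proof -
      have "s / p x + - (s / real DIM('a)) * \<alpha> x = s * (1 / p x - \<alpha> x / real DIM('a))" by (simp add: algebra_simps)
      also have "\<dots> = s / q x" by (simp add: \<alpha>q)
      finally show ?thesis by (simp only: \<delta>_def powr_powr powr_add[symmetric])
    qed
    have e2: "\<delta> powr (\<alpha> x - real DIM('a) / p x) = G powr (s / q x)"
    proof -
      have "- (s / real DIM('a)) * (\<alpha> x - real DIM('a) / p x) = s * (1 / p x - \<alpha> x / real DIM('a))" by (simp add: algebra_simps)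
      also have "\<dots> = s / q x" by (simp add: \<alpha>q)
      finally show ?thesis by (simp only: \<delta>_def powr_powr)
    qed
    have k [measurable]: "(\<lambda>y. ennreal (f y / norm (x - y) powr (real DIM('a) - \<alpha> x))) \<in> borel_measurable lebesgue"
    proof -
      have "(\<lambda>y. norm (x - y) powr (real DIM('a) - \<alpha> x)) \<in> borel_measurable lebesgue"
        by (rule measurable_completion) measurable
      then show ?thesis by measurable
    qed
    have "pos_potential \<alpha> f x =
       (\<integral>\<^sup>+y\<in>ball x \<delta>. ennreal (f y / norm (x - y) powr (real DIM('a) - \<alpha> x)) \<partial>lebesgue) +
       (\<integral>\<^sup>+y\<in>- ball x \<delta>. ennreal (f y / norm (x - y) powr (real DIM('a) - \<alpha> x)) \<partial>lebesgue)"
      unfolding pos_potential_def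
      by (subst nn_integral_add[symmetric], measurable, intro nn_integral_cong) (auto simp: indicator_def)
    also have "\<dots> \<le> ennreal (C2 * \<Phi> * \<delta> powr \<alpha> x) + ennreal (far_const * \<delta> powr (\<alpha> x - real DIM('a) / p x))"
      by (intro add_mono n f)
    also have "\<dots> = ennreal (C2 * \<Phi> * \<delta> powr \<alpha> x + far_const * \<delta> powr (\<alpha> x - real DIM('a) / p x))"
      using C2 C3 \<Phi> by simp
    also have "C2 * \<Phi> * \<delta> powr \<alpha> x + far_const * \<delta> powr (\<alpha> x - real DIM('a) / p x) = c"
      unfolding \<Phi>_def e2 c_def L_def using e1 by (simp add: algebra_simps)
    finally have pot: "pos_potential \<alpha> f x \<le> ennreal c" .
    have "c powr q x \<le> K * G powr s"
    proof -
      have "c powr q x = L powr q x * G powr s"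
        unfolding c_def using L qx by (simp add: powr_mult powr_powr)
      also have "L powr q x \<le> (1 + L) powr q x" using L qx by (intro powr_mono2) auto
      also have "\<dots> \<le> K" unfolding K_def using L qx by (intro powr_mono) auto
      finally show ?thesis by (simp add: mult_right_mono)
    qed
    then have "ennreal (c powr q x) \<le> ennreal (K * G powr s)" by (rule ennreal_leI)
    also have "\<dots> = ennreal K * ennreal (G powr s)" using K by (simp add: ennreal_mult')
    also have "\<dots> \<le> g x" unfolding g_def by (intro mult_left_mono Gs) simp
    finally show ?thesis using pot L by (intro exI[of _ c]) (auto simp: c_def)
  qed
  show ?thesis unfolding dominated_def mult_1_right using gm 1 2 by blast
qed

end

section \<open>Potentials away from the distinguished point\<close>

lemma pos_potential_add:
  assumes [measurable]: "f \<in> borel_measurable lebesgue" "g \<in> borel_measurable lebesgue"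
    and "\<And>y. 0 \<le> f y" "\<And>y. 0 \<le> g y"
  shows "pos_potential \<alpha> (\<lambda>y. f y + g y) x = pos_potential \<alpha> f x + pos_potential \<alpha> g x"
proof -
  have [measurable]: "(\<lambda>y. norm (x - y) powr (real DIM('a) - \<alpha> x)) \<in> borel_measurable lebesgue"
    by (rule measurable_completion) measurable
  show ?thesis unfolding pos_potential_def
    by (subst nn_integral_add[symmetric])
      (auto intro!: nn_integral_cong simp: add_divide_distrib assms ennreal_plus)
qed

lemma pos_potential_cmult:
  assumes [measurable]: "f \<in> borel_measurable lebesgue" and "0 \<le> c"
  shows "pos_potential \<alpha> (\<lambda>y. c * f y) x = ennreal c * pos_potential \<alpha> f x"
proof -
  have [measurable]: "(\<lambda>y. norm (x - y) powr (real DIM('a) - \<alpha> x)) \<in> borel_measurable lebesgue"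
    by (rule measurable_completion) measurable
  show ?thesis unfolding pos_potential_def
    by (subst nn_integral_cmult[symmetric]) (auto intro!: nn_integral_cong simp: ennreal_mult'[symmetric] assms)
qed

text \<open>
  The interval has length \<open>u/2\<close> and \<open>1/r > 1/u\<close> on it, so if \<open>\<omega>\<close> exceeded \<open>4 j + \<eta>\<close> everywhere, the
  integral would be at least \<open>2 j + \<eta>/2\<close>.  The positive \<open>\<eta>\<close> covers the case \<open>j = 0\<close>.
\<close>

lemma ex_below_mean:
  fixes \<omega> :: "real \<Rightarrow> real"
  assumes u: "0 < u" and \<eta>: "0 < \<eta>" and j: "0 \<le> j"
    and int: "(\<integral>\<^sup>+r\<in>{u/2<..<u}. ennreal (\<omega> r / r) \<partial>lebesgue) \<le> ennreal j"
  shows "\<exists>r\<in>{u/2<..<u}. \<omega> r \<le> 4 * j + \<eta>"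
proof (rule ccontr)
  assume "\<not> ?thesis"
  then have big: "4 * j + \<eta> < \<omega> r" if "r \<in> {u/2<..<u}" for r using that by force
  have "ennreal ((4 * j + \<eta>) / u * (u / 2)) = ennreal ((4 * j + \<eta>) / u) * emeasure lebesgue {u/2<..<u}"
    using u \<eta> j by (simp add: emeasure_completion ennreal_mult'[symmetric])
  also have "\<dots> = (\<integral>\<^sup>+r\<in>{u/2<..<u}. ennreal ((4 * j + \<eta>) / u) \<partial>lebesgue)"
    by (simp add: nn_integral_cmult_indicator)
  also have "\<dots> \<le> (\<integral>\<^sup>+r\<in>{u/2<..<u}. ennreal (\<omega> r / r) \<partial>lebesgue)"
  proof (intro nn_integral_mono)
    fix r
    show "ennreal ((4 * j + \<eta>) / u) * indicator {u/2<..<u} r \<le> ennreal (\<omega> r / r) * indicator {u/2<..<u} r"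
    proof (cases "r \<in> {u/2<..<u}")
      case True
      then have "(4 * j + \<eta>) / u \<le> \<omega> r / r"
        using big[OF True] u \<eta> j by (intro frac_le) auto
      then show ?thesis using True by (simp add: ennreal_leI)
    qed simp
  qed
  also have "\<dots> \<le> ennreal j" by (rule int)
  finally have "(4 * j + \<eta>) / u * (u / 2) \<le> j" using j by (simp add: ennreal_le_iff)
  then show False using u \<eta> j by simp
qed

text \<open>
  The weight \<open>\<omega>\<close> need not be monotone, so its values at prescribed dyadic radii are not controlled by
  the integral.  Choosing in each dyadic interval a radius where \<open>\<omega>\<close> is at most four times its
  integral there (plus a summable error) repairs this; the intervals are disjoint, so the integrals
  add up.
\<close>

lemma dyadic_selection:
  fixes \<omega> :: "real \<Rightarrow> real"
  assumes t: "0 < t" and J: "0 < J" and \<omega>0: "\<And>r. 0 < r \<Longrightarrow> r < t \<Longrightarrow> 0 \<le> \<omega> r"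
    and [measurable]: "(\<lambda>r. \<omega> r * indicator {0<..<t} r) \<in> borel_measurable lebesgue"
    and int: "(\<integral>\<^sup>+r\<in>{0<..<t}. ennreal (\<omega> r / r) \<partial>lebesgue) \<le> ennreal J"
  obtains s where "\<And>k::nat. t / 2 ^ (k + 2) < s k" "\<And>k. s k < t / 2 ^ (k + 1)"
    "(\<Sum>k. ennreal (\<omega> (s k))) \<le> ennreal (6 * J)"
proof -
  define f where "f r = ennreal (\<omega> r / r) * indicator {0<..<t} r" for r
  have "f = (\<lambda>r. ennreal (\<omega> r * indicator {0<..<t} r / r))"
    by (auto simp: fun_eq_iff f_def indicator_def)
  moreover have [measurable]: "(\<lambda>r::real. r) \<in> borel_measurable lebesgue"
    by (rule measurable_completion) measurable
  ultimately have [measurable]: "f \<in> borel_measurable lebesgue" by simp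
  define B where "B k = {t / 2 ^ (k + 2)<..<t / 2 ^ (k + 1)}" for k :: nat
  have Bt: "B k \<subseteq> {0<..<t}" for k
  proof -
    have "t / 2 ^ (k + 1) \<le> t / 1" using t by (intro divide_left_mono one_le_power) auto
    then show ?thesis using t by (auto simp: B_def intro: less_trans[rotated])
  qed
  have disj: "disjoint_family B"
    unfolding disjoint_family_on_def
  proof (intro ballI impI)
    fix i j :: nat assume "i \<noteq> j"
    have *: "B i \<inter> B j = {}" if "i < j" for i j
    proof -
      have "t / 2 ^ (j + 1) \<le> t / 2 ^ (i + 2)"
        using that t by (intro divide_left_mono power_increasing) auto
      then show ?thesis by (auto simp: B_def)
    qed
    show "B i \<inter> B j = {}" using *[of i j] *[of j i] \<open>i \<noteq> j\<close> by (cases "i < j") auto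
  qed
  have [measurable]: "B k \<in> sets lebesgue" for k by (simp add: B_def)
  define I where "I k = (\<integral>\<^sup>+r\<in>B k. f r \<partial>lebesgue)" for k
  have sumI: "(\<Sum>k. I k) \<le> ennreal J"
  proof -
    have "(\<Sum>k. I k) = (\<integral>\<^sup>+r\<in>(\<Union>k. B k). f r \<partial>lebesgue)"
      unfolding I_def by (rule nn_integral_disjoint_family[symmetric]) (auto simp: disj)
    also have "\<dots> \<le> (\<integral>\<^sup>+r. f r \<partial>lebesgue)"
      by (intro nn_integral_mono) (auto simp: indicator_def)
    finally show ?thesis using int by (simp add: f_def)
  qed
  define j where "j k = enn2real (I k)" for k
  have I: "I k = ennreal (j k)" for k
  proof -
    have "I k \<le> ennreal J" using ennreal_le_suminf[of I k] sumI by (rule order_trans)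
    then show ?thesis unfolding j_def by (intro ennreal_enn2real[symmetric]) (auto simp: less_top[symmetric] top_unique)
  qed
  have j0: "0 \<le> j k" for k by (simp add: j_def)
  have "\<exists>r\<in>B k. \<omega> r \<le> 4 * j k + J * (1 / 2) ^ k" for k
  proof -
    have "\<exists>r\<in>{t / 2 ^ (k + 1) / 2<..<t / 2 ^ (k + 1)}. \<omega> r \<le> 4 * j k + J * (1 / 2) ^ k"
    proof (rule ex_below_mean)
      have "(\<integral>\<^sup>+r\<in>{t / 2 ^ (k + 1) / 2<..<t / 2 ^ (k + 1)}. ennreal (\<omega> r / r) \<partial>lebesgue) = I k"
        unfolding I_def f_def using Bt[of k]
        by (intro nn_integral_cong) (auto simp: B_def indicator_def field_simps)
      then show "(\<integral>\<^sup>+r\<in>{t / 2 ^ (k + 1) / 2<..<t / 2 ^ (k + 1)}. ennreal (\<omega> r / r) \<partial>lebesgue) \<le> ennreal (j k)"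
        using I by simp
    qed (use t J j0 in auto)
    then show ?thesis by (simp add: B_def mult.commute)
  qed
  then obtain s where s: "\<And>k. s k \<in> B k" "\<And>k. \<omega> (s k) \<le> 4 * j k + J * (1 / 2) ^ k" by metis
  have "(\<Sum>k. ennreal (\<omega> (s k))) \<le> (\<Sum>k. ennreal 4 * ennreal (j k) + ennreal (J * (1 / 2) ^ k))"
  proof (intro suminf_le summableI)
    fix k
    have "ennreal (\<omega> (s k)) \<le> ennreal (4 * j k + J * (1 / 2) ^ k)" by (intro ennreal_leI s)
    then show "ennreal (\<omega> (s k)) \<le> ennreal 4 * ennreal (j k) + ennreal (J * (1 / 2) ^ k)"
      using j0 J by (simp add: ennreal_plus ennreal_mult)
  qed
  also have "\<dots> = ennreal 4 * (\<Sum>k. ennreal (j k)) + (\<Sum>k. ennreal (J * (1 / 2) ^ k))"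
    by (simp add: suminf_add[symmetric])
  also have "(\<Sum>k. ennreal (J * (1 / 2) ^ k)) = ennreal (J / (1 - 1/2))"
    using J by (intro suminf_ennreal_geometric) auto
  also have "ennreal 4 * (\<Sum>k. ennreal (j k)) + ennreal (J / (1 - 1/2)) \<le> ennreal 4 * ennreal J + ennreal (J / (1 - 1/2))"
    using sumI unfolding I by (intro add_mono mult_left_mono) auto
  also have "\<dots> = ennreal (4 * J + J / (1 - 1/2))"
    using J by (subst ennreal_plus, simp, simp, subst ennreal_mult) auto
  also have "4 * J + J / (1 - 1/2) = 6 * J" by simp
  finally have "(\<Sum>k. ennreal (\<omega> (s k))) \<le> ennreal (6 * J)" .
  then show thesis using s(1) by (intro that[of s]) (auto simp: B_def)
qed

context log_hoelder_setting
begin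

text \<open>
  On the shell between the radii \<open>r (k + 1)\<close> and \<open>r k\<close>, which differ by a factor of at most 4, the
  function \<open>F\<close> divided by \<open>M \<omega>(r (k + 1)) r (k + 1)^(- a)\<close> has modular at most 1, and
  \<open>ball_integral_le\<close> gives a multiple of \<open>M \<omega>(r (k + 1))\<close>: the powers of the radii cancel.  The
  shells exhaust the ball except for its centre.
\<close>

lemma integral_near_centre_le:
  fixes F :: "'a \<Rightarrow> real"
  assumes x0: "x0 \<in> \<Omega>" and [measurable]: "F \<in> borel_measurable lebesgue" and F0: "\<And>y. 0 \<le> F y"
    and Fz: "\<And>y. y \<notin> \<Omega> \<Longrightarrow> F y = 0" and t: "0 < t" "t \<le> D" and M: "0 < M"
    and w: "\<And>k::nat. 0 < w k" and r: "\<And>k::nat. t / 2 ^ (k + 2) < r k" "\<And>k. r k < t / 2 ^ (k + 1)"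
    and mod: "\<And>k. (\<integral>\<^sup>+y\<in>\<Omega> - ball x0 (r k).
        ennreal ((F y / (M * w k * r k powr - (real DIM('a) - real DIM('a) / p x0))) powr p y) \<partial>lebesgue) \<le> 1"
    and sum_w: "(\<Sum>k. ennreal (w k)) \<le> ennreal W" and W: "0 \<le> W"
  shows "(\<integral>\<^sup>+y\<in>ball x0 (r 0). ennreal (F y) \<partial>lebesgue)
    \<le> ennreal ((1 + E0 * unit_ball_vol (real DIM('a))) * 4 powr (real DIM('a) - real DIM('a) / p x0) * M * W)"
proof -
  define a where "a = real DIM('a) - real DIM('a) / p x0"
  have p0: "1 < p x0" using p_gt_1 x0 by auto
  have a: "0 \<le> a" using p0 by (simp add: a_def divide_le_eq)
  define b where "b = 1 + E0 * unit_ball_vol (real DIM('a))"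
  have b: "0 \<le> b" using E0_pos by (simp add: b_def)
  have rpos: "0 < r k" for k using r(1)[of k] t by (meson divide_pos_pos less_trans zero_less_numeral zero_less_power)
  have rD: "r k \<le> D" for k
  proof -
    have "t / 2 ^ (k + 1) \<le> t / 1" using t by (intro divide_left_mono one_le_power) auto
    then show ?thesis using r(2)[of k] t by linarith
  qed
  define m where "m k = M * w k * r k powr - a" for k
  have m: "0 < m k" for k
    using M w[of k] less_imp_neq[OF rpos[of k]] unfolding m_def by (intro mult_pos_pos) auto
  define S where "S k = ball x0 (r k) - ball x0 (r (Suc k))" for k
  have Sm [measurable]: "S k \<in> sets lebesgue" for k unfolding S_def by measurable
  have shell: "(\<integral>\<^sup>+y\<in>S k. ennreal (F y) \<partial>lebesgue) \<le> ennreal (b * 4 powr a * M * w (Suc k))" for k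
  proof -
    define g where "g y = F y * indicator (- ball x0 (r (Suc k))) y / m (Suc k)" for y
    have gm [measurable]: "g \<in> borel_measurable lebesgue" unfolding g_def by measurable
    have g0: "0 \<le> g y" for y using F0 m[of "Suc k"] by (simp add: g_def)
    have gz: "g y = 0" if "y \<notin> \<Omega>" for y using Fz[OF that] by (simp add: g_def)
    have "(\<integral>\<^sup>+y. ennreal (g y powr p y) \<partial>lebesgue) = (\<integral>\<^sup>+y\<in>\<Omega> - ball x0 (r (Suc k)).
        ennreal ((F y / (M * w (Suc k) * r (Suc k) powr - a)) powr p y) \<partial>lebesgue)"
      by (intro nn_integral_cong) (auto simp: g_def m_def Fz indicator_def)
    then have gmod: "(\<integral>\<^sup>+y. ennreal (g y powr p y) \<partial>lebesgue) \<le> 1"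
      using mod[of "Suc k"] by (simp add: a_def)
    have g: "unit_modular g" using gm g0 gz gmod unfolding unit_modular_def by blast
    have "(\<integral>\<^sup>+y\<in>S k. ennreal (F y) \<partial>lebesgue) \<le> (\<integral>\<^sup>+y. ennreal (m (Suc k)) * (ennreal (g y) * indicator (ball x0 (r k)) y) \<partial>lebesgue)"
    proof (intro nn_integral_mono)
      fix y
      have "y \<in> S k \<Longrightarrow> F y = m (Suc k) * g y" using m[of "Suc k"] by (simp add: S_def g_def)
      then show "ennreal (F y) * indicator (S k) y \<le> ennreal (m (Suc k)) * (ennreal (g y) * indicator (ball x0 (r k)) y)"
        using m[of "Suc k"] g0[of y] by (cases "y \<in> S k") (auto simp: ennreal_mult' S_def)
    qed
    also have "\<dots> = ennreal (m (Suc k)) * (\<integral>\<^sup>+y\<in>ball x0 (r k). ennreal (g y) \<partial>lebesgue)"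
      by (intro nn_integral_cmult) measurable
    also have "\<dots> \<le> ennreal (m (Suc k)) * ennreal (b * r k powr a)"
      unfolding a_def b_def
      by (intro mult_left_mono ball_integral_le) (use x0 rpos rD g in auto)
    also have "\<dots> = ennreal (m (Suc k) * (b * r k powr a))"
      using m[of "Suc k"] by (simp add: ennreal_mult')
    also have "\<dots> \<le> ennreal (b * 4 powr a * M * w (Suc k))"
    proof (rule ennreal_leI)
      have "t / 2 ^ (k + 1) = 4 * (t / 2 ^ (Suc k + 2))" by simp
      then have "r k \<le> 4 * r (Suc k)" using r(2)[of k] r(1)[of "Suc k"] by linarith
      then have "r k powr a \<le> (4 * r (Suc k)) powr a" using rpos[of k] a by (intro powr_mono2) auto
      also have "\<dots> = 4 powr a * r (Suc k) powr a" using rpos[of "Suc k"] by (simp add: powr_mult)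
      finally have "r k powr a \<le> 4 powr a * r (Suc k) powr a" .
      then have "m (Suc k) * (b * r k powr a) \<le> m (Suc k) * (b * (4 powr a * r (Suc k) powr a))"
        using m[of "Suc k"] b by (intro mult_left_mono) auto
      also have "\<dots> = b * 4 powr a * M * w (Suc k) * (r (Suc k) powr - a * r (Suc k) powr a)"
        by (simp add: m_def)
      also have "r (Suc k) powr - a * r (Suc k) powr a = 1"
        using rpos[of "Suc k"] by (simp add: powr_add[symmetric])
      finally show "m (Suc k) * (b * r k powr a) \<le> b * 4 powr a * M * w (Suc k)" by simp
    qed
    finally show ?thesis .
  qed
  have cover: "ennreal (F y) * indicator (ball x0 (r 0)) y \<le> (\<Sum>k. ennreal (F y) * indicator (S k) y)"
    if "y \<noteq> x0" for y
  proof (cases "y \<in> ball x0 (r 0)")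
    case True
    have d: "0 < dist x0 y" using that by simp
    obtain i :: nat where i: "t / dist x0 y < 2 ^ i"
      using real_arch_pow[of 2 "t / dist x0 y"] by auto
    have "t < dist x0 y * 2 ^ i" using i d by (simp add: field_simps)
    also have "dist x0 y * 2 ^ i \<le> dist x0 y * 2 ^ (i + 1)" using d by simp
    finally have "t / 2 ^ (i + 1) < dist x0 y" using d by (simp add: field_simps)
    then have ex: "y \<notin> ball x0 (r i)" using r(2)[of i] by simp
    define l where "l = (LEAST i. y \<notin> ball x0 (r i))"
    have l: "y \<notin> ball x0 (r l)" unfolding l_def using ex by (rule LeastI)
    then obtain k where k: "l = Suc k" using True by (cases l) auto
    then have "y \<in> ball x0 (r k)" using not_less_Least[of k "\<lambda>i. y \<notin> ball x0 (r i)"] by (auto simp: l_def)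
    then have "y \<in> S k" using l k by (simp add: S_def)
    then have "ennreal (F y) * indicator (ball x0 (r 0)) y = ennreal (F y) * indicator (S k) y" using True by simp
    also have "\<dots> \<le> (\<Sum>k. ennreal (F y) * indicator (S k) y)" by (rule ennreal_le_suminf)
    finally show ?thesis .
  qed simp
  have "AE y in lebesgue. y \<noteq> x0" by (rule AE_completion[OF AE_lborel_singleton])
  then have "(\<integral>\<^sup>+y\<in>ball x0 (r 0). ennreal (F y) \<partial>lebesgue) \<le> (\<integral>\<^sup>+y. (\<Sum>k. ennreal (F y) * indicator (S k) y) \<partial>lebesgue)"
    by (intro nn_integral_mono_AE) (rule eventually_mono, assumption, rule cover)
  also have "\<dots> = (\<Sum>k. \<integral>\<^sup>+y\<in>S k. ennreal (F y) \<partial>lebesgue)"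
    by (intro nn_integral_suminf) measurable
  also have "\<dots> \<le> (\<Sum>k. ennreal (b * 4 powr a * M) * ennreal (w (Suc k)))"
  proof (intro suminf_le summableI)
    fix k
    show "(\<integral>\<^sup>+y\<in>S k. ennreal (F y) \<partial>lebesgue) \<le> ennreal (b * 4 powr a * M) * ennreal (w (Suc k))"
      using shell[of k] b M by (simp add: ennreal_mult'[symmetric])
  qed
  also have "\<dots> = ennreal (b * 4 powr a * M) * (\<Sum>k. ennreal (w (Suc k)))" by simp
  also have "(\<Sum>k. ennreal (w (Suc k))) \<le> (\<Sum>k. ennreal (w k))"
  proof (rule suminf_le_const)
    fix N
    have "(\<Sum>k<N. ennreal (w (Suc k))) = (\<Sum>k\<in>Suc ` {..<N}. ennreal (w k))"
      by (simp add: sum.reindex)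
    also have "\<dots> \<le> (\<Sum>k. ennreal (w k))" by (intro sum_le_suminf) auto
    finally show "(\<Sum>k<N. ennreal (w (Suc k))) \<le> (\<Sum>k. ennreal (w k))" .
  qed simp
  also note sum_w
  finally have "(\<integral>\<^sup>+y\<in>ball x0 (r 0). ennreal (F y) \<partial>lebesgue) \<le> ennreal (b * 4 powr a * M) * ennreal W"
    by (simp add: mult_left_mono)
  also have "\<dots> = ennreal (b * 4 powr a * M * W)" using b M by (simp add: ennreal_mult')
  finally show ?thesis by (simp add: a_def b_def)
qed

text \<open>
  From \<open>\<bar>x0 - y\<bar> \<le> t/2 \<le> \<bar>x0 - x\<bar>/2\<close> it follows that \<open>\<bar>x - y\<bar> \<ge> \<bar>x0 - x\<bar>/2\<close>, so the kernel can be
  evaluated at \<open>x0\<close> and taken out of the integral.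
\<close>

lemma potential_near_centre_le:
  fixes F :: "'a \<Rightarrow> real"
  assumes x: "x \<in> \<Omega>" and [measurable]: "F \<in> borel_measurable lebesgue" and F0: "\<And>y. 0 \<le> F y"
    and t: "0 < t" "t \<le> norm (x0 - x)" and r: "r \<le> t / 2" and Fr: "\<And>y. y \<notin> ball x0 r \<Longrightarrow> F y = 0"
    and int: "(\<integral>\<^sup>+y. ennreal (F y) \<partial>lebesgue) \<le> ennreal Q"
  shows "pos_potential \<alpha> F x \<le> ennreal (2 powr real DIM('a) * norm (x0 - x) powr - (real DIM('a) - \<alpha> x) * Q)"
proof -
  define \<rho> where "\<rho> = norm (x0 - x)"
  have \<rho>: "0 < \<rho>" using t unfolding \<rho>_def by linarith
  define c where "c = 2 powr real DIM('a) * \<rho> powr - (real DIM('a) - \<alpha> x)"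
  have c: "0 \<le> c" by (simp add: c_def)
  have \<alpha>: "\<alpha> x \<le> real DIM('a)" "0 < \<alpha> x" using \<alpha>_le[OF x] \<alpha>_ge[OF x] a0 by auto
  have "pos_potential \<alpha> F x \<le> (\<integral>\<^sup>+y. ennreal c * ennreal (F y) \<partial>lebesgue)"
    unfolding pos_potential_def
  proof (intro nn_integral_mono)
    fix y
    show "ennreal (F y / norm (x - y) powr (real DIM('a) - \<alpha> x)) \<le> ennreal c * ennreal (F y)"
    proof (cases "y \<in> ball x0 r")
      case True
      then have "norm (x0 - y) < t / 2" using r by (simp add: dist_norm)
      moreover have "\<rho> \<le> norm (x0 - y) + norm (x - y)"
        unfolding \<rho>_def using norm_triangle_ineq[of "x0 - y" "y - x"] by (simp add: norm_minus_commute)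
      ultimately have ge: "\<rho> / 2 \<le> norm (x - y)" using t by (simp add: \<rho>_def)
      have "F y / norm (x - y) powr (real DIM('a) - \<alpha> x) \<le> F y / (\<rho> / 2) powr (real DIM('a) - \<alpha> x)"
      proof (rule divide_left_mono)
        show "(\<rho> / 2) powr (real DIM('a) - \<alpha> x) \<le> norm (x - y) powr (real DIM('a) - \<alpha> x)"
          using ge \<rho> \<alpha> by (intro powr_mono2) auto
        have "0 < norm (x - y)" using ge \<rho> by linarith
        then show "0 < norm (x - y) powr (real DIM('a) - \<alpha> x) * (\<rho> / 2) powr (real DIM('a) - \<alpha> x)" using \<rho> by simp
      qed (rule F0)
      also have "\<dots> = 2 powr (real DIM('a) - \<alpha> x) * \<rho> powr - (real DIM('a) - \<alpha> x) * F y"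
        using \<rho> powr_minus_divide[of \<rho> "real DIM('a) - \<alpha> x"] by (simp add: powr_divide)
      also have "\<dots> \<le> c * F y"
        unfolding c_def using \<alpha> F0 by (intro mult_right_mono powr_mono) auto
      finally show ?thesis using c by (simp add: ennreal_mult'[symmetric] ennreal_leI)
    qed (simp add: Fr)
  qed
  also have "\<dots> = ennreal c * (\<integral>\<^sup>+y. ennreal (F y) \<partial>lebesgue)"
    by (intro nn_integral_cmult) measurable
  also have "\<dots> \<le> ennreal c * ennreal Q" by (intro mult_left_mono int) simp
  also have "\<dots> = ennreal (c * Q)" using c by (simp add: ennreal_mult')
  finally show ?thesis by (simp add: c_def \<rho>_def)
qed

text \<open>
  The first factor collects the constants of the outer and of the inner part, raised to an upper bound
  of \<open>q\<close>; the second adds the modulars of the two parts, bounded by \<open>sobolev_modular\<close> and, with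
  \<open>power_tail_le\<close>, by \<open>nn_integral_tail_bound\<close>.
\<close>

definition potential_const where
  "potential_const x0 =
     (2 * (1 + 6 * 4 powr (real DIM('a) - real DIM('a) / p x0) +
        2 powr real DIM('a) * ((1 + E0 * unit_ball_vol (real DIM('a))) * 4 powr (real DIM('a) - real DIM('a) / p x0) * 6))) powr (1 / \<kappa>) *
     (sobolev_const + exp (real DIM('a) * A / \<kappa>) *
        (unit_ball_vol (real DIM('a)) * 4 powr real DIM('a) / (1 - 2 powr - (real DIM('a) - real DIM('a) / p x0))))"

text \<open>
  The central estimate, for one radius \<open>t\<close>; \<open>M\<close> stands for the norm of \<open>F\<close> in the source space.  Cut at the radius \<open>r 0\<close> between \<open>t/4\<close> and \<open>t/2\<close>, \<open>F\<close> is the sum of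
  \<open>m f1\<close>, with the modular of \<open>f1\<close> at most 1 and \<open>m\<close> at most a multiple of \<open>M J t^(- a)\<close>, and of a
  function supported near \<open>x0\<close>, whose potential is \<open>M J t^(- a)\<close> times the function that
  \<open>power_tail_le\<close> estimates.
\<close>

lemma potential_modular:
  assumes x0: "x0 \<in> \<Omega>" and Fm [measurable]: "F \<in> borel_measurable lebesgue"
    and F0: "\<And>y. 0 \<le> F y" and Fz: "\<And>y. y \<notin> \<Omega> \<Longrightarrow> F y = 0"
    and M: "0 < M" and t: "0 < t" and tD: "t \<le> D" and J: "0 < J"
    and \<omega>: "\<And>r. 0 < r \<Longrightarrow> r < t \<Longrightarrow> 0 < \<omega> r"
    and \<omega>m: "(\<lambda>r. \<omega> r * indicator {0<..<t} r) \<in> borel_measurable lebesgue"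
    and int: "(\<integral>\<^sup>+r\<in>{0<..<t}. ennreal (\<omega> r / r) \<partial>lebesgue) \<le> ennreal J"
    and mod: "\<And>r. 0 < r \<Longrightarrow> r < t \<Longrightarrow> (\<integral>\<^sup>+y\<in>\<Omega> - ball x0 r.
       ennreal ((F y / (M * \<omega> r * r powr - (real DIM('a) - real DIM('a) / p x0))) powr p y) \<partial>lebesgue) \<le> 1"
  shows "dominated F (\<Omega> - ball x0 t) (M * J * t powr - (real DIM('a) - real DIM('a) / p x0)) (potential_const x0)"
proof -
  define a where "a = real DIM('a) - real DIM('a) / p x0"
  have p0: "1 < p x0" using p_gt_1 x0 by auto
  have a: "0 < a" using p0 by (simp add: a_def divide_less_eq)
  define B where "B = unit_ball_vol (real DIM('a)) * 4 powr real DIM('a) / (1 - 2 powr - a)"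
  have "2 powr - a < 1" using a by (simp add: powr_less_one)
  then have B: "0 \<le> B" unfolding B_def by (intro divide_nonneg_nonneg mult_nonneg_nonneg) auto
  define E where "E = exp (real DIM('a) * A / \<kappa>)"
  have E: "0 < E" by (simp add: E_def)
  define L1 where "L1 = 6 * 4 powr a"
  define L2 where "L2 = 2 powr real DIM('a) * ((1 + E0 * unit_ball_vol (real DIM('a))) * 4 powr a * 6)"
  define L where "L = 1 + L1 + L2"
  have L1: "0 \<le> L1" by (simp add: L1_def)
  have L2: "0 \<le> L2" using E0_pos by (simp add: L2_def)
  have L: "1 \<le> L" using L1 L2 by (simp add: L_def)
  define K1 where "K1 = (2 * L) powr (1 / \<kappa>)"
  have K1: "0 < K1" using L by (simp add: K1_def)
  have K_eq: "potential_const x0 = K1 * (sobolev_const + E * B)"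
    by (simp add: potential_const_def K1_def L_def L1_def L2_def E_def B_def a_def)
  have \<omega>0: "0 \<le> \<omega> r" if "0 < r" "r < t" for r using \<omega>[OF that] by simp
  obtain r where r: "\<And>k::nat. t / 2 ^ (k + 2) < r k" "\<And>k. r k < t / 2 ^ (k + 1)"
    and sum_\<omega>: "(\<Sum>k. ennreal (\<omega> (r k))) \<le> ennreal (6 * J)"
    using dyadic_selection[OF t J \<omega>0 \<omega>m int] by blast
  have rt: "0 < r k" "r k < t" for k
  proof -
    show "0 < r k" using r(1)[of k] t by (meson divide_pos_pos less_trans zero_less_numeral zero_less_power)
    have "t / 2 ^ (k + 1) \<le> t / 1" using t by (intro divide_left_mono one_le_power) auto
    then show "r k < t" using r(2)[of k] by linarith
  qed
  define \<Lambda> where "\<Lambda> = M * J * t powr - a"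
  have \<Lambda>: "0 < \<Lambda>" using M J t by (simp add: \<Lambda>_def)
  define m where "m = M * \<omega> (r 0) * r 0 powr - a"
  have m: "0 < m" using M \<omega>[OF rt] less_imp_neq[OF rt(1)[of 0]] unfolding m_def by (intro mult_pos_pos) auto
  have m_le: "m \<le> L1 * \<Lambda>"
  proof -
    have "ennreal (\<omega> (r 0)) \<le> ennreal (6 * J)"
      using ennreal_le_suminf[of "\<lambda>k. ennreal (\<omega> (r k))" 0] sum_\<omega> by (rule order_trans)
    then have "\<omega> (r 0) \<le> 6 * J" using J by (simp add: ennreal_le_iff)
    moreover have "r 0 powr - a \<le> (t / 4) powr - a"
      using r(1)[of 0] t a by (intro powr_mono2') auto
    moreover have "(t / 4) powr - a = 4 powr a * t powr - a"
      using t by (simp add: powr_divide powr_minus divide_simps)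
    ultimately have "\<omega> (r 0) * r 0 powr - a \<le> (6 * J) * (4 powr a * t powr - a)"
      using J by (intro mult_mono) auto
    then have "M * (\<omega> (r 0) * r 0 powr - a) \<le> M * ((6 * J) * (4 powr a * t powr - a))"
      using M by (intro mult_left_mono) auto
    then show ?thesis by (simp add: m_def L1_def \<Lambda>_def mult_ac)
  qed
  define f1 where "f1 y = F y * indicator (- ball x0 (r 0)) y / m" for y
  define F2 where "F2 y = F y * indicator (ball x0 (r 0)) y" for y
  have f1m [measurable]: "f1 \<in> borel_measurable lebesgue" and [measurable]: "F2 \<in> borel_measurable lebesgue"
    unfolding f1_def F2_def by measurable
  have f10: "0 \<le> f1 y" and F20: "0 \<le> F2 y" for y using F0 m by (auto simp: f1_def F2_def)
  have f1z: "f1 y = 0" if "y \<notin> \<Omega>" for y using Fz[OF that] by (simp add: f1_def)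
  have F_split: "F = (\<lambda>y. m * f1 y + F2 y)"
    using m by (auto simp: fun_eq_iff f1_def F2_def indicator_def)
  have "(\<integral>\<^sup>+y. ennreal (f1 y powr p y) \<partial>lebesgue) = (\<integral>\<^sup>+y\<in>\<Omega> - ball x0 (r 0).
      ennreal ((F y / (M * \<omega> (r 0) * r 0 powr - a)) powr p y) \<partial>lebesgue)"
    by (intro nn_integral_cong) (auto simp: f1_def m_def Fz indicator_def)
  then have "(\<integral>\<^sup>+y. ennreal (f1 y powr p y) \<partial>lebesgue) \<le> 1"
    using mod[OF rt, of 0] by (simp add: a_def)
  then have f1: "unit_modular f1" using f1m f10 f1z unfolding unit_modular_def by blast
  obtain g1 where [measurable]: "g1 \<in> borel_measurable lebesgue"
    and g1: "(\<integral>\<^sup>+x\<in>\<Omega>. g1 x \<partial>lebesgue) \<le> ennreal sobolev_const"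
    and g1c: "\<And>x. x \<in> \<Omega> \<Longrightarrow> g1 x < \<infinity> \<Longrightarrow>
        \<exists>c\<ge>0. pos_potential \<alpha> f1 x \<le> ennreal c \<and> ennreal (c powr q x) \<le> g1 x"
    using sobolev_modular[OF f1] unfolding dominated_def mult_1_right by auto
  have F2int: "(\<integral>\<^sup>+y. ennreal (F2 y) \<partial>lebesgue) \<le> ennreal ((1 + E0 * unit_ball_vol (real DIM('a))) * 4 powr a * M * (6 * J))"
  proof -
    have "(\<integral>\<^sup>+y. ennreal (F2 y) \<partial>lebesgue) = (\<integral>\<^sup>+y\<in>ball x0 (r 0). ennreal (F y) \<partial>lebesgue)"
      by (intro nn_integral_cong) (auto simp: F2_def indicator_def)
    also have "\<dots> \<le> ennreal ((1 + E0 * unit_ball_vol (real DIM('a))) * 4 powr a * M * (6 * J))"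
      unfolding a_def
      by (rule integral_near_centre_le[where w = "\<lambda>k. \<omega> (r k)" and r = r and t = t])
        (use x0 F0 Fz t tD M \<omega> rt r mod sum_\<omega> J in auto)
    finally show ?thesis .
  qed
  define k where "k x = norm (x0 - x) powr - real DIM('a) * (t / norm (x0 - x)) powr a" for x
  have [measurable]: "k \<in> borel_measurable lebesgue"
    unfolding k_def by (rule measurable_completion) measurable
  define g where "g x = ennreal K1 * (g1 x + ennreal E * (ennreal (k x) * indicator (- ball x0 t) x))" for x
  have gm: "g \<in> borel_measurable lebesgue" unfolding g_def by measurable
  have gint: "(\<integral>\<^sup>+x\<in>\<Omega>. g x \<partial>lebesgue) \<le> ennreal (potential_const x0)"
  proof -
    have [measurable]: "\<Omega> \<in> sets lebesgue" using Omega by (rule fmeasurableD)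
    have "(\<integral>\<^sup>+x\<in>\<Omega>. g x \<partial>lebesgue) \<le>
       (\<integral>\<^sup>+x. ennreal K1 * (g1 x * indicator \<Omega> x + ennreal E * (ennreal (k x) * indicator (- ball x0 t) x)) \<partial>lebesgue)"
      by (intro nn_integral_mono) (auto simp: g_def indicator_def)
    also have "\<dots> = ennreal K1 * ((\<integral>\<^sup>+x\<in>\<Omega>. g1 x \<partial>lebesgue) +
        ennreal E * (\<integral>\<^sup>+x\<in>- ball x0 t. ennreal (k x) \<partial>lebesgue))"
      by (subst nn_integral_cmult, measurable, subst nn_integral_add) (auto simp: nn_integral_cmult)
    also have "\<dots> \<le> ennreal K1 * (ennreal sobolev_const + ennreal E * ennreal B)"
      using nn_integral_tail_bound[OF a t] unfolding k_def B_def by (intro mult_left_mono add_mono g1) auto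
    also have "\<dots> = ennreal (potential_const x0)"
      using K1 sobolev_const_nonneg E B by (simp add: K_eq ennreal_plus ennreal_mult')
    finally show ?thesis .
  qed
  have pw: "\<exists>c\<ge>0. pos_potential \<alpha> F x \<le> ennreal (c * \<Lambda>) \<and> ennreal (c powr q x) \<le> g x"
    if x: "x \<in> \<Omega>" "x \<notin> ball x0 t" and fin: "g x < \<infinity>" for x
  proof -
    have \<rho>: "t \<le> norm (x0 - x)" using x by (simp add: dist_norm)
    note qx = q_bounds[OF x(1)]
    have "g1 x < \<infinity>" using fin K1 by (auto simp: g_def less_top[symmetric] ennreal_mult_eq_top_iff)
    then obtain c1 where c1: "0 \<le> c1" "pos_potential \<alpha> f1 x \<le> ennreal c1" "ennreal (c1 powr q x) \<le> g1 x"
      using g1c[OF x(1)] by blast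
    define \<tau> where "\<tau> = t powr a * norm (x0 - x) powr - (real DIM('a) - \<alpha> x)"
    have \<tau>: "0 \<le> \<tau>" by (simp add: \<tau>_def)
    \<comment> \<open>The two summands are the contributions of the outer and of the inner part, in units of \<open>\<Lambda>\<close>.\<close>
    define c where "c = L1 * c1 + L2 * \<tau>"
    have c: "0 \<le> c" using L1 L2 c1 \<tau> by (simp add: c_def)
    have "pos_potential \<alpha> F x = ennreal m * pos_potential \<alpha> f1 x + pos_potential \<alpha> F2 x"
      unfolding F_split using m f10 F20
      by (subst pos_potential_add) (auto simp: pos_potential_cmult)
    also have "\<dots> \<le> ennreal (L1 * \<Lambda>) * ennreal c1 + ennreal (2 powr real DIM('a) * norm (x0 - x) powr - (real DIM('a) - \<alpha> x) * ((1 + E0 * unit_ball_vol (real DIM('a))) * 4 powr a * M * (6 * J)))"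
    proof (intro add_mono mult_mono ennreal_leI m_le c1)
      show "pos_potential \<alpha> F2 x \<le> ennreal (2 powr real DIM('a) * norm (x0 - x) powr - (real DIM('a) - \<alpha> x) * ((1 + E0 * unit_ball_vol (real DIM('a))) * 4 powr a * M * (6 * J)))"
      proof (rule potential_near_centre_le[where r = "r 0"])
        show "r 0 \<le> t / 2" using r(2)[of 0] by simp
        show "F2 y = 0" if "y \<notin> ball x0 (r 0)" for y using that by (simp add: F2_def)
      qed (use x \<rho> t F20 F2int in auto)
    qed auto
    also have "2 powr real DIM('a) * norm (x0 - x) powr - (real DIM('a) - \<alpha> x) * ((1 + E0 * unit_ball_vol (real DIM('a))) * 4 powr a * M * (6 * J)) = L2 * \<tau> * \<Lambda>"
    proof -
      have "t powr a * t powr - a = 1" using t by (simp add: powr_add[symmetric])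
      then have "\<tau> * \<Lambda> = norm (x0 - x) powr - (real DIM('a) - \<alpha> x) * (M * J)"
        unfolding \<tau>_def \<Lambda>_def by (metis mult.assoc mult.commute mult.right_neutral)
      then show ?thesis unfolding L2_def by (simp add: mult.assoc) 
    qed
    also have "ennreal (L1 * \<Lambda>) * ennreal c1 + ennreal (L2 * \<tau> * \<Lambda>) = ennreal (c * \<Lambda>)"
    proof -
      have "ennreal (L1 * \<Lambda>) * ennreal c1 = ennreal (L1 * \<Lambda> * c1)"
        using L1 \<Lambda> c1 by (intro ennreal_mult[symmetric]) auto
      moreover have "ennreal (L1 * \<Lambda> * c1) + ennreal (L2 * \<tau> * \<Lambda>) = ennreal (L1 * \<Lambda> * c1 + L2 * \<tau> * \<Lambda>)"
        using L1 \<Lambda> c1 L2 \<tau> by (intro ennreal_plus[symmetric]) auto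
      ultimately show ?thesis by (simp add: c_def algebra_simps)
    qed
    finally have pot: "pos_potential \<alpha> F x \<le> ennreal (c * \<Lambda>)" .
    have "c powr q x \<le> K1 * (c1 powr q x + E * k x)"
    proof -
      have "c \<le> L * c1 + L * \<tau>"
        unfolding c_def using L1 L2 c1 \<tau> by (intro add_mono mult_right_mono) (auto simp: L_def)
      then have "c \<le> L * (c1 + \<tau>)" by (simp add: distrib_left)
      then have "c powr q x \<le> (L * (c1 + \<tau>)) powr q x" using c qx by (intro powr_mono2) auto
      also have "\<dots> = L powr q x * (c1 + \<tau>) powr q x" by (rule powr_mult)
      also have "\<dots> \<le> L powr q x * (2 powr q x * (c1 powr q x + \<tau> powr q x))"
        using c1 \<tau> qx by (intro mult_left_mono powr_add_le) auto
      also have "\<dots> = (2 * L) powr q x * (c1 powr q x + \<tau> powr q x)"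
        using powr_mult[of 2 L "q x"] by simp
      also have "\<dots> \<le> K1 * (c1 powr q x + E * k x)"
      proof (intro mult_mono add_mono order_refl)
        show "(2 * L) powr q x \<le> K1" unfolding K1_def using L qx by (intro powr_mono) auto
        show "\<tau> powr q x \<le> E * k x"
          unfolding \<tau>_def k_def E_def a_def by (rule power_tail_le) (use x0 x t \<rho> in auto)
      qed (use K1 in auto)
      finally show ?thesis .
    qed
    then have "ennreal (c powr q x) \<le> ennreal (K1 * (c1 powr q x + E * k x))" by (rule ennreal_leI)
    also have "\<dots> = ennreal K1 * (ennreal (c1 powr q x) + ennreal E * ennreal (k x))"
      using K1 E by (simp add: ennreal_mult' ennreal_plus k_def)
    also have "\<dots> \<le> ennreal K1 * (g1 x + ennreal E * ennreal (k x))"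
      by (intro mult_left_mono add_mono c1) auto
    also have "\<dots> = g x" using x(2) unfolding g_def by simp
    finally show ?thesis using c pot by blast
  qed
  show ?thesis unfolding dominated_def using gm gint pw unfolding \<Lambda>_def a_def by blast
qed

end

section \<open>Exponents of class WL and the Luxemburg norm\<close>

lemma WL_continuous_on:
  assumes "p \<in> WL \<Omega>" shows "continuous_on \<Omega> p"
proof -
  obtain A where A: "0 < A" and wl: "\<And>x y. x \<in> \<Omega> \<Longrightarrow> y \<in> \<Omega> \<Longrightarrow> x \<noteq> y \<Longrightarrow> norm (x - y) \<le> 1/2 \<Longrightarrow>
     \<bar>p x - p y\<bar> \<le> A / (- ln (norm (x - y)))"
    using assms unfolding WL_def by blast
  show ?thesis
    unfolding continuous_on_iff
  proof (intro ballI allI impI)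
    fix x e assume x: "x \<in> \<Omega>" and e: "0 < (e::real)"
    define d where "d = min (1/2) (exp (- (A / e)))"
    have d: "0 < d" by (simp add: d_def)
    have "dist (p y) (p x) < e" if y: "y \<in> \<Omega>" "dist y x < d" for y
    proof (cases "y = x")
      case False
      have n: "0 < norm (y - x)" "norm (y - x) < 1/2" "norm (y - x) < exp (- (A / e))"
        using False y by (auto simp: d_def dist_norm)
      have "ln (norm (y - x)) < ln (exp (- (A / e)))" using n by (subst ln_less_cancel_iff) auto
      then have l: "A / e < - ln (norm (y - x))" by simp
      then have "0 < - ln (norm (y - x))" using A e divide_pos_pos[of A e] by linarith
      moreover have "A < e * - ln (norm (y - x))" using l e by (simp only: pos_divide_less_eq mult.commute)
      ultimately have "A / (- ln (norm (y - x))) < e" by (simp only: pos_divide_less_eq)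
      then show ?thesis using wl[of y x] x y False n by (simp add: dist_real_def)
    qed (use e in simp)
    then show "\<exists>d>0. \<forall>x'\<in>\<Omega>. dist x' x < d \<longrightarrow> dist (p x') (p x) < e" using d by blast
  qed
qed

text \<open>
  For \<open>r \<le> 1/2\<close> the definition of the class applies, as \<open>\<bar>ln r\<bar>\<close> is at most \<open>- ln \<bar>x - y\<bar>\<close>; for
  larger \<open>r\<close> the logarithm is bounded and so is \<open>p\<close>.
\<close>

lemma WL_log_bound:
  assumes "p \<in> WL \<Omega>" and B: "\<And>x. x \<in> \<Omega> \<Longrightarrow> \<bar>p x\<bar> \<le> B" and "0 \<le> B" and D: "1 \<le> D"
  obtains A where
    "\<And>x y r. x \<in> \<Omega> \<Longrightarrow> y \<in> \<Omega> \<Longrightarrow> norm (x - y) \<le> r \<Longrightarrow> 0 < r \<Longrightarrow> r \<le> D \<Longrightarrow> \<bar>p x - p y\<bar> * \<bar>ln r\<bar> \<le> A"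
proof -
  obtain A where A: "0 < A" and wl: "\<And>x y. x \<in> \<Omega> \<Longrightarrow> y \<in> \<Omega> \<Longrightarrow> x \<noteq> y \<Longrightarrow> norm (x - y) \<le> 1/2 \<Longrightarrow>
     \<bar>p x - p y\<bar> \<le> A / (- ln (norm (x - y)))"
    using assms(1) unfolding WL_def by blast
  define A' where "A' = A + (2 * B) * (ln 2 + ln D)"
  have A': "0 \<le> A'" using A D \<open>0 \<le> B\<close> by (simp add: A'_def)
  have main: "\<bar>p x - p y\<bar> * \<bar>ln r\<bar> \<le> A'"
    if xy: "x \<in> \<Omega>" "y \<in> \<Omega>" and r: "norm (x - y) \<le> r" "0 < r" "r \<le> D" for x y r
  proof (cases "x = y")
    case False
    show ?thesis
    proof (cases "r \<le> 1/2")
      case True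
      have n: "0 < norm (x - y)" "norm (x - y) \<le> 1/2" using False r True by auto
      have "ln (norm (x - y)) \<le> ln r" "ln r < 0" using n r True by (auto simp: ln_less_zero)
      then have "\<bar>ln r\<bar> \<le> - ln (norm (x - y))" "0 < - ln (norm (x - y))" by auto
      then have "\<bar>p x - p y\<bar> * \<bar>ln r\<bar> \<le> (A / (- ln (norm (x - y)))) * (- ln (norm (x - y)))"
        using wl[OF xy False n(2)] by (intro mult_mono) auto
      also have "\<dots> = A" using \<open>0 < - ln (norm (x - y))\<close> by simp
      also have "A \<le> A'" using D \<open>0 \<le> B\<close> by (simp add: A'_def)
      finally show ?thesis .
    next
      case False
      have "- ln 2 \<le> ln r"
      proof -
        have "ln (1/2) \<le> ln r" using False by (subst ln_le_cancel_iff) auto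
        then show ?thesis by (simp add: ln_div)
      qed
      moreover have "ln r \<le> ln D" using r D by simp
      moreover have "0 \<le> ln D" "0 \<le> ln (2::real)" using D by auto
      ultimately have "\<bar>ln r\<bar> \<le> ln 2 + ln D" by linarith
      moreover have "\<bar>p x - p y\<bar> \<le> 2 * B" using B[OF xy(1)] B[OF xy(2)] by linarith
      ultimately have "\<bar>p x - p y\<bar> * \<bar>ln r\<bar> \<le> (2 * B) * (ln 2 + ln D)"
        using \<open>0 \<le> B\<close> by (intro mult_mono) auto
      then show ?thesis using A by (simp add: A'_def)
    qed
  qed (use A' in simp)
  show thesis by (rule that[OF main])
qed

lemma modular_le_1_of_norm_less:
  assumes "luxemburg_norm p E f < ennreal \<eta>" and p: "\<And>x. x \<in> E \<Longrightarrow> 0 \<le> p x"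
  shows "(\<integral>\<^sup>+x\<in>E. ennreal (\<bar>f x / \<eta>\<bar> powr p x) \<partial>lebesgue) \<le> 1"
proof -
  obtain \<theta> where \<theta>: "0 < \<theta>" "ennreal \<theta> < ennreal \<eta>"
    and mod: "(\<integral>\<^sup>+x\<in>E. ennreal (\<bar>f x / \<theta>\<bar> powr p x) \<partial>lebesgue) \<le> 1"
    using assms(1) unfolding luxemburg_norm_def Inf_less_iff by auto
  have le: "\<theta> \<le> \<eta>" using \<theta> by (simp add: ennreal_less_iff)
  have "(\<integral>\<^sup>+x\<in>E. ennreal (\<bar>f x / \<eta>\<bar> powr p x) \<partial>lebesgue) \<le> (\<integral>\<^sup>+x\<in>E. ennreal (\<bar>f x / \<theta>\<bar> powr p x) \<partial>lebesgue)"
  proof (intro nn_integral_mono)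
    fix x
    show "ennreal (\<bar>f x / \<eta>\<bar> powr p x) * indicator E x \<le> ennreal (\<bar>f x / \<theta>\<bar> powr p x) * indicator E x"
    proof (cases "x \<in> E")
      case True
      have "\<bar>f x / \<eta>\<bar> \<le> \<bar>f x / \<theta>\<bar>" using \<theta>(1) le by (simp add: abs_divide frac_le)
      then have "\<bar>f x / \<eta>\<bar> powr p x \<le> \<bar>f x / \<theta>\<bar> powr p x" using p[OF True] by (intro powr_mono2) auto
      then show ?thesis using True by (simp add: ennreal_leI)
    qed simp
  qed
  then show ?thesis using mod by (rule order_trans)
qed

text \<open>
  Enlarging the denominator by \<open>K \<ge> 1\<close> divides the modular by at least \<open>K\<close>, because the exponent is
  at least 1.
\<close>

lemma luxemburg_norm_le:
  assumes \<eta>: "0 < \<eta>" and K: "1 \<le> K" and q: "\<And>x. x \<in> E \<Longrightarrow> 1 \<le> q x"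
    and [measurable]: "g \<in> borel_measurable lebesgue" "E \<in> sets lebesgue"
    and g: "AE x in lebesgue. x \<in> E \<longrightarrow> ennreal (\<bar>f x / \<eta>\<bar> powr q x) \<le> g x"
    and int: "(\<integral>\<^sup>+x\<in>E. g x \<partial>lebesgue) \<le> ennreal K"
  shows "luxemburg_norm q E f \<le> ennreal (K * \<eta>)"
proof -
  have "(\<integral>\<^sup>+x\<in>E. ennreal (\<bar>f x / (K * \<eta>)\<bar> powr q x) \<partial>lebesgue) \<le>
     (\<integral>\<^sup>+x. ennreal (1 / K) * (g x * indicator E x) \<partial>lebesgue)"
  proof (rule nn_integral_mono_AE, use g in eventually_elim)
    fix x
    assume *: "x \<in> E \<longrightarrow> ennreal (\<bar>f x / \<eta>\<bar> powr q x) \<le> g x"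
    show "ennreal (\<bar>f x / (K * \<eta>)\<bar> powr q x) * indicator E x \<le> ennreal (1 / K) * (g x * indicator E x)"
    proof (cases "x \<in> E")
      case True
      have "\<bar>f x / (K * \<eta>)\<bar> powr q x = (1 / K) powr q x * \<bar>f x / \<eta>\<bar> powr q x"
      proof -
        have "\<bar>f x / (K * \<eta>)\<bar> = (1 / K) * \<bar>f x / \<eta>\<bar>" using K \<eta> by (simp add: abs_mult)
        then show ?thesis by (simp only: powr_mult)
      qed
      also have "\<dots> \<le> (1 / K) powr 1 * \<bar>f x / \<eta>\<bar> powr q x"
        using K q[OF True] by (intro mult_right_mono powr_mono') auto
      finally have "\<bar>f x / (K * \<eta>)\<bar> powr q x \<le> (1 / K) * \<bar>f x / \<eta>\<bar> powr q x" using K by simp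
      then have "ennreal (\<bar>f x / (K * \<eta>)\<bar> powr q x) \<le> ennreal (1 / K) * ennreal (\<bar>f x / \<eta>\<bar> powr q x)"
        using K by (simp add: ennreal_mult'[symmetric] ennreal_leI)
      also have "\<dots> \<le> ennreal (1 / K) * g x" using * True by (intro mult_left_mono) auto
      finally show ?thesis using True by simp
    qed simp
  qed
  also have "\<dots> = ennreal (1 / K) * (\<integral>\<^sup>+x\<in>E. g x \<partial>lebesgue)"
    by (intro nn_integral_cmult) measurable
  also have "\<dots> \<le> ennreal (1 / K) * ennreal K" by (intro mult_left_mono int) simp
  also have "\<dots> = 1" using K by (simp add: ennreal_mult[symmetric])
  finally show ?thesis unfolding luxemburg_norm_def
    using \<eta> K by (intro Inf_lower) (auto intro!: exI[of _ "K * \<eta>"])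
qed

section \<open>Measurability of the operators and comparison with the potential\<close>

lemma borel_version:
  fixes F :: "'a::euclidean_space \<Rightarrow> real"
  assumes "F \<in> borel_measurable lebesgue"
  obtains F' where "F' \<in> borel_measurable borel" "AE x in lebesgue. F x = F' x"
proof -
  obtain F' where F': "F' \<in> borel_measurable lborel" "AE x in lborel. F x = F' x"
    using completion_ex_borel_measurable_real[OF assms] by blast
  then show thesis by (intro that[of F']) (auto intro: AE_completion)
qed

text \<open>
  The theorem on parametrised integrals requires measurability on a product of Borel measures, hence
  the passage to a Borel function equal to \<open>F\<close> almost everywhere.
\<close>

lemma kernel_nn_integral_measurable:
  fixes F :: "'a::euclidean_space \<Rightarrow> real"
  assumes F: "F \<in> borel_measurable lebesgue"
    and k: "(\<lambda>(x, y). k x y) \<in> borel_measurable (borel \<Otimes>\<^sub>M borel)"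
  shows "(\<lambda>x::'a. \<integral>\<^sup>+y. k x y * ennreal (F y) \<partial>lebesgue) \<in> borel_measurable borel"
proof -
  obtain F' where F' [measurable]: "F' \<in> borel_measurable borel" and ae: "AE x in lebesgue. F x = F' x"
    using borel_version[OF F] .
  have "(\<lambda>(x, y). k x y) \<in> borel_measurable (borel \<Otimes>\<^sub>M lborel)"
    using k by (simp cong: measurable_cong_sets)
  then have [measurable]: "(\<lambda>z. k (fst z) (snd z)) \<in> borel_measurable (borel \<Otimes>\<^sub>M lborel)"
    by (simp add: case_prod_beta')
  have "(\<integral>\<^sup>+y. k x y * ennreal (F y) \<partial>lebesgue) = (\<integral>\<^sup>+y. k x y * ennreal (F' y) \<partial>lborel)" for x
  proof -
    have "(\<integral>\<^sup>+y. k x y * ennreal (F y) \<partial>lebesgue) = (\<integral>\<^sup>+y. k x y * ennreal (F' y) \<partial>lebesgue)"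
      by (rule nn_integral_cong_AE) (use ae in \<open>eventually_elim, simp\<close>)
    then show ?thesis by (simp add: nn_integral_completion)
  qed
  moreover have "(\<lambda>x. \<integral>\<^sup>+y. k x y * ennreal (F' y) \<partial>lborel) \<in> borel_measurable borel"
  proof (rule lborel.borel_measurable_nn_integral)
    have "(\<lambda>z. k (fst z) (snd z) * ennreal (F' (snd z))) \<in> borel_measurable (borel \<Otimes>\<^sub>M lborel)"
      by measurable
    then show "(\<lambda>(x, y). k x y * ennreal (F' y)) \<in> borel_measurable (borel \<Otimes>\<^sub>M lborel)"
      by (simp add: case_prod_beta')
  qed
  ultimately show ?thesis by simp
qed

lemma riesz_potential_measurable:
  fixes f :: "'a::euclidean_space \<Rightarrow> real"
  assumes \<Omega>: "open \<Omega>" and f: "f \<in> borel_measurable (lebesgue_on \<Omega>)" and \<alpha>: "continuous_on \<Omega> \<alpha>"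
  shows "riesz_potential \<Omega> \<alpha> f \<in> borel_measurable (lebesgue_on \<Omega>)"
proof -
  have Om: "\<Omega> \<in> sets lebesgue" "\<Omega> \<in> sets borel" using \<Omega> by (auto intro: borel_open)
  have "(\<lambda>x. indicator \<Omega> x * f x) \<in> borel_measurable lebesgue"
    using f Om by (subst (asm) borel_measurable_restrict_space_iff) auto
  then obtain F' where F' [measurable]: "F' \<in> borel_measurable borel"
    and ae: "AE x in lebesgue. indicator \<Omega> x * f x = F' x"
    using borel_version by blast
  define b where "b x = indicator \<Omega> x *\<^sub>R \<alpha> x" for x
  have [measurable]: "b \<in> borel_measurable borel"
    unfolding b_def by (rule borel_measurable_continuous_on_indicator[OF Om(2) \<alpha>])
  define g where "g x = (\<integral>y. F' y / norm (x - y) powr (real DIM('a) - b x) \<partial>lborel)" for x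
  have gm: "g \<in> borel_measurable borel"
    unfolding g_def by (rule lborel.borel_measurable_lebesgue_integral) measurable
  have "riesz_potential \<Omega> \<alpha> f x = g x" if x: "x \<in> \<Omega>" for x
  proof -
    have "riesz_potential \<Omega> \<alpha> f x = (\<integral>y. indicator \<Omega> y * f y / norm (x - y) powr (real DIM('a) - b x) \<partial>lebesgue)"
      unfolding riesz_potential_def riesz_kernel_term_def set_lebesgue_integral_def
      using x by (simp add: b_def)
    also have "\<dots> = (\<integral>y. F' y / norm (x - y) powr (real DIM('a) - b x) \<partial>lebesgue)"
    proof (rule integral_cong_AE)
      have 1: "(\<lambda>y. norm (x - y) powr (real DIM('a) - b x)) \<in> borel_measurable lebesgue"
        by (rule measurable_completion) measurable
      have 2: "F' \<in> borel_measurable lebesgue" by (rule measurable_completion) measurable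
      show "(\<lambda>y. indicator \<Omega> y * f y / norm (x - y) powr (real DIM('a) - b x)) \<in> borel_measurable lebesgue"
        using 1 \<open>(\<lambda>x. indicator \<Omega> x * f x) \<in> borel_measurable lebesgue\<close> by (rule borel_measurable_divide[rotated])
      show "(\<lambda>y. F' y / norm (x - y) powr (real DIM('a) - b x)) \<in> borel_measurable lebesgue"
        using 1 2 by (rule borel_measurable_divide[rotated])
      show "AE y in lebesgue. indicator \<Omega> y * f y / norm (x - y) powr (real DIM('a) - b x) = F' y / norm (x - y) powr (real DIM('a) - b x)"
        using ae by eventually_elim simp
    qed
    also have "\<dots> = g x" unfolding g_def by (rule integral_completion) measurable
    finally show ?thesis .
  qed
  moreover have "g \<in> borel_measurable (lebesgue_on \<Omega>)"
    by (rule measurable_restrict_space1, rule measurable_completion) (use gm in simp)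
  ultimately show ?thesis by (subst measurable_cong[of _ _ g]) auto
qed

text \<open>
  Needed for measurability: the supremum becomes countable.  For rational radii below \<open>r\<close> that tend
  to \<open>r\<close>, the lemma of Fatou bounds the integral over the open ball of radius \<open>r\<close> by the lower limit
  of the integrals over the smaller balls, whose denominators are not larger.
\<close>

lemma frac_maximal_eq_rational:
  fixes f :: "'a::euclidean_space \<Rightarrow> real"
  assumes f: "f \<in> borel_measurable (lebesgue_on \<Omega>)" and Om: "\<Omega> \<in> sets lebesgue" and \<alpha>: "\<alpha> x \<le> real DIM('a)"
  shows "frac_maximal \<Omega> \<alpha> f x = (SUP r\<in>{0<..} \<inter> \<rat>. (\<integral>\<^sup>+y\<in>rel_ball \<Omega> x r. ennreal \<bar>f y\<bar> \<partial>lebesgue) /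
        ennreal (measure lebesgue (ball x r) powr (1 - \<alpha> x / real DIM('a))))"
    (is "_ = ?S")
proof (rule antisym)
  define c where "c r = ennreal (measure lebesgue (ball x r) powr (1 - \<alpha> x / real DIM('a)))" for r
  define G where "G r = (\<integral>\<^sup>+y\<in>rel_ball \<Omega> x r. ennreal \<bar>f y\<bar> \<partial>lebesgue)" for r
  have e: "0 \<le> 1 - \<alpha> x / real DIM('a)" using \<alpha> by (simp add: divide_le_eq)
  have cpos: "0 < c r" if "0 < r" for r
    using content_ball_pos[OF that, of x] by (simp add: c_def)
  have cfin: "c r < \<infinity>" for r by (simp add: c_def)
  have cmono: "c r \<le> c r'" if "0 < r" "r \<le> r'" for r r'
    unfolding c_def using that e
    by (intro ennreal_leI powr_mono2 measure_mono_fmeasurable) (auto simp: fmeasurableD)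
  have S: "?S = (SUP r\<in>{0<..} \<inter> \<rat>. G r / c r)" by (simp add: G_def c_def)
  have fm: "(\<lambda>y. indicator \<Omega> y * f y) \<in> borel_measurable lebesgue"
    using f Om by (subst (asm) borel_measurable_restrict_space_iff) auto
  have "G r / c r \<le> ?S" if r: "0 < r" for r
  proof -
    have "\<exists>x\<in>\<rat>. max 0 (r - 1 / real (Suc k)) < x \<and> x < r" for k
      using r by (intro Rats_dense_in_real) auto
    \<comment> \<open>Rational radii below \<open>r\<close> that converge to \<open>r\<close>.\<close>
    then obtain \<rho> where \<rho>: "\<And>k. \<rho> k \<in> \<rat>" "\<And>k. 0 < \<rho> k" "\<And>k. r - 1 / real (Suc k) < \<rho> k" "\<And>k. \<rho> k < r"
      by (metis max_less_iff_conj)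
    define H where "H r y = ennreal \<bar>indicator \<Omega> y * f y\<bar> * indicator (ball x r) y" for r y
    have GH: "G r = (\<integral>\<^sup>+y. H r y \<partial>lebesgue)" for r
      unfolding G_def H_def by (intro nn_integral_cong) (auto simp: indicator_def)
    have Hm: "H r \<in> borel_measurable lebesgue" for r unfolding H_def using fm by measurable
    have lim: "H r y \<le> liminf (\<lambda>k. H (\<rho> k) y)" for y
    proof (cases "y \<in> ball x r")
      case True
      then have "0 < r - dist x y" by simp
      then obtain N where N: "1 / real (Suc N) < r - dist x y"
        using reals_Archimedean[of "r - dist x y"] by (auto simp: inverse_eq_divide)
      have "eventually (\<lambda>k. H r y \<le> H (\<rho> k) y) sequentially"
        using eventually_ge_at_top[of N]
      proof eventually_elim
        case (elim k)
        have "1 / real (Suc k) \<le> 1 / real (Suc N)" using elim by (intro divide_left_mono) auto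
        then have "y \<in> ball x (\<rho> k)" using N \<rho>(3)[of k] by simp
        then show ?case using True by (simp add: H_def)
      qed
      then show ?thesis by (rule Liminf_bounded)
    qed (simp add: H_def)
    have "G r \<le> (\<integral>\<^sup>+y. liminf (\<lambda>k. H (\<rho> k) y) \<partial>lebesgue)"
      unfolding GH by (intro nn_integral_mono lim)
    also have "\<dots> \<le> liminf (\<lambda>k. \<integral>\<^sup>+y. H (\<rho> k) y \<partial>lebesgue)"
      by (intro nn_integral_liminf Hm)
    also have "\<dots> \<le> ?S * c r"
    proof (rule Liminf_le)
      show "\<forall>\<^sub>F k in sequentially. (\<integral>\<^sup>+y. H (\<rho> k) y \<partial>lebesgue) \<le> ?S * c r"
      proof (intro always_eventually allI)
        fix k
        have "G (\<rho> k) / c (\<rho> k) \<le> ?S" unfolding S using \<rho> by (intro SUP_upper) auto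
        then have "G (\<rho> k) / c (\<rho> k) * c (\<rho> k) \<le> ?S * c r"
          using \<rho>(2,4)[of k] cmono[of "\<rho> k" r] by (intro mult_mono) auto
        moreover have "G (\<rho> k) / c (\<rho> k) * c (\<rho> k) = G (\<rho> k)"
          using cpos[OF \<rho>(2)[of k]] cfin[of "\<rho> k"] by (simp add: ennreal_divide_times)
        ultimately show "(\<integral>\<^sup>+y. H (\<rho> k) y \<partial>lebesgue) \<le> ?S * c r" by (simp add: GH)
      qed
    qed simp
    finally have "G r \<le> ?S * c r" .
    then show ?thesis using cpos[OF r] by (intro divide_le_posI_ennreal) (auto simp: mult.commute)
  qed
  then show "frac_maximal \<Omega> \<alpha> f x \<le> ?S"
    unfolding frac_maximal_def by (intro SUP_least) (auto simp: G_def c_def)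
  show "?S \<le> frac_maximal \<Omega> \<alpha> f x"
    unfolding frac_maximal_def by (intro SUP_subset_mono) auto
qed

lemma frac_maximal_measurable:
  fixes f :: "'a::euclidean_space \<Rightarrow> real"
  assumes \<Omega>: "open \<Omega>" and f: "f \<in> borel_measurable (lebesgue_on \<Omega>)" and \<alpha>: "continuous_on \<Omega> \<alpha>"
    and \<alpha>n: "\<And>x. x \<in> \<Omega> \<Longrightarrow> \<alpha> x \<le> real DIM('a)"
  shows "frac_maximal \<Omega> \<alpha> f \<in> borel_measurable (lebesgue_on \<Omega>)"
proof -
  have Om: "\<Omega> \<in> sets lebesgue" "\<Omega> \<in> sets borel" using \<Omega> by (auto intro: borel_open)
  have fm: "(\<lambda>x. indicator \<Omega> x * f x) \<in> borel_measurable lebesgue"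
    using f Om by (subst (asm) borel_measurable_restrict_space_iff) auto
  define b where "b x = indicator \<Omega> x *\<^sub>R \<alpha> x" for x
  have bm [measurable]: "b \<in> borel_measurable borel"
    unfolding b_def by (rule borel_measurable_continuous_on_indicator[OF Om(2) \<alpha>])
  define G where "G r x = (\<integral>\<^sup>+y. indicator (ball x r) y * ennreal \<bar>indicator \<Omega> y * f y\<bar> \<partial>lebesgue)" for r x
  have Gm [measurable]: "G r \<in> borel_measurable borel" for r
    unfolding G_def
  proof (rule kernel_nn_integral_measurable)
    show "(\<lambda>y. \<bar>indicator \<Omega> y * f y\<bar>) \<in> borel_measurable lebesgue" using fm by measurable
    have "open {z :: 'a \<times> 'a. dist (fst z) (snd z) < r}"
      by (intro open_Collect_less continuous_intros)
    then have "{z :: 'a \<times> 'a. dist (fst z) (snd z) < r} \<in> sets (borel \<Otimes>\<^sub>M borel)"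
      by (subst borel_prod) (rule borel_open)
    then have "indicator {z :: 'a \<times> 'a. dist (fst z) (snd z) < r} \<in> borel_measurable (borel \<Otimes>\<^sub>M borel)"
      by simp
    moreover have "(\<lambda>(x, y). indicator (ball x r) y) =
      (indicator {z :: 'a \<times> 'a. dist (fst z) (snd z) < r} :: _ \<Rightarrow> ennreal)"
      by (auto simp: fun_eq_iff indicator_def)
    ultimately show "(\<lambda>(x, y). indicator (ball x r) y :: ennreal) \<in> borel_measurable (borel \<Otimes>\<^sub>M (borel :: 'a measure))"
      by simp
  qed
  define g where "g x = (SUP r\<in>{0<..} \<inter> \<rat>. G r x /
    ennreal ((unit_ball_vol (real DIM('a)) * r powr real DIM('a)) powr (1 - b x / real DIM('a))))" for x
  have gm: "g \<in> borel_measurable borel"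
    unfolding g_def by (intro borel_measurable_SUP) (auto intro: countable_Int2 countable_rat)
  have "frac_maximal \<Omega> \<alpha> f x = g x" if x: "x \<in> \<Omega>" for x
  proof -
    have "measure lebesgue (ball x r) = unit_ball_vol (real DIM('a)) * r powr real DIM('a)" if "0 < r" for r
      using emeasure_lebesgue_ball[OF that, of x] by (simp add: measure_def)
    moreover have "(\<integral>\<^sup>+y\<in>rel_ball \<Omega> x r. ennreal \<bar>f y\<bar> \<partial>lebesgue) = G r x" for r
      unfolding G_def by (intro nn_integral_cong) (auto simp: indicator_def)
    ultimately show ?thesis
      unfolding frac_maximal_eq_rational[where \<alpha> = \<alpha> and x = x, OF f Om(1) \<alpha>n[OF x]] g_def
      using x by (intro SUP_cong) (auto simp: b_def)
  qed
  moreover have "g \<in> borel_measurable (lebesgue_on \<Omega>)"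
    by (rule measurable_restrict_space1, rule measurable_completion) (use gm in simp)
  ultimately show ?thesis by (subst measurable_cong[of _ _ g]) auto
qed

text \<open>
  On \<open>B(x,r)\<close> the kernel is at least \<open>r^(\<alpha>(x) - n)\<close>, which is the denominator up to a power of the
  volume \<open>V\<close> of the unit ball with exponent between 0 and 1, whence the factor \<open>1 + 1/V\<close>.  The
  centre has to be excluded: the quotient is 0 there by the convention on division by 0.
\<close>

lemma frac_maximal_le_potential:
  fixes f :: "'a::euclidean_space \<Rightarrow> real"
  assumes f: "f \<in> borel_measurable (lebesgue_on \<Omega>)" and Om: "\<Omega> \<in> sets lebesgue"
    and \<alpha>: "0 \<le> \<alpha> x" "\<alpha> x \<le> real DIM('a)"
  shows "frac_maximal \<Omega> \<alpha> f x \<le> ennreal (1 + 1 / unit_ball_vol (real DIM('a))) * pos_potential \<alpha> (\<lambda>y. indicator \<Omega> y * \<bar>f y\<bar>) x"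
  unfolding frac_maximal_def
proof (rule SUP_least)
  fix r :: real assume "r \<in> {0<..}"
  then have r: "0 < r" by simp
  define F where "F y = indicator \<Omega> y * \<bar>f y\<bar>" for y
  have "(\<lambda>y. indicator \<Omega> y * f y) \<in> borel_measurable lebesgue"
    using f Om by (subst (asm) borel_measurable_restrict_space_iff) auto
  then have "(\<lambda>y. \<bar>indicator \<Omega> y * f y\<bar>) \<in> borel_measurable lebesgue" by measurable
  then have Fm: "F \<in> borel_measurable lebesgue" by (simp add: F_def[abs_def] abs_mult)
  have F0: "0 \<le> F y" for y by (simp add: F_def)
  define v where "v = unit_ball_vol (real DIM('a))"
  have v: "0 < v" by (simp add: v_def)
  define e where "e = 1 - \<alpha> x / real DIM('a)"
  have e: "0 \<le> e" "e \<le> 1" using \<alpha> by (auto simp: e_def divide_le_eq)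
  have ne: "real DIM('a) * e = real DIM('a) - \<alpha> x" by (simp add: e_def right_diff_distrib)
  define c where "c = measure lebesgue (ball x r) powr (1 - \<alpha> x / real DIM('a))"
  have "measure lebesgue (ball x r) = v * r powr real DIM('a)"
    using emeasure_lebesgue_ball[OF r, of x] v by (simp add: measure_def v_def)
  then have c: "c = v powr e * r powr (real DIM('a) - \<alpha> x)"
    using v r by (simp add: c_def e_def[symmetric] powr_mult powr_powr ne)
  then have cpos: "0 < c" using v r by simp
  have "1 \<le> v powr e * (1 + 1 / v)"
  proof (cases "1 \<le> v")
    case True
    then have "1 * 1 \<le> v powr e * (1 + 1 / v)" using e v by (intro mult_mono ge_one_powr_ge_zero) auto
    then show ?thesis by simp
  next
    case False
    then have "v powr 1 \<le> v powr e" using v e by (intro powr_mono') auto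
    then have "v * (1 + 1 / v) \<le> v powr e * (1 + 1 / v)" using v by (intro mult_right_mono) auto
    moreover have "v * (1 + 1 / v) = v + 1" using v by (simp add: field_simps)
    ultimately show ?thesis using v by linarith
  qed
  then have "1 * r powr (real DIM('a) - \<alpha> x) \<le> (v powr e * (1 + 1 / v)) * r powr (real DIM('a) - \<alpha> x)"
    by (intro mult_right_mono) auto
  then have rc: "r powr (real DIM('a) - \<alpha> x) \<le> c * (1 + 1 / v)" by (simp add: c mult_ac)
  have "AE y in lebesgue. y \<noteq> x" by (rule AE_completion[OF AE_lborel_singleton])
  have "(\<integral>\<^sup>+y\<in>rel_ball \<Omega> x r. ennreal \<bar>f y\<bar> \<partial>lebesgue) \<le> pos_potential \<alpha> (\<lambda>y. (c * (1 + 1 / v)) * F y) x"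
    unfolding pos_potential_def
  proof (rule nn_integral_mono_AE, use \<open>AE y in lebesgue. y \<noteq> x\<close> in eventually_elim)
    fix y assume "y \<noteq> x"
    show "ennreal \<bar>f y\<bar> * indicator (rel_ball \<Omega> x r) y \<le> ennreal (c * (1 + 1 / v) * F y / norm (x - y) powr (real DIM('a) - \<alpha> x))"
    proof (cases "y \<in> rel_ball \<Omega> x r")
      case True
      then have d: "0 < norm (x - y)" "norm (x - y) \<le> r" using \<open>y \<noteq> x\<close> by (auto simp: dist_norm)
      have "norm (x - y) powr (real DIM('a) - \<alpha> x) \<le> r powr (real DIM('a) - \<alpha> x)" using d \<alpha> by (intro powr_mono2) auto
      also note rc
      finally have "1 \<le> c * (1 + 1 / v) / norm (x - y) powr (real DIM('a) - \<alpha> x)" using d by simp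
      then have "1 * F y \<le> c * (1 + 1 / v) / norm (x - y) powr (real DIM('a) - \<alpha> x) * F y"
        by (intro mult_right_mono F0)
      then have "\<bar>f y\<bar> \<le> c * (1 + 1 / v) * F y / norm (x - y) powr (real DIM('a) - \<alpha> x)"
        using True by (simp add: F_def)
      then show ?thesis using True by (simp add: ennreal_leI)
    qed simp
  qed
  also have "\<dots> = ennreal (c * (1 + 1 / v)) * pos_potential \<alpha> F x"
    using cpos v by (intro pos_potential_cmult Fm) auto
  also have "\<dots> = ennreal c * (ennreal (1 + 1 / v) * pos_potential \<alpha> F x)"
    using cpos v by (simp add: ennreal_mult' mult.assoc)
  finally have "(\<integral>\<^sup>+y\<in>rel_ball \<Omega> x r. ennreal \<bar>f y\<bar> \<partial>lebesgue) \<le> ennreal c * (ennreal (1 + 1 / v) * pos_potential \<alpha> F x)" .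
  then have "(\<integral>\<^sup>+y\<in>rel_ball \<Omega> x r. ennreal \<bar>f y\<bar> \<partial>lebesgue) / ennreal c \<le> ennreal (1 + 1 / v) * pos_potential \<alpha> F x"
    using cpos by (intro divide_le_posI_ennreal) auto
  then show "(\<integral>\<^sup>+y\<in>rel_ball \<Omega> x r. ennreal \<bar>f y\<bar> \<partial>lebesgue) /
      ennreal (measure lebesgue (ball x r) powr (1 - \<alpha> x / real DIM('a)))
    \<le> ennreal (1 + 1 / unit_ball_vol (real DIM('a))) * pos_potential \<alpha> (\<lambda>y. indicator \<Omega> y * \<bar>f y\<bar>) x"
    by (simp only: c_def v_def F_def[abs_def])
qed

lemma riesz_potential_le:
  fixes f :: "'a::euclidean_space \<Rightarrow> real"
  assumes f: "f \<in> borel_measurable (lebesgue_on \<Omega>)" and Om: "\<Omega> \<in> sets lebesgue"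
    and fin: "pos_potential \<alpha> (\<lambda>y. indicator \<Omega> y * \<bar>f y\<bar>) x < \<infinity>"
  shows "set_integrable lebesgue \<Omega> (riesz_kernel_term \<alpha> f x)"
    and "ennreal \<bar>riesz_potential \<Omega> \<alpha> f x\<bar> \<le> pos_potential \<alpha> (\<lambda>y. indicator \<Omega> y * \<bar>f y\<bar>) x"
proof -
  have fm: "(\<lambda>y. indicator \<Omega> y * f y) \<in> borel_measurable lebesgue"
    using f Om by (subst (asm) borel_measurable_restrict_space_iff) auto
  define k where "k y = indicator \<Omega> y *\<^sub>R riesz_kernel_term \<alpha> f x y" for y
  have "(\<lambda>y. norm (x - y) powr (real DIM('a) - \<alpha> x)) \<in> borel_measurable lebesgue"
    by (rule measurable_completion) measurable
  with fm have "(\<lambda>y. (indicator \<Omega> y * f y) / norm (x - y) powr (real DIM('a) - \<alpha> x)) \<in> borel_measurable lebesgue"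
    by (rule borel_measurable_divide)
  then have km: "k \<in> borel_measurable lebesgue"
    by (simp add: k_def[abs_def] riesz_kernel_term_def)
  have kn: "(\<integral>\<^sup>+y. ennreal (norm (k y)) \<partial>lebesgue) = pos_potential \<alpha> (\<lambda>y. indicator \<Omega> y * \<bar>f y\<bar>) x"
    unfolding pos_potential_def k_def riesz_kernel_term_def
    by (intro nn_integral_cong) (simp add: abs_mult)
  have int: "integrable lebesgue k"
    using km kn fin by (intro integrableI_bounded) auto
  then show "set_integrable lebesgue \<Omega> (riesz_kernel_term \<alpha> f x)"
    by (simp add: set_integrable_def k_def[abs_def])
  show "ennreal \<bar>riesz_potential \<Omega> \<alpha> f x\<bar> \<le> pos_potential \<alpha> (\<lambda>y. indicator \<Omega> y * \<bar>f y\<bar>) x"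
    using integral_norm_bound_ennreal[OF int] unfolding kn
    by (simp add: riesz_potential_def set_lebesgue_integral_def k_def[abs_def])
qed

section \<open>The norm estimate\<close>

locale morrey_setting = log_hoelder_setting \<Omega> p \<alpha> q s P D A \<kappa> a0
  for \<Omega> :: "'a::euclidean_space set" and p \<alpha> q s P D A \<kappa> a0 +
  fixes x0 :: 'a and \<omega>1 \<omega>2 :: "real \<Rightarrow> real" and C :: real
  assumes Omega_open: "open \<Omega>" and x0: "x0 \<in> \<Omega>"
    and diameter_pos: "0 < diameter \<Omega>" and diameter_le: "diameter \<Omega> \<le> D"
    and weight1: "morrey_weight \<Omega> x0 p \<omega>1" and weight2: "morrey_weight \<Omega> x0 q \<omega>2"
    and C: "0 < C"
    and hardy: "\<And>t. 0 < t \<Longrightarrow> t < diameter \<Omega> \<Longrightarrow>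
       ennreal (t powr \<alpha> x0) * (\<integral>\<^sup>+r\<in>{0<..<t}. ennreal (\<omega>1 r / r) \<partial>lebesgue) \<le> ennreal (C * \<omega>2 t)"
begin

text \<open>
  If \<open>\<omega>\<close> vanished at \<open>r\<close>, the quotient in the norm would be infinite there.
\<close>

lemma morrey_weight_pos:
  assumes "morrey_weight \<Omega> x0 u \<omega>" "0 < r" "r < diameter \<Omega>"
  shows "0 < \<omega> r"
proof (rule ccontr)
  assume "\<not> 0 < \<omega> r"
  then have "ennreal (\<omega> r) = 0" by (simp add: ennreal_neg)
  then have "morrey_factor x0 u \<omega> r = \<infinity>" using assms(2) by (simp add: morrey_factor_def)
  moreover have "morrey_factor x0 u \<omega> r \<le> (SUP r\<in>{0<..<diameter \<Omega>}. morrey_factor x0 u \<omega> r)"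
    using assms by (intro SUP_upper) auto
  moreover have "(SUP r\<in>{0<..<diameter \<Omega>}. morrey_factor x0 u \<omega> r) < \<infinity>"
    using assms(1) unfolding morrey_weight_def by blast
  ultimately show False by (metis leD)
qed

lemma conj_exponent_eq:
  assumes "1 < u x0" shows "real DIM('a) / conj_exponent u x0 = real DIM('a) - real DIM('a) / u x0"
  using assms by (simp add: conj_exponent_def field_simps)

definition modulus :: "('a \<Rightarrow> real) \<Rightarrow> 'a \<Rightarrow> real" where
  "modulus f y = indicator \<Omega> y * \<bar>f y\<bar>"

lemma modulus_measurable:
  assumes f: "f \<in> borel_measurable (lebesgue_on \<Omega>)"
  shows "modulus f \<in> borel_measurable lebesgue"
proof -
  have "(\<lambda>y. indicator \<Omega> y * f y) \<in> borel_measurable lebesgue"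
    using f Omega fmeasurableD by (subst (asm) borel_measurable_restrict_space_iff) auto
  then have "(\<lambda>y. \<bar>indicator \<Omega> y * f y\<bar>) \<in> borel_measurable lebesgue" by measurable
  then show ?thesis by (simp add: modulus_def[abs_def] abs_mult)
qed

text \<open>
  The strict inequality lets \<open>M\<close> be inserted into the modular; the infimum in the Luxemburg norm need
  not be attained otherwise.
\<close>

lemma modular_of_morrey_norm:
  assumes M: "comp_morrey_norm \<Omega> x0 p \<omega>1 f < ennreal M" and r: "0 < r" "r < diameter \<Omega>"
  shows "(\<integral>\<^sup>+y\<in>\<Omega> - ball x0 r.
     ennreal ((modulus f y / (M * \<omega>1 r * r powr - (real DIM('a) - real DIM('a) / p x0))) powr p y) \<partial>lebesgue) \<le> 1"
proof -
  define a where "a = real DIM('a) - real DIM('a) / p x0"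
  have \<omega>: "0 < \<omega>1 r" using weight1 r by (rule morrey_weight_pos)
  have M0: "0 < M" using M by (cases "0 < M") (auto simp: ennreal_neg)
  define \<eta> where "\<eta> = M * \<omega>1 r * r powr - a"
  have \<eta>: "0 < \<eta>" using M0 \<omega> r by (simp add: \<eta>_def)
  have factor: "morrey_factor x0 p \<omega>1 r = ennreal (r powr a / \<omega>1 r)"
    using \<omega> p_gt_1[OF x0] by (simp add: morrey_factor_def conj_exponent_eq divide_ennreal a_def)
  have "luxemburg_norm p (\<Omega> - rel_ball \<Omega> x0 r) f < ennreal \<eta>"
  proof (rule ccontr)
    assume "\<not> ?thesis"
    then have "ennreal \<eta> \<le> luxemburg_norm p (\<Omega> - rel_ball \<Omega> x0 r) f" by simp
    then have "ennreal (r powr a / \<omega>1 r) * ennreal \<eta> \<le>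
        morrey_factor x0 p \<omega>1 r * luxemburg_norm p (\<Omega> - rel_ball \<Omega> x0 r) f"
      unfolding factor by (rule mult_left_mono) simp
    also have "\<dots> \<le> comp_morrey_norm \<Omega> x0 p \<omega>1 f"
      unfolding comp_morrey_norm_def using r by (intro SUP_upper) auto
    also note M
    also have "ennreal (r powr a / \<omega>1 r) * ennreal \<eta> = ennreal M"
    proof -
      have "r powr a / \<omega>1 r * \<eta> = M * (r powr a * r powr - a)" using \<omega> by (simp add: \<eta>_def)
      also have "r powr a * r powr - a = 1" using r by (simp add: powr_add[symmetric])
      finally show ?thesis using \<omega> by (simp add: ennreal_mult'[symmetric])
    qed
    finally show False by simp
  qed
  then have "(\<integral>\<^sup>+x\<in>\<Omega> - rel_ball \<Omega> x0 r. ennreal (\<bar>f x / \<eta>\<bar> powr p x) \<partial>lebesgue) \<le> 1"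
    by (rule modular_le_1_of_norm_less) (use p_gt_1 less_imp_le less_trans zero_less_one in blast)
  moreover have "(\<integral>\<^sup>+x\<in>\<Omega> - rel_ball \<Omega> x0 r. ennreal (\<bar>f x / \<eta>\<bar> powr p x) \<partial>lebesgue) =
     (\<integral>\<^sup>+y\<in>\<Omega> - ball x0 r. ennreal ((modulus f y / \<eta>) powr p y) \<partial>lebesgue)"
    using \<eta> by (intro nn_integral_cong) (auto simp: indicator_def modulus_def abs_divide)
  ultimately show ?thesis by (simp add: \<eta>_def a_def)
qed

text \<open>
  The condition on the weights bounds the integral of \<open>\<omega>1(r)/r\<close> over \<open>(0,t)\<close> by
  \<open>C \<omega>2(t) t^(- \<alpha>(x0))\<close>, and \<open>\<alpha>(x0) + n/p'(x0) = n/q'(x0)\<close>.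
\<close>

lemma potential_estimate:
  assumes f: "f \<in> borel_measurable (lebesgue_on \<Omega>)" and M: "comp_morrey_norm \<Omega> x0 p \<omega>1 f < ennreal M"
    and t: "0 < t" "t < diameter \<Omega>"
  shows "dominated (modulus f) (\<Omega> - ball x0 t) (M * C * \<omega>2 t * t powr - (real DIM('a) - real DIM('a) / q x0))
    (potential_const x0)"
proof -
  have \<omega>2: "0 < \<omega>2 t" using weight2 t by (rule morrey_weight_pos)
  have M0: "0 < M" using M by (cases "0 < M") (auto simp: ennreal_neg)
  define J where "J = C * \<omega>2 t * t powr - \<alpha> x0"
  have J: "0 < J" using C \<omega>2 t by (simp add: J_def)
  have int: "(\<integral>\<^sup>+r\<in>{0<..<t}. ennreal (\<omega>1 r / r) \<partial>lebesgue) \<le> ennreal J"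
  proof -
    define I where "I = (\<integral>\<^sup>+r\<in>{0<..<t}. ennreal (\<omega>1 r / r) \<partial>lebesgue)"
    have one: "t powr - \<alpha> x0 * t powr \<alpha> x0 = 1" using t by (simp add: powr_add[symmetric])
    have "I = ennreal (t powr - \<alpha> x0) * (ennreal (t powr \<alpha> x0) * I)"
      by (simp add: mult.assoc[symmetric] ennreal_mult'[symmetric] one)
    also have "\<dots> \<le> ennreal (t powr - \<alpha> x0) * ennreal (C * \<omega>2 t)"
      unfolding I_def using hardy[OF t] by (intro mult_left_mono) auto
    also have "\<dots> = ennreal (t powr - \<alpha> x0 * (C * \<omega>2 t))" by (rule ennreal_mult'[symmetric]) simp
    also have "t powr - \<alpha> x0 * (C * \<omega>2 t) = J" by (simp add: J_def)
    finally show ?thesis by (simp add: I_def)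
  qed
  have \<omega>m: "(\<lambda>r. \<omega>1 r * indicator {0<..<t} r) \<in> borel_measurable lebesgue"
  proof -
    have "(\<lambda>r. indicator {0<..<diameter \<Omega>} r *\<^sub>R \<omega>1 r) \<in> borel_measurable lebesgue"
      using weight1 unfolding morrey_weight_def
      by (subst (asm) borel_measurable_restrict_space_iff) auto
    then have "(\<lambda>r. indicator {0<..<t} r * (indicator {0<..<diameter \<Omega>} r *\<^sub>R \<omega>1 r)) \<in> borel_measurable lebesgue"
      by (intro borel_measurable_times borel_measurable_indicator) auto
    moreover have "(\<lambda>r. indicator {0<..<t} r * (indicator {0<..<diameter \<Omega>} r *\<^sub>R \<omega>1 r)) = (\<lambda>r. \<omega>1 r * indicator {0<..<t} r)"
      using t by (auto simp: fun_eq_iff indicator_def)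
    ultimately show ?thesis by simp
  qed
  have e: "- \<alpha> x0 + - (real DIM('a) - real DIM('a) / p x0) = - (real DIM('a) - real DIM('a) / q x0)"
  proof -
    have "real DIM('a) * (1 / q x0) = real DIM('a) * (1 / p x0 - \<alpha> x0 / real DIM('a))" using q_eq[OF x0] by simp
    then show ?thesis by (simp add: right_diff_distrib)
  qed
  have Lam: "M * J * t powr - (real DIM('a) - real DIM('a) / p x0) = M * C * \<omega>2 t * t powr - (real DIM('a) - real DIM('a) / q x0)"
    unfolding e[symmetric] J_def by (subst powr_add) simp
  show ?thesis
    unfolding Lam[symmetric]
  proof (rule potential_modular[where \<omega> = \<omega>1])
    show "modulus f \<in> borel_measurable lebesgue" using f by (rule modulus_measurable)
    show "0 \<le> modulus f y" for y by (simp add: modulus_def)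
    show "modulus f y = 0" if "y \<notin> \<Omega>" for y using that by (simp add: modulus_def)
    show "0 < \<omega>1 r" if "0 < r" "r < t" for r using that t by (intro morrey_weight_pos[OF weight1]) linarith+
    show "(\<integral>\<^sup>+y\<in>\<Omega> - ball x0 r.
       ennreal ((modulus f y / (M * \<omega>1 r * r powr - (real DIM('a) - real DIM('a) / p x0))) powr p y) \<partial>lebesgue) \<le> 1"
      if "0 < r" "r < t" for r using that t by (intro modular_of_morrey_norm[OF M]) linarith+
    show "t \<le> D" using t diameter_le by linarith
  qed (fact x0 M0 J int \<omega>m t(1))+
qed

text \<open>
  The estimate outside \<open>B(x0,t)\<close> gives finiteness there, and the sets obtained for a null sequence of
  radii \<open>t\<close> exhaust \<open>\<Omega>\<close> except for \<open>x0\<close>.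
\<close>

lemma AE_potential_finite:
  assumes f: "f \<in> comp_morrey_space \<Omega> x0 p \<omega>1"
  shows "AE x in lebesgue_on \<Omega>. pos_potential \<alpha> (modulus f) x < \<infinity>"
proof -
  have fm: "f \<in> borel_measurable (lebesgue_on \<Omega>)" and fN: "comp_morrey_norm \<Omega> x0 p \<omega>1 f < \<infinity>"
    using f by (auto simp: comp_morrey_space_def)
  obtain M where M: "comp_morrey_norm \<Omega> x0 p \<omega>1 f < ennreal M"
  proof (rule that)
    have "comp_morrey_norm \<Omega> x0 p \<omega>1 f = ennreal (enn2real (comp_morrey_norm \<Omega> x0 p \<omega>1 f))"
      using fN by simp
    also have "\<dots> < ennreal (enn2real (comp_morrey_norm \<Omega> x0 p \<omega>1 f) + 1)"
      by (intro ennreal_lessI) (auto simp: add_nonneg_pos)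
    finally show "comp_morrey_norm \<Omega> x0 p \<omega>1 f < ennreal (enn2real (comp_morrey_norm \<Omega> x0 p \<omega>1 f) + 1)" .
  qed
  have Om: "\<Omega> \<in> sets lebesgue" using Omega by (rule fmeasurableD)
  define l where "l k = diameter \<Omega> / real (k + 2)" for k :: nat
  have l: "0 < l k" "l k < diameter \<Omega>" for k
    using diameter_pos by (auto simp: l_def field_simps intro!: add_pos_nonneg)
  have "AE x in lebesgue. x \<in> \<Omega> - ball x0 (l k) \<longrightarrow> pos_potential \<alpha> (modulus f) x < \<infinity>" for k
  proof -
    obtain g where [measurable]: "g \<in> borel_measurable lebesgue"
      and gint: "(\<integral>\<^sup>+x\<in>\<Omega>. g x \<partial>lebesgue) \<le> ennreal (potential_const x0)"
      and g: "\<And>x. x \<in> \<Omega> - ball x0 (l k) \<Longrightarrow> g x < \<infinity> \<Longrightarrow> \<exists>c\<ge>0.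
           pos_potential \<alpha> (modulus f) x \<le> ennreal (c * (M * C * \<omega>2 (l k) * l k powr - (real DIM('a) - real DIM('a) / q x0)))"
      using potential_estimate[OF fm M l, of k] unfolding dominated_def by blast
    have "AE x in lebesgue. g x * indicator \<Omega> x \<noteq> \<infinity>"
      using gint Om by (intro nn_integral_PInf_AE) (auto simp: top_unique)
    then show ?thesis
    proof eventually_elim
      case (elim x)
      show ?case
      proof
        assume x: "x \<in> \<Omega> - ball x0 (l k)"
        then have "g x < \<infinity>" using elim by (simp add: less_top)
        then obtain c where "pos_potential \<alpha> (modulus f) x \<le> ennreal (c * (M * C * \<omega>2 (l k) * l k powr - (real DIM('a) - real DIM('a) / q x0)))"
          using g[OF x] by blast
        then show "pos_potential \<alpha> (modulus f) x < \<infinity>" by (rule le_less_trans) simp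
      qed
    qed
  qed
  then have "AE x in lebesgue. \<forall>k. x \<in> \<Omega> - ball x0 (l k) \<longrightarrow> pos_potential \<alpha> (modulus f) x < \<infinity>"
    by (subst AE_all_countable) (rule allI)
  moreover have "AE x in lebesgue. x \<noteq> x0" by (rule AE_completion[OF AE_lborel_singleton])
  ultimately have "AE x in lebesgue. x \<in> \<Omega> \<longrightarrow> pos_potential \<alpha> (modulus f) x < \<infinity>"
  proof eventually_elim
    case (elim x)
    have d: "0 < dist x0 x" using elim by simp
    obtain k :: nat where "diameter \<Omega> / dist x0 x < real k" using reals_Archimedean2 by blast
    then have "diameter \<Omega> < dist x0 x * real k" using d by (simp add: field_simps)
    also have "\<dots> \<le> dist x0 x * real (k + 2)" using d by (intro mult_left_mono) auto
    finally have "l k < dist x0 x" by (simp add: l_def divide_less_eq)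
    then have "x \<notin> ball x0 (l k)" by simp
    then show ?case using elim(1) by blast
  qed
  then show ?thesis using Om by (subst AE_restrict_space_iff) auto
qed

text \<open>
  The estimate is available for real \<open>M\<close> above the norm of \<open>f\<close> only; the norm itself, which may be 0,
  is reached by letting \<open>M\<close> decrease to it.
\<close>

lemma bounded_by_potential:
  assumes b: "0 < b" and f: "f \<in> comp_morrey_space \<Omega> x0 p \<omega>1"
    and T: "\<And>x. x \<in> \<Omega> \<Longrightarrow> pos_potential \<alpha> (modulus f) x < \<infinity> \<Longrightarrow>
       ennreal \<bar>T x\<bar> \<le> ennreal b * pos_potential \<alpha> (modulus f) x"
  shows "comp_morrey_norm \<Omega> x0 q \<omega>2 T \<le>
    ennreal (max 1 (potential_const x0) * b * C) * comp_morrey_norm \<Omega> x0 p \<omega>1 f"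
proof -
  define K1 where "K1 = max 1 (potential_const x0)"
  have K1: "1 \<le> K1" "potential_const x0 \<le> K1" by (auto simp: K1_def)
  define K where "K = K1 * b * C"
  have K: "0 < K" using K1 b C by (simp add: K_def)
  have Om: "\<Omega> \<in> sets lebesgue" using Omega by (rule fmeasurableD)
  define d where "d = real DIM('a) - real DIM('a) / q x0"
  have fm: "f \<in> borel_measurable (lebesgue_on \<Omega>)" and fN: "comp_morrey_norm \<Omega> x0 p \<omega>1 f < \<infinity>"
    using f by (auto simp: comp_morrey_space_def)
  have le_M: "comp_morrey_norm \<Omega> x0 q \<omega>2 T \<le> ennreal (K * M)"
    if M: "comp_morrey_norm \<Omega> x0 p \<omega>1 f < ennreal M" for M
    unfolding comp_morrey_norm_def
  proof (rule SUP_least)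
    fix t assume "t \<in> {0<..<diameter \<Omega>}"
    then have t: "0 < t" "t < diameter \<Omega>" by auto
    have M0: "0 < M" using M by (cases "0 < M") (auto simp: ennreal_neg)
    have \<omega>2: "0 < \<omega>2 t" using weight2 t by (rule morrey_weight_pos)
    define \<eta> where "\<eta> = b * (M * C * \<omega>2 t * t powr - d)"
    have \<eta>: "0 < \<eta>" using b M0 C \<omega>2 t by (simp add: \<eta>_def)
    obtain g where gm [measurable]: "g \<in> borel_measurable lebesgue"
      and gint: "(\<integral>\<^sup>+x\<in>\<Omega>. g x \<partial>lebesgue) \<le> ennreal (potential_const x0)"
      and g: "\<And>x. x \<in> \<Omega> - ball x0 t \<Longrightarrow> g x < \<infinity> \<Longrightarrow> \<exists>c\<ge>0.
         pos_potential \<alpha> (modulus f) x \<le> ennreal (c * (M * C * \<omega>2 t * t powr - d)) \<and>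
         ennreal (c powr q x) \<le> g x"
      using potential_estimate[OF fm M t] unfolding dominated_def d_def by blast
    have "luxemburg_norm q (\<Omega> - rel_ball \<Omega> x0 t) T \<le> ennreal (K1 * \<eta>)"
    proof (rule luxemburg_norm_le)
      show "1 \<le> q x" if "x \<in> \<Omega> - rel_ball \<Omega> x0 t" for x using q_bounds(1)[of x] that by simp
      show "\<Omega> - rel_ball \<Omega> x0 t \<in> sets lebesgue" using Om by measurable
      have "(\<integral>\<^sup>+x\<in>\<Omega> - rel_ball \<Omega> x0 t. g x \<partial>lebesgue) \<le> (\<integral>\<^sup>+x\<in>\<Omega>. g x \<partial>lebesgue)"
        by (intro nn_integral_mono) (auto simp: indicator_def)
      also note gint
      also have "ennreal (potential_const x0) \<le> ennreal K1" by (intro ennreal_leI K1)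
      finally show "(\<integral>\<^sup>+x\<in>\<Omega> - rel_ball \<Omega> x0 t. g x \<partial>lebesgue) \<le> ennreal K1" .
      have "AE x in lebesgue. g x * indicator \<Omega> x \<noteq> \<infinity>"
        using gint Om by (intro nn_integral_PInf_AE) (auto simp: top_unique)
      then show "AE x in lebesgue. x \<in> \<Omega> - rel_ball \<Omega> x0 t \<longrightarrow> ennreal (\<bar>T x / \<eta>\<bar> powr q x) \<le> g x"
      proof eventually_elim
        case (elim x)
        show ?case
        proof
          assume "x \<in> \<Omega> - rel_ball \<Omega> x0 t"
          then have x: "x \<in> \<Omega>" "x \<in> \<Omega> - ball x0 t" by auto
          then have "g x < \<infinity>" using elim by (simp add: less_top)
          then obtain c where c: "0 \<le> c"
            "pos_potential \<alpha> (modulus f) x \<le> ennreal (c * (M * C * \<omega>2 t * t powr - d))"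
            "ennreal (c powr q x) \<le> g x"
            using g[OF x(2)] by blast
          have "pos_potential \<alpha> (modulus f) x < \<infinity>" using c(2) by (rule le_less_trans) simp
          then have "ennreal \<bar>T x\<bar> \<le> ennreal b * pos_potential \<alpha> (modulus f) x" by (rule T[OF x(1)])
          also have "\<dots> \<le> ennreal b * ennreal (c * (M * C * \<omega>2 t * t powr - d))"
            by (intro mult_left_mono c) simp
          also have "\<dots> = ennreal (c * \<eta>)" using b by (simp add: ennreal_mult'[symmetric] \<eta>_def mult_ac)
          finally have "\<bar>T x\<bar> \<le> c * \<eta>" using c \<eta> by (simp add: ennreal_le_iff)
          then have "\<bar>T x / \<eta>\<bar> \<le> c" using \<eta> by (simp add: abs_divide divide_le_eq)
          then have "\<bar>T x / \<eta>\<bar> powr q x \<le> c powr q x"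
            using q_bounds(1)[OF x(1)] by (intro powr_mono2) auto
          then show "ennreal (\<bar>T x / \<eta>\<bar> powr q x) \<le> g x"
            using c(3) by (meson ennreal_leI order_trans)
        qed
      qed
    qed (fact \<eta> K1 gm)+
    then have "ennreal (t powr d / \<omega>2 t) * luxemburg_norm q (\<Omega> - rel_ball \<Omega> x0 t) T
      \<le> ennreal (t powr d / \<omega>2 t) * ennreal (K1 * \<eta>)"
      by (rule mult_left_mono) simp
    also have "ennreal (t powr d / \<omega>2 t) * ennreal (K1 * \<eta>) = ennreal (K * M)"
    proof -
      have "t powr d / \<omega>2 t * (K1 * \<eta>) = K * M * (t powr d * t powr - d)"
        using \<omega>2 by (simp add: \<eta>_def K_def)
      also have "t powr d * t powr - d = 1" using t by (simp add: powr_add[symmetric])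
      finally show ?thesis using \<omega>2 by (simp add: ennreal_mult'[symmetric])
    qed
    finally have *: "ennreal (t powr d / \<omega>2 t) * luxemburg_norm q (\<Omega> - rel_ball \<Omega> x0 t) T \<le> ennreal (K * M)" .
    have "morrey_factor x0 q \<omega>2 t = ennreal (t powr d / \<omega>2 t)"
      using \<omega>2 q_bounds(1)[OF x0] by (simp add: morrey_factor_def conj_exponent_eq divide_ennreal d_def)
    with * show "morrey_factor x0 q \<omega>2 t * luxemburg_norm q (\<Omega> - rel_ball \<Omega> x0 t) T \<le> ennreal (K * M)"
      by simp
  qed
  define N where "N = enn2real (comp_morrey_norm \<Omega> x0 p \<omega>1 f)"
  have N: "comp_morrey_norm \<Omega> x0 p \<omega>1 f = ennreal N" "0 \<le> N" using fN by (auto simp: N_def)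
  have "comp_morrey_norm \<Omega> x0 q \<omega>2 T \<le> ennreal (K * N)"
  proof (rule ennreal_le_epsilon)
    fix e :: real assume e: "0 < e"
    have "comp_morrey_norm \<Omega> x0 q \<omega>2 T \<le> ennreal (K * (N + e / K))"
      by (rule le_M) (use N K e in \<open>auto intro!: ennreal_lessI simp: add_nonneg_pos\<close>)
    also have "K * (N + e / K) = K * N + e" using K by (simp add: field_simps)
    finally show "comp_morrey_norm \<Omega> x0 q \<omega>2 T \<le> ennreal (K * N) + ennreal e"
      using K N e by (simp add: ennreal_plus)
  qed
  then show ?thesis unfolding K1_def[symmetric] K_def[symmetric] using K N by (simp add: ennreal_mult)
qed

lemma bounded_between_by_potential:
  assumes b: "0 < b"
    and Tm: "\<And>f. f \<in> borel_measurable (lebesgue_on \<Omega>) \<Longrightarrow> T f \<in> borel_measurable (lebesgue_on \<Omega>)"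
    and T: "\<And>f x. f \<in> borel_measurable (lebesgue_on \<Omega>) \<Longrightarrow> x \<in> \<Omega> \<Longrightarrow> pos_potential \<alpha> (modulus f) x < \<infinity> \<Longrightarrow>
         ennreal \<bar>T f x\<bar> \<le> ennreal b * pos_potential \<alpha> (modulus f) x"
  shows "bounded_between
       (comp_morrey_space \<Omega> x0 p \<omega>1) (comp_morrey_norm \<Omega> x0 p \<omega>1)
       (comp_morrey_space \<Omega> x0 q \<omega>2) (comp_morrey_norm \<Omega> x0 q \<omega>2) T"
  unfolding bounded_between_def
proof (intro exI[of _ "max 1 (potential_const x0) * b * C"] ballI conjI)
  fix f assume f: "f \<in> comp_morrey_space \<Omega> x0 p \<omega>1"
  then have fm: "f \<in> borel_measurable (lebesgue_on \<Omega>)" and fN: "comp_morrey_norm \<Omega> x0 p \<omega>1 f < \<infinity>"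
    by (auto simp: comp_morrey_space_def)
  show le: "comp_morrey_norm \<Omega> x0 q \<omega>2 (T f) \<le> ennreal (max 1 (potential_const x0) * b * C) * comp_morrey_norm \<Omega> x0 p \<omega>1 f"
    by (rule bounded_by_potential[OF b f T[OF fm]])
  also have "\<dots> < \<infinity>" using fN by (simp add: ennreal_mult_less_top)
  finally show "T f \<in> comp_morrey_space \<Omega> x0 q \<omega>2" using Tm[OF fm] by (simp add: comp_morrey_space_def)
qed

end

section \<open>Boundedness between complementary Morrey spaces\<close>

theorem theorem6p2:
  fixes \<Omega> :: "'a::euclidean_space set" and x\<^sub>0 :: 'a
    and p q \<alpha> :: "'a \<Rightarrow> real" and \<omega>\<^sub>1 \<omega>\<^sub>2 :: "real \<Rightarrow> real" and C :: real
  assumes "open \<Omega>" and "bounded \<Omega>" and "x\<^sub>0 \<in> \<Omega>"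
    and "p \<in> WL \<Omega>" and "\<alpha> \<in> WL \<Omega>"
    and "1 < exponent_lower \<Omega> p"
    and "\<forall>x\<in>\<Omega>. exponent_lower \<Omega> p \<le> ereal (p x) \<and> ereal (p x) \<le> exponent_upper \<Omega> p"
    and "exponent_upper \<Omega> p < \<infinity>"
    and "(INF x\<in>\<Omega>. ereal (\<alpha> x)) > 0"
    and "(SUP x\<in>\<Omega>. ereal (\<alpha> x * p x)) < ereal (real DIM('a))"
    and "\<forall>x\<in>\<Omega>. 1 / q x = 1 / p x - \<alpha> x / real DIM('a)"
    and "morrey_weight \<Omega> x\<^sub>0 p \<omega>\<^sub>1" and "morrey_weight \<Omega> x\<^sub>0 q \<omega>\<^sub>2"
    and "\<forall>t\<in>{0<..<diameter \<Omega>}.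
           ennreal (t powr \<alpha> x\<^sub>0) * (\<integral>\<^sup>+r\<in>{0<..<t}. ennreal (\<omega>\<^sub>1 r / r) \<partial>lebesgue)
             \<le> ennreal (C * \<omega>\<^sub>2 t)"
  shows "(\<forall>f\<in>comp_morrey_space \<Omega> x\<^sub>0 p \<omega>\<^sub>1. AE x in lebesgue_on \<Omega>. frac_maximal \<Omega> \<alpha> f x < \<infinity>) \<and>
     bounded_between
       (comp_morrey_space \<Omega> x\<^sub>0 p \<omega>\<^sub>1) (comp_morrey_norm \<Omega> x\<^sub>0 p \<omega>\<^sub>1)
       (comp_morrey_space \<Omega> x\<^sub>0 q \<omega>\<^sub>2) (comp_morrey_norm \<Omega> x\<^sub>0 q \<omega>\<^sub>2)
       (\<lambda>f x. enn2real (frac_maximal \<Omega> \<alpha> f x)) \<and>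
     (\<forall>f\<in>comp_morrey_space \<Omega> x\<^sub>0 p \<omega>\<^sub>1. AE x in lebesgue_on \<Omega>.
        set_integrable lebesgue \<Omega> (riesz_kernel_term \<alpha> f x)) \<and>
     bounded_between
       (comp_morrey_space \<Omega> x\<^sub>0 p \<omega>\<^sub>1) (comp_morrey_norm \<Omega> x\<^sub>0 p \<omega>\<^sub>1)
       (comp_morrey_space \<Omega> x\<^sub>0 q \<omega>\<^sub>2) (comp_morrey_norm \<Omega> x\<^sub>0 q \<omega>\<^sub>2)
       (riesz_potential \<Omega> \<alpha>)"
proof -
  have sup_diam: "dist x y \<le> diameter \<Omega>" if "x \<in> \<Omega>" "y \<in> \<Omega>" for x y
    using assms(2) that by (rule diameter_bounded_bound)
  obtain s P where s: "1 < s" and sP: "\<And>x. x \<in> \<Omega> \<Longrightarrow> s \<le> p x \<and> p x \<le> P"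
  proof -
    have le: "exponent_lower \<Omega> p \<le> ereal (p x\<^sub>0)" "ereal (p x\<^sub>0) \<le> exponent_upper \<Omega> p"
      using assms(3,7) by auto
    obtain s where s: "exponent_lower \<Omega> p = ereal s"
      using assms(6) le(1) by (cases "exponent_lower \<Omega> p") auto
    obtain P where P: "exponent_upper \<Omega> p = ereal P"
      using assms(8) le(2) by (cases "exponent_upper \<Omega> p") auto
    show thesis using that[of s P] assms(6,7) s P by simp
  qed
  have P: "1 < P" using s sP[OF assms(3)] by linarith
  obtain a0 where a0: "0 < a0" and \<alpha>_ge: "\<And>x. x \<in> \<Omega> \<Longrightarrow> a0 \<le> \<alpha> x"
  proof -
    obtain a where a: "0 < ereal a" "ereal a < (INF x\<in>\<Omega>. ereal (\<alpha> x))"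
      using ereal_dense2[OF assms(9)] by blast
    have "a \<le> \<alpha> x" if "x \<in> \<Omega>" for x
    proof -
      have "ereal a < ereal (\<alpha> x)" using a(2) INF_lower[OF that, of "\<lambda>x. ereal (\<alpha> x)"] by (rule less_le_trans)
      then show ?thesis by simp
    qed
    then show thesis using that[of a] a by simp
  qed
  obtain b where b: "b < real DIM('a)" and \<alpha>p: "\<And>x. x \<in> \<Omega> \<Longrightarrow> \<alpha> x * p x \<le> b"
  proof -
    obtain b where b: "(SUP x\<in>\<Omega>. ereal (\<alpha> x * p x)) < ereal b" "ereal b < ereal (real DIM('a))"
      using ereal_dense2[OF assms(10)] by blast
    have "\<alpha> x * p x \<le> b" if "x \<in> \<Omega>" for x
    proof -
      have "ereal (\<alpha> x * p x) < ereal b"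
        using SUP_upper[OF that, of "\<lambda>x. ereal (\<alpha> x * p x)"] b(1) by (rule le_less_trans)
      then show ?thesis by simp
    qed
    then show thesis using that[of b] b by simp
  qed
  \<comment> \<open>A lower bound of \<open>1/q = (n - \<alpha> p)/(n p)\<close>.\<close>
  define \<kappa> where "\<kappa> = (real DIM('a) - b) / (real DIM('a) * P)"
  have \<kappa>: "0 < \<kappa>" using b P by (simp add: \<kappa>_def)
  have q_ge: "\<kappa> \<le> 1 / q x" if x: "x \<in> \<Omega>" for x
  proof -
    have p: "1 < p x" "p x \<le> P" using sP[OF x] s by auto
    have "\<kappa> \<le> (real DIM('a) - \<alpha> x * p x) / (real DIM('a) * p x)"
      unfolding \<kappa>_def using p \<alpha>p[OF x] b by (intro frac_le mult_left_mono) auto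
    also have "\<dots> = 1 / p x - \<alpha> x / real DIM('a)" using p by (simp add: field_simps)
    finally show ?thesis using assms(11) x by simp
  qed
  define D where "D = max 1 (diameter \<Omega>)"
  obtain A where logA: "\<And>x y r. x \<in> \<Omega> \<Longrightarrow> y \<in> \<Omega> \<Longrightarrow> norm (x - y) \<le> r \<Longrightarrow> 0 < r \<Longrightarrow> r \<le> D \<Longrightarrow>
     \<bar>p x - p y\<bar> * \<bar>ln r\<bar> \<le> A"
  proof (rule WL_log_bound[OF assms(4), where B = P and D = D], goal_cases)
    case (1 x)
    then show ?case using sP[of x] s by auto
  next
    case 2
    then show ?case using P by simp
  next
    case 3
    then show ?case by (simp add: D_def)
  next
    case (4 A)
    show ?case by (rule that[OF 4(2)])
  qed
  have diam: "0 < diameter \<Omega>"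
  proof -
    obtain e where e: "0 < e" "ball x\<^sub>0 e \<subseteq> \<Omega>" using assms(1,3) open_contains_ball by blast
    obtain i :: 'a where i: "i \<in> Basis" using nonempty_Basis by blast
    define y where "y = x\<^sub>0 + (e / 2) *\<^sub>R i"
    have d: "dist x\<^sub>0 y = e / 2" using e i by (simp add: y_def dist_norm)
    then have "y \<in> \<Omega>" using e by (intro subsetD[OF e(2)]) simp
    then show ?thesis using sup_diam[OF assms(3), of y] d e by linarith
  qed
  \<comment> \<open>The constant \<open>C\<close> may be any real number, so it is enlarged to a positive one.\<close>
  interpret morrey_setting \<Omega> p \<alpha> q s P D A \<kappa> a0 x\<^sub>0 \<omega>\<^sub>1 \<omega>\<^sub>2 "max C 1"
  proof unfold_locales
    show "\<Omega> \<in> lmeasurable" using assms(1,2) by (rule lmeasurable_open[rotated])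
    have "(\<lambda>x. indicator \<Omega> x *\<^sub>R p x) \<in> borel_measurable borel"
      using assms(1) WL_continuous_on[OF assms(4)] by (intro borel_measurable_continuous_on_indicator borel_open)
    then have "(\<lambda>x. p x * indicator \<Omega> x) \<in> borel_measurable lborel" by (simp add: mult.commute)
    then show "(\<lambda>x. p x * indicator \<Omega> x) \<in> borel_measurable lebesgue" by (rule measurable_completion)
    show "norm (x - y) \<le> D" if "x \<in> \<Omega>" "y \<in> \<Omega>" for x y
      using sup_diam[OF that] by (simp add: D_def dist_norm)
    show "ennreal (t powr \<alpha> x\<^sub>0) * (\<integral>\<^sup>+r\<in>{0<..<t}. ennreal (\<omega>\<^sub>1 r / r) \<partial>lebesgue) \<le> ennreal (max C 1 * \<omega>\<^sub>2 t)"
      if t: "0 < t" "t < diameter \<Omega>" for t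
    proof -
      have "0 \<le> \<omega>\<^sub>2 t" using assms(13) t unfolding morrey_weight_def by simp
      then have "ennreal (C * \<omega>\<^sub>2 t) \<le> ennreal (max C 1 * \<omega>\<^sub>2 t)"
        by (intro ennreal_leI mult_right_mono) auto
      moreover have "ennreal (t powr \<alpha> x\<^sub>0) * (\<integral>\<^sup>+r\<in>{0<..<t}. ennreal (\<omega>\<^sub>1 r / r) \<partial>lebesgue) \<le> ennreal (C * \<omega>\<^sub>2 t)"
        using assms(14) t by simp
      ultimately show ?thesis by (rule order_trans[rotated])
    qed
    show "1 / q x = 1 / p x - \<alpha> x / real DIM('a)" if "x \<in> \<Omega>" for x using assms(11) that by simp
  qed (use s sP a0 \<alpha>_ge \<kappa> q_ge logA diam assms in \<open>auto simp: D_def\<close>)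
  have Om: "\<Omega> \<in> sets lebesgue" using Omega by (rule fmeasurableD)
  have \<alpha>c: "continuous_on \<Omega> \<alpha>" using assms(5) by (rule WL_continuous_on)
  have \<alpha>n: "\<alpha> x \<le> real DIM('a)" "0 \<le> \<alpha> x" if "x \<in> \<Omega>" for x using \<alpha>_le[OF that] \<alpha>_ge[OF that] a0 by auto
  define b where "b = 1 + 1 / unit_ball_vol (real DIM('a))"
  have b: "0 < b" by (simp add: b_def add_pos_nonneg)
  have maximal: "frac_maximal \<Omega> \<alpha> f x \<le> ennreal b * pos_potential \<alpha> (modulus f) x"
    if "f \<in> borel_measurable (lebesgue_on \<Omega>)" "x \<in> \<Omega>" for f x
    unfolding b_def modulus_def[abs_def] using that Om \<alpha>n by (intro frac_maximal_le_potential) auto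
  have 1: "AE x in lebesgue_on \<Omega>. frac_maximal \<Omega> \<alpha> f x < \<infinity>" if f: "f \<in> comp_morrey_space \<Omega> x\<^sub>0 p \<omega>\<^sub>1" for f
  proof -
    have fm: "f \<in> borel_measurable (lebesgue_on \<Omega>)" using f by (simp add: comp_morrey_space_def)
    have "AE x in lebesgue_on \<Omega>. x \<in> \<Omega>" by (intro AE_I2) auto
    then show ?thesis using AE_potential_finite[OF f]
    proof eventually_elim
      case (elim x)
      show ?case by (rule le_less_trans[OF maximal[OF fm elim(1)]]) (use elim in \<open>simp add: ennreal_mult_less_top\<close>)
    qed
  qed
  have 2: "bounded_between
       (comp_morrey_space \<Omega> x\<^sub>0 p \<omega>\<^sub>1) (comp_morrey_norm \<Omega> x\<^sub>0 p \<omega>\<^sub>1)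
       (comp_morrey_space \<Omega> x\<^sub>0 q \<omega>\<^sub>2) (comp_morrey_norm \<Omega> x\<^sub>0 q \<omega>\<^sub>2)
       (\<lambda>f x. enn2real (frac_maximal \<Omega> \<alpha> f x))"
  proof (rule bounded_between_by_potential[OF b])
    show "(\<lambda>x. enn2real (frac_maximal \<Omega> \<alpha> f x)) \<in> borel_measurable (lebesgue_on \<Omega>)"
      if f: "f \<in> borel_measurable (lebesgue_on \<Omega>)" for f
      using frac_maximal_measurable[OF assms(1) f \<alpha>c \<alpha>n(1)] by measurable
    show "ennreal \<bar>enn2real (frac_maximal \<Omega> \<alpha> f x)\<bar> \<le> ennreal b * pos_potential \<alpha> (modulus f) x"
      if f: "f \<in> borel_measurable (lebesgue_on \<Omega>)" "x \<in> \<Omega>" for f x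
    proof -
      have "ennreal \<bar>enn2real (frac_maximal \<Omega> \<alpha> f x)\<bar> \<le> frac_maximal \<Omega> \<alpha> f x"
        by (cases "frac_maximal \<Omega> \<alpha> f x") auto
      then show ?thesis using maximal[OF f] by (rule order_trans)
    qed
  qed
  have 3: "AE x in lebesgue_on \<Omega>. set_integrable lebesgue \<Omega> (riesz_kernel_term \<alpha> f x)"
    if f: "f \<in> comp_morrey_space \<Omega> x\<^sub>0 p \<omega>\<^sub>1" for f
  proof -
    have fm: "f \<in> borel_measurable (lebesgue_on \<Omega>)" using f by (simp add: comp_morrey_space_def)
    show ?thesis using AE_potential_finite[OF f]
    proof eventually_elim
      case (elim x)
      then show ?case using riesz_potential_le(1)[OF fm Om, of \<alpha> x] by (simp add: modulus_def[abs_def])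
    qed
  qed
  have 4: "bounded_between
       (comp_morrey_space \<Omega> x\<^sub>0 p \<omega>\<^sub>1) (comp_morrey_norm \<Omega> x\<^sub>0 p \<omega>\<^sub>1)
       (comp_morrey_space \<Omega> x\<^sub>0 q \<omega>\<^sub>2) (comp_morrey_norm \<Omega> x\<^sub>0 q \<omega>\<^sub>2)
       (riesz_potential \<Omega> \<alpha>)"
  proof (rule bounded_between_by_potential[OF zero_less_one])
    show "riesz_potential \<Omega> \<alpha> f \<in> borel_measurable (lebesgue_on \<Omega>)"
      if f: "f \<in> borel_measurable (lebesgue_on \<Omega>)" for f
      by (rule riesz_potential_measurable[OF assms(1) f \<alpha>c])
    show "ennreal \<bar>riesz_potential \<Omega> \<alpha> f x\<bar> \<le> ennreal 1 * pos_potential \<alpha> (modulus f) x"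
      if "f \<in> borel_measurable (lebesgue_on \<Omega>)" "pos_potential \<alpha> (modulus f) x < \<infinity>" for f x
      using riesz_potential_le(2)[OF that(1) Om, of \<alpha> x] that(2) by (simp add: modulus_def[abs_def])
  qed
  show ?thesis using 1 2 3 4 by blast
qed

end
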